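(* Let $C$ be an arbitrary (nonempty) simplicial complex in $\mathbb{R}^d$. (1) If the underlying space $|C|\subset\mathbb{R}^d$ is convex, then the (first) derived subdivision $\mathrm{sd}\, C$ is collapsible. (2) If $d\ge 2$ and the underlying space $|C|\subset\mathbb{R}^d$ is star-shaped, then the $(d-2)$-nd derived subdivision $\mathrm{sd}^{d-2} C$ is collapsible. (3) If $C$ collapses simplicially onto some subcomplex $C'$, then for every simplicial subdivision $D$ of $C$ the simplicial complex $\mathrm{sd}\, D$ collapses to the restriction of $\mathrm{sd}\, D$ to the underlying space of $C'$.
   Context: A simplicial complex in $\mathbb{R}^d$ is a finite collection of (geometric) simplices in $\mathbb{R}^d$, closed under taking faces, such that the intersection of any two of them is a face of both. Its underlying space $|C|$ is the union of its faces. A subset $X\subset\mathbb{R}^d$ is star-shaped if there is a point $x\in X$ (a star-center) such that for each $y\in X$ the segment $[x,y]$ lies in $X$. A subdivision of $C$ is a complex $D$ with $|D|=|C|$ such that every face of $D$ is contained in some face of $C$; it is a simplicial subdivision if $D$ is a simplicial complex. A derived subdivision $\mathrm{sd}\, C$ is any subdivision obtained by stellarly subdividing all faces of $C$ in order of decreasing dimension. Equivalently, one chooses a point in the relative interior of each nonempty face, and the simplices are the convex hulls of the points corresponding to chains of nonempty faces; its face poset is that of the order complex of the poset of nonempty faces of $C$. The barycentric subdivision is an example. The iterates are $\mathrm{sd}^0 C=C$, $\mathrm{sd}^{m}C=\mathrm{sd}(\mathrm{sd}^{m-1}C)$. For a complex $C$ and a set $A$, the restriction of $C$ to $A$ is the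 inclusion-maximal subcomplex of $C$ whose faces all lie in $A$. A free face $\sigma$ of $C$ is a nonempty face strictly contained in exactly one other face of $C$. An elementary collapse is the deletion of a free face $\sigma$, i.e. the passage from $C$ to the subcomplex $C-\sigma$ of all faces of $C$ not containing $\sigma$. $C$ collapses to a subcomplex $C'$ if $C$ can be reduced to $C'$ by a sequence of elementary collapses. $C$ is collapsible if it collapses onto a single vertex. *)

theory Defs
  imports "HOL-Analysis.Analysis"
begin

(* Complexes are those of HOL-Analysis.Polytope: by the closure under face_of, every complex with
   a member contains the empty face {}.  The underlying space of C is \<Union>C. *)

definition subcomplex :: "'a::euclidean_space set set \<Rightarrow> 'a set set \<Rightarrow> bool"
  where "subcomplex B C \<longleftrightarrow> simplicial_complex B \<and> B \<subseteq> C"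

definition simplicial_subdivision :: "'a::euclidean_space set set \<Rightarrow> 'a set set \<Rightarrow> bool"
  where "simplicial_subdivision C D \<longleftrightarrow>
    simplicial_complex D \<and> \<Union>D = \<Union>C \<and> (\<forall>F\<in>D. \<exists>G\<in>C. F \<subseteq> G)"

(* D is one of the derived subdivisions of C; the choice p of the subdividing points is arbitrary.
   The empty chain contributes the empty face. *)
definition derived_subdivision :: "'a::euclidean_space set set \<Rightarrow> 'a set set \<Rightarrow> bool"
  where "derived_subdivision C D \<longleftrightarrow>
    (\<exists>p. (\<forall>F \<in> C - {{}}. p F \<in> rel_interior F) \<and>
         D = {convex hull (p ` K) | K. subset.chain (C - {{}}) K})"

(* D is some m-th iterated derived subdivision of C; the choices in different steps are
   independent. *)
definition iterated_derived_subdivision ::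
    "nat \<Rightarrow> 'a::euclidean_space set set \<Rightarrow> 'a set set \<Rightarrow> bool"
  where "iterated_derived_subdivision m = derived_subdivision ^^ m"

definition restriction :: "'a::euclidean_space set set \<Rightarrow> 'a set \<Rightarrow> 'a set set"
  where "restriction C A = (GREATEST B. subcomplex B C \<and> (\<forall>F\<in>B. F \<subseteq> A))"

(* Two faces of a complex satisfy F \<subseteq> G iff F is a face of G, so inclusion is incidence. *)
definition free_face :: "'a::euclidean_space set set \<Rightarrow> 'a set \<Rightarrow> bool"
  where "free_face C \<sigma> \<longleftrightarrow> \<sigma> \<in> C \<and> \<sigma> \<noteq> {} \<and> (\<exists>!\<tau>. \<tau> \<in> C \<and> \<sigma> \<subset> \<tau>)"

definition deletion :: "'a::euclidean_space set set \<Rightarrow> 'a set \<Rightarrow> 'a set set"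
  where "deletion C \<sigma> = {\<tau> \<in> C. \<not> \<sigma> \<subseteq> \<tau>}"

definition elementary_collapse :: "'a::euclidean_space set set \<Rightarrow> 'a set set \<Rightarrow> bool"
  where "elementary_collapse C D \<longleftrightarrow> (\<exists>\<sigma>. free_face C \<sigma> \<and> D = deletion C \<sigma>)"

definition collapses_to :: "'a::euclidean_space set set \<Rightarrow> 'a set set \<Rightarrow> bool"
  where "collapses_to = elementary_collapse\<^sup>*\<^sup>*"

definition collapsible :: "'a::euclidean_space set set \<Rightarrow> bool"
  where "collapsible C \<longleftrightarrow> (\<exists>v. collapses_to C {{}, {v}})"

lemma subcomplex_filter:
  assumes "simplicial_complex C" and "\<And>F S. S \<in> C \<Longrightarrow> F face_of S \<Longrightarrow> P S \<Longrightarrow> P F"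
  shows "subcomplex {F \<in> C. P F} C"
  using assms unfolding subcomplex_def simplicial_complex_def by auto

lemma restriction_eq:
  assumes "simplicial_complex C"
  shows "restriction C A = {F \<in> C. F \<subseteq> A}"
  unfolding restriction_def
proof (rule Greatest_equality)
  show "subcomplex {F \<in> C. F \<subseteq> A} C \<and> (\<forall>F\<in>{F \<in> C. F \<subseteq> A}. F \<subseteq> A)"
    using subcomplex_filter[OF assms, of "\<lambda>F. F \<subseteq> A"] face_of_imp_subset by blast
qed (auto simp: subcomplex_def)

lemma elementary_collapse_subcomplex:
  assumes "simplicial_complex C" "elementary_collapse C D"
  shows "subcomplex D C"
  using assms subcomplex_filter[OF assms(1), of "\<lambda>F. \<not> \<sigma> \<subseteq> F" for \<sigma>] face_of_imp_subset
  unfolding elementary_collapse_def deletion_def by blast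

lemma collapses_to_subcomplex:
  assumes "simplicial_complex C" "collapses_to C D"
  shows "subcomplex D C"
  using assms(2) unfolding collapses_to_def
proof (induction rule: rtranclp_induct)
  case base
  then show ?case using assms(1) by (simp add: subcomplex_def)
next
  case (step D E)
  then show ?case using elementary_collapse_subcomplex unfolding subcomplex_def by blast
qed

lemma derived_subdivision_exists:
  assumes "simplicial_complex C"
  shows "\<exists>D. derived_subdivision C D"
proof -
  have "\<exists>x. x \<in> rel_interior F" if "F \<in> C - {{}}" for F
  proof -
    have "convex F"
      using assms that unfolding simplicial_complex_def simplex_def by fastforce
    then show ?thesis using that rel_interior_eq_empty by blast
  qed
  then obtain p where "\<forall>F \<in> C - {{}}. p F \<in> rel_interior F"
    by metis
  then show ?thesis
    unfolding derived_subdivision_def by blast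
qed

end

theory Submission
  imports Defs
begin

text \<open>The simplices of a derived subdivision of \<open>C\<close> are indexed by the chains of nonempty faces of \<open>C\<close>, and an
elementary collapse deletes two chains \<open>k\<close> and \<open>insert x k\<close>, where \<open>insert x k\<close> is the only remaining chain
properly containing \<open>k\<close>. The three claims therefore concern the order complex of the face poset; the positions of
the subdividing points matter only for showing that this correspondence is faithful.

The main idea is to sweep \<open>C\<close> from a point \<open>z\<close>. Every face \<open>F\<close> has a unique point nearest to \<open>z\<close>, which lies in the
relative interior of a unique face \<open>c F \<subseteq> F\<close>. Build up the order complex by adding faces in order of increasing
distance to \<open>z\<close>. The faces \<open>F\<close> with \<open>c F = \<kappa>\<close> arrive together, and all contain \<open>\<kappa>\<close>. A chain of such faces,
followed by faces that are nearer to \<open>z\<close>, is matched with the same chain with \<open>\<kappa>\<close> inserted or removed; only the chains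
whose sole member in the group is \<open>\<kappa>\<close> itself are left over. They are indexed by the chains of the faces \<open>\<tau> \<supset> \<kappa>\<close>
nearer to \<open>z\<close>, and these are precisely the faces \<open>\<tau>\<close> that enter an open half-space orthogonal to \<open>\<kappa>\<close>, pointing from
the nearest point of \<open>\<kappa>\<close> towards \<open>z\<close>. The same problem has thus reappeared in the cone of directions at \<open>\<kappa>\<close>,
with that direction in place of \<open>z\<close>, and induction on \<open>\<kappa>\<close> applies. To make all steps literally the same, \<open>C\<close> is placed
at height one over the origin, so that its faces span a simplicial fan; the induction step is \<open>chains_vanish\<close>.

What makes the induction work is that the position of the half-space remembers \<open>z\<close>. If the segment from each point of
\<open>C\<close> to \<open>z\<close> stays in \<open>C\<close> near that point, then some face above \<open>\<kappa>\<close> points towards \<open>z\<close>, so the set of nearer faces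
is nonempty and its order complex is collapsible by induction. The condition only asks that the fixed direction lies in a
wedge over \<open>F\<close>, for every face \<open>F\<close>; subtracting a vector in the span of \<open>\<kappa>\<close> does not affect it for \<open>F \<supseteq> \<kappa>\<close>.
This is why convexity can be weakened to star-shapedness. More generally, if \<open>z\<close> lies outside \<open>C\<close> and the faces from
which the motion towards \<open>z\<close> leaves \<open>C\<close> at once form a subcomplex \<open>B\<close>, then all chains not contained in \<open>B\<close> are removed.

For a star-centre \<open>z\<close> this shows that every derived subdivision of a star-shaped complex is collapsible, which gives the first claim,
and also the second one in dimension at least three, since subdividing preserves the underlying space.
For the third claim it suffices to follow one elementary collapse, which deletes a simplex \<open>\<tau>\<close> and its facet \<open>\<sigma>\<close>. Seen
from a point \<open>z\<close> beyond the vertex of \<open>\<tau>\<close> opposite to \<open>\<sigma>\<close>, the visible part \<open>B\<close> of the boundary of \<open>\<tau>\<close> is what is to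
remain, so the general form, applied to the subdivision of \<open>\<tau>\<close>, removes all other chains.

In the plane the second claim is about \<open>C\<close> itself. Collapse \<open>C\<close> as far as possible. If a triangle were left, then
the triangles that are left would have no free edge, and the chains inside them would obstruct the collapse of
the derived subdivision. So a graph is left; it is connected, and its Euler characteristic is one because the derived
subdivision is collapsible. Without vertices of degree one, such a graph is a point.\<close>

section \<open>Removing a pair of sets\<close>

text \<open>The family \<open>X\<close> need not be closed under subsets, so that the chains of a complex outside a subcomplex are covered. If it
is closed and \<open>s\<close> is nonempty, then this is an elementary collapse.\<close>

definition pair_removal :: "'v set set \<Rightarrow> 'v set set \<Rightarrow> bool"
  where "pair_removal X Y \<longleftrightarrow> (\<exists>s x. x \<notin> s \<and> s \<in> X \<and> insert x s \<in> X \<and>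
    (\<forall>u\<in>X. s \<subseteq> u \<longrightarrow> u = s \<or> u = insert x s) \<and> Y = X - {s, insert x s})"

text \<open>For a simplicial complex, the empty set included, this is collapsibility: the empty set can only disappear in the last
step, together with the last vertex.\<close>

definition vanishes :: "'v set set \<Rightarrow> bool"
  where "vanishes X \<longleftrightarrow> pair_removal^** X {}"

lemma pair_removals_subset: "pair_removal^** X Y \<Longrightarrow> Y \<subseteq> X"
  by (induction rule: rtranclp_induct) (auto simp: pair_removal_def)

text \<open>Whether a pair can be removed depends only on the sets above it, so sets that lie above none of the removed ones may be
added.\<close>

lemma pair_removals_frame:
  assumes "pair_removal^** X Y" and "\<And>z x. z \<in> Z \<Longrightarrow> x \<in> X - Y \<Longrightarrow> \<not> x \<subseteq> z"
  shows "pair_removal^** (X \<union> Z) (Y \<union> Z)"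
  using assms
proof (induction rule: converse_rtranclp_induct)
  case (step X X1)
  from step.hyps(1) obtain s x where sx: "x \<notin> s" "s \<in> X" "insert x s \<in> X"
    "\<forall>u\<in>X. s \<subseteq> u \<longrightarrow> u = s \<or> u = insert x s" "X1 = X - {s, insert x s}"
    unfolding pair_removal_def by blast
  have "Y \<subseteq> X1" using step.hyps(2) by (rule pair_removals_subset)
  then have notY: "s \<in> X - Y" "insert x s \<in> X - Y" using sx by auto
  then have up: "\<And>z. z \<in> Z \<Longrightarrow> \<not> s \<subseteq> z" "insert x s \<notin> Z" "s \<notin> Z"
    using step.prems by blast+
  have "pair_removal (X \<union> Z) (X1 \<union> Z)"
    unfolding pair_removal_def
  proof (intro exI conjI)
    show "X1 \<union> Z = X \<union> Z - {s, insert x s}" using sx(5) up by auto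
  qed (use sx up in auto)
  moreover have "pair_removal^** (X1 \<union> Z) (Y \<union> Z)"
    using step.IH step.prems sx(5) by blast
  ultimately show ?case by (rule converse_rtranclp_into_rtranclp)
qed simp

lemma vanishes_empty [simp]: "vanishes {}"
  by (simp add: vanishes_def)

lemma vanishes_Un:
  assumes "vanishes X" "vanishes Z" "\<And>z x. z \<in> Z \<Longrightarrow> x \<in> X \<Longrightarrow> \<not> x \<subseteq> z"
  shows "vanishes (X \<union> Z)"
  using pair_removals_frame[of X "{}" Z] assms unfolding vanishes_def
  by (simp add: rtranclp_trans)

text \<open>A fibre of \<open>g\<close> at which \<open>r\<close> is maximal is closed upwards in \<open>X\<close>, so it can be removed first.\<close>

lemma vanishes_patchwork:
  fixes r :: "'v set \<Rightarrow> real"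
  assumes "finite X"
    and "\<And>k k'. k \<in> X \<Longrightarrow> k' \<in> X \<Longrightarrow> k \<subseteq> k' \<Longrightarrow> r k < r k' \<or> g k = g k'"
    and "\<And>k k'. k \<in> X \<Longrightarrow> k' \<in> X \<Longrightarrow> g k = g k' \<Longrightarrow> r k = r k'"
    and "\<And>k. k \<in> X \<Longrightarrow> vanishes {k' \<in> X. g k' = g k}"
  shows "vanishes X"
  using assms
proof (induction "card X" arbitrary: X rule: less_induct)
  case less
  show ?case
  proof (cases "X = {}")
    case False
    obtain k where k: "k \<in> X" "\<And>k'. k' \<in> X \<Longrightarrow> r k' \<le> r k"
      using less.prems(1) False obtains_MAX[of X r] by (metis Max_ge finite_imageI image_eqI)
    define A where "A = {k' \<in> X. g k' = g k}"
    have "X - A \<subset> X" using k unfolding A_def by blast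
    then have cardA: "card (X - A) < card X" using less.prems(1) psubset_card_mono by blast
    have fib: "vanishes {k' \<in> X - A. g k' = g l}" if "l \<in> X - A" for l
    proof -
      have "{k' \<in> X - A. g k' = g l} = {k' \<in> X. g k' = g l}" using that unfolding A_def by auto
      then show ?thesis using less.prems(4) that by auto
    qed
    have finA: "finite (X - A)" using less.prems(1) by simp
    have mono: "\<And>k k'. k \<in> X - A \<Longrightarrow> k' \<in> X - A \<Longrightarrow> k \<subseteq> k' \<Longrightarrow> r k < r k' \<or> g k = g k'"
      using less.prems(2) by blast
    have const: "\<And>k k'. k \<in> X - A \<Longrightarrow> k' \<in> X - A \<Longrightarrow> g k = g k' \<Longrightarrow> r k = r k'"
      using less.prems(3) by blast
    have "vanishes A" using less.prems(4) k unfolding A_def by blast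
    moreover have "vanishes (X - A)" by (rule less.hyps[OF cardA finA mono const fib])
    moreover have "\<not> x \<subseteq> z" if "z \<in> X - A" "x \<in> A" for x z
    proof
      assume "x \<subseteq> z"
      then have "r x < r z" using that less.prems(2)[of x z] unfolding A_def by auto
      moreover have "r x = r k" using that k less.prems(3) unfolding A_def by blast
      ultimately show False using k(2)[of z] that by simp
    qed
    ultimately have "vanishes (A \<union> (X - A))" by (rule vanishes_Un)
    moreover have "A \<union> (X - A) = X" unfolding A_def by blast
    ultimately show ?thesis by simp
  qed simp
qed

text \<open>Remove the pairs \<open>k - {a}\<close>, \<open>insert a k\<close>, the largest first.\<close>

lemma vanishes_cone:
  assumes "finite X" and "\<And>k. k \<in> X \<Longrightarrow> finite k"
    and "\<And>k. k \<in> X \<Longrightarrow> insert a k \<in> X" and "\<And>k. k \<in> X \<Longrightarrow> k - {a} \<in> X"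
  shows "vanishes X"
proof (rule vanishes_patchwork[where g = "\<lambda>k. k - {a}" and r = "\<lambda>k. real (card (k - {a}))"])
  fix k k' assume *: "k \<in> X" "k' \<in> X" "k \<subseteq> k'"
  have "card (k - {a}) < card (k' - {a})" if "k - {a} \<noteq> k' - {a}"
    by (rule psubset_card_mono) (use * that assms(2) in blast)+
  then show "real (card (k - {a})) < real (card (k' - {a})) \<or> k - {a} = k' - {a}"
    by auto
next
  fix k assume k: "k \<in> X"
  let ?s = "k - {a}"
  have "{k' \<in> X. k' - {a} = ?s} = {?s, insert a ?s}"
    using assms(3)[OF k] assms(4)[OF k] by auto
  moreover have "pair_removal {?s, insert a ?s} {}"
    unfolding pair_removal_def by (rule exI[of _ ?s], rule exI[of _ a]) auto
  ultimately show "vanishes {k' \<in> X. k' - {a} = ?s}"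
    unfolding vanishes_def by (metis r_into_rtranclp)
qed (use assms(1) in auto)

text \<open>The hypotheses say that \<open>\<phi>\<close> preserves inclusion in both directions and adjacent pairs.\<close>

lemma vanishes_image:
  assumes "vanishes X"
    and emb: "\<And>s t. s \<in> X \<Longrightarrow> t \<in> X \<Longrightarrow> \<phi> s \<subseteq> \<phi> t \<longleftrightarrow> s \<subseteq> t"
    and ins: "\<And>s x. s \<in> X \<Longrightarrow> insert x s \<in> X \<Longrightarrow> \<exists>y. \<phi> (insert x s) = insert y (\<phi> s)"
  shows "vanishes (\<phi> ` X)"
proof -
  have inj: "inj_on \<phi> X"
    using emb by (intro inj_onI subset_antisym) (metis order_refl)+
  have "pair_removal^** (\<phi> ` X) (\<phi> ` Y)" if "pair_removal^** X Y" for Y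
    using that
  proof (induction rule: rtranclp_induct)
    case (step Y Z)
    obtain s x where sx: "x \<notin> s" "s \<in> Y" "insert x s \<in> Y"
      "\<forall>u\<in>Y. s \<subseteq> u \<longrightarrow> u = s \<or> u = insert x s" "Z = Y - {s, insert x s}"
      using step.hyps(2) unfolding pair_removal_def by blast
    have Y: "Y \<subseteq> X" using pair_removals_subset[OF step.hyps(1)] .
    obtain y where y: "\<phi> (insert x s) = insert y (\<phi> s)" using ins[of s x] sx Y by blast
    have "pair_removal (\<phi> ` Y) (\<phi> ` Z)"
      unfolding pair_removal_def
    proof (intro exI conjI ballI impI)
      show "y \<notin> \<phi> s"
      proof
        assume "y \<in> \<phi> s"
        then have "\<phi> (insert x s) \<subseteq> \<phi> s" using y by auto
        then show False using emb[of "insert x s" s] sx Y by blast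
      qed
      show "\<phi> s \<in> \<phi> ` Y" "insert y (\<phi> s) \<in> \<phi> ` Y"
        using imageI[OF sx(2), of \<phi>] imageI[OF sx(3), of \<phi>] unfolding y by blast+
      show "u = \<phi> s \<or> u = insert y (\<phi> s)" if u: "u \<in> \<phi> ` Y" "\<phi> s \<subseteq> u" for u
      proof -
        obtain u' where u': "u' \<in> Y" "u = \<phi> u'" using u(1) by blast
        then have "s \<subseteq> u'" using emb[of s u'] u(2) sx(2) Y by blast
        then show ?thesis using sx(4) u' y by metis
      qed
      show "\<phi> ` Z = \<phi> ` Y - {\<phi> s, insert y (\<phi> s)}"
      proof -
        have "Y - {s, insert x s} \<subseteq> X" "{s, insert x s} \<subseteq> X" using sx(2,3) Y by auto
        then show ?thesis
          using inj_on_image_set_diff[OF inj, of Y "{s, insert x s}"] by (simp add: y sx(5))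
      qed
    qed
    then show ?case using step.IH by simp
  qed simp
  from this[of "{}"] assms(1) show ?thesis by (simp add: vanishes_def)
qed

lemma vanishes_imp_to_vertex:
  assumes "vanishes X" "{} \<in> X"
  obtains x where "pair_removal^** X {{}, {x}}"
proof -
  have "\<exists>x. pair_removal^** X {{}, {x}}"
    using assms unfolding vanishes_def
  proof (induction rule: converse_rtranclp_induct)
    case (step X X1)
    obtain s x where sx: "x \<notin> s" "s \<in> X" "insert x s \<in> X"
      "\<forall>u\<in>X. s \<subseteq> u \<longrightarrow> u = s \<or> u = insert x s" "X1 = X - {s, insert x s}"
      using step.hyps(1) unfolding pair_removal_def by blast
    show ?case
    proof (cases "s = {}")
      case True
      then have "X = {{}, {x}}" using sx by blast
      then show ?thesis by blast
    next
      case False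
      then have "{} \<in> X1" using sx step.prems by blast
      then show ?thesis using step.IH step.hyps(1) by (meson converse_rtranclp_into_rtranclp)
    qed
  qed simp
  then show ?thesis using that by blast
qed

section \<open>Sweeping an order complex\<close>

text \<open>If \<open>\<beta>\<close> stands for \<open>\<kappa> \<in> B\<close>, then these are the chains \<open>k\<close> in \<open>Q\<close> for which \<open>insert \<kappa> k\<close> is not contained in \<open>B\<close>:
the link of \<open>\<kappa>\<close> in the order complex relative to \<open>B\<close>. The empty chain belongs to it exactly if \<open>\<kappa> \<notin> B\<close>.\<close>

definition chains_off :: "bool \<Rightarrow> 'v set set \<Rightarrow> 'v set set \<Rightarrow> 'v set set set"
  where "chains_off \<beta> Q B = {k. subset.chain Q k \<and> (\<beta> \<longrightarrow> \<not> k \<subseteq> B)}"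

lemma chain_subsetI: "subset.chain Q k \<Longrightarrow> k' \<subseteq> k \<Longrightarrow> subset.chain Q k'"
  by (auto simp: subset_chain_def subset_iff)

lemma finite_chain_Inter_mem:
  assumes "subset.chain Q k" "finite k" "k \<noteq> {}"
  shows "\<Inter>k \<in> k"
  by (rule Inter_in_chain[OF assms(2,3,1)])

text \<open>Here \<open>f\<close> is the time at which a face is reached, and \<open>c\<close> assigns to it the least face of the group in which it is reached.
Since larger faces are reached earlier, the least member of a chain tells when the chain is complete. In the group of \<open>\<kappa>\<close>, all chains
that contain another member of the group cancel by inserting or removing \<open>\<kappa>\<close>, and the remaining ones form the link of \<open>\<kappa>\<close>.
If the empty chain has to be removed too, it is absorbed by the group of \<open>\<iota>\<close>, which is reached before all others and
is a cone in its own right.\<close>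

lemma vanishes_sweep:
  fixes f :: "'v set \<Rightarrow> real" and c :: "'v set \<Rightarrow> 'v set"
  assumes fin: "finite Q"
    and c: "\<And>\<sigma>. \<sigma> \<in> Q \<Longrightarrow> c \<sigma> \<in> Q \<and> c \<sigma> \<subseteq> \<sigma> \<and> f (c \<sigma>) = f \<sigma>"
    and f: "\<And>\<sigma> \<tau>. \<sigma> \<in> Q \<Longrightarrow> \<tau> \<in> Q \<Longrightarrow> \<sigma> \<subseteq> \<tau> \<Longrightarrow> f \<tau> < f \<sigma> \<or> (f \<tau> = f \<sigma> \<and> c \<tau> = c \<sigma>)"
    and B: "\<And>\<sigma> \<tau>. \<sigma> \<in> Q \<Longrightarrow> \<tau> \<in> B \<Longrightarrow> \<sigma> \<subseteq> \<tau> \<Longrightarrow> \<sigma> \<in> B"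
    and \<beta>: "\<beta> \<or> Q \<inter> B = {}"
    and link: "\<And>\<kappa>. \<kappa> \<in> Q \<Longrightarrow> c \<kappa> = \<kappa> \<Longrightarrow> \<beta> \<or> \<kappa> \<noteq> \<iota> \<Longrightarrow>
      vanishes (chains_off (\<kappa> \<in> B) {\<tau> \<in> Q. \<kappa> \<subset> \<tau> \<and> f \<tau> < f \<kappa>} B)"
    and exc: "\<not> \<beta> \<Longrightarrow> \<iota> \<in> Q \<and> c \<iota> = \<iota> \<and> (\<forall>\<tau>\<in>Q. f \<iota> < f \<tau> \<or> f \<iota> = f \<tau> \<and> c \<tau> = \<iota>)"
  shows "vanishes (chains_off \<beta> Q B)"
proof -
  define X where "X = chains_off \<beta> Q B"
  \<comment> \<open>The empty chain is counted to the group of \<open>\<iota>\<close>, the first one to be reached.\<close>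
  define g where "g k = (if k = {} then \<iota> else c (\<Inter>k))" for k
  have cc: "c (c \<sigma>) = c \<sigma>" if "\<sigma> \<in> Q" for \<sigma>
    using f[of "c \<sigma>" \<sigma>] c[OF that] that by auto
  have XD: "k \<subseteq> Q" "finite k" "subset.chain Q k" "\<beta> \<Longrightarrow> \<not> k \<subseteq> B" if "k \<in> X" for k
  proof -
    show kQ: "k \<subseteq> Q" "subset.chain Q k" "\<beta> \<Longrightarrow> \<not> k \<subseteq> B"
      using that unfolding X_def chains_off_def subset_chain_def by auto
    show "finite k" by (rule finite_subset[OF kQ(1) fin])
  qed
  have finX: "finite X"
    using finite_subset[of X "Pow Q"] fin XD(1) by blast
  have min: "\<Inter>k \<in> k" "\<Inter>k \<in> Q" if k: "k \<in> X" "k \<noteq> {}" for k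
  proof -
    show "\<Inter>k \<in> k" by (rule finite_chain_Inter_mem[OF XD(3,2)]) (fact k)+
    then show "\<Inter>k \<in> Q" using XD(1)[OF k(1)] by (rule subsetD[rotated])
  qed
  have gQ: "g k \<in> Q \<and> c (g k) = g k" if k: "k \<in> X" for k
  proof (cases "k = {}")
    case True
    then have "\<not> \<beta>" using XD(4)[OF k] by auto
    from exc[OF this] show ?thesis unfolding g_def using True by simp
  next
    case False
    have "\<Inter>k \<in> Q" by (rule min(2)[OF k False])
    then show ?thesis using c cc False unfolding g_def by simp
  qed
  have fiber: "vanishes {k \<in> X. g k = \<kappa>}" if \<kappa>: "\<kappa> \<in> Q" "c \<kappa> = \<kappa>" for \<kappa>
  proof (cases "\<beta> \<or> \<kappa> \<noteq> \<iota>")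
    case False
    then have nb: "\<not> \<beta>" and \<iota>: "\<kappa> = \<iota>" by auto
    have all: "\<iota> \<subseteq> \<tau> \<and> c \<tau> = \<iota>" if "k \<in> X" "g k = \<iota>" "\<tau> \<in> k" for k \<tau>
    proof -
      have ne: "k \<noteq> {}" using that by blast
      obtain m where m: "m = \<Inter>k" by blast
      have mQ: "m \<in> Q" unfolding m by (rule min(2)[OF that(1) ne])
      have m\<tau>: "m \<subseteq> \<tau>" unfolding m by (rule Inter_lower[OF that(3)])
      have cm: "c m = \<iota>" using that(2) ne unfolding g_def m by simp
      have \<tau>: "\<tau> \<in> Q" using XD(1)[OF that(1)] that(3) by blast
      have "f m = f \<iota>" using c[OF mQ] cm by simp
      moreover have "f \<iota> < f \<tau> \<or> f \<iota> = f \<tau>" using exc[OF nb] \<tau> by blast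
      ultimately have "\<not> f \<tau> < f m" by linarith
      then have "c \<tau> = \<iota>" using f[OF mQ \<tau> m\<tau>] cm by simp
      then show ?thesis using c[OF \<tau>] by metis
    qed
    show ?thesis unfolding \<iota>
    proof (rule vanishes_cone[where a = \<iota>])
      fix k assume "k \<in> {k \<in> X. g k = \<iota>}"
      then have k: "k \<in> X" "g k = \<iota>" by auto
      have "subset.chain Q (insert \<iota> k)"
        using all[OF k] exc[OF nb] XD(3)[OF k(1)] unfolding subset_chain_insert by blast
      moreover have "\<Inter>(insert \<iota> k) = \<iota>" using all[OF k] by blast
      ultimately show "insert \<iota> k \<in> {k \<in> X. g k = \<iota>}"
        using nb exc[OF nb] unfolding X_def chains_off_def g_def by auto
      have kX: "k - {\<iota>} \<in> X"
        using chain_subsetI[OF XD(3)[OF k(1)], of "k - {\<iota>}"] nb unfolding X_def chains_off_def by auto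
      show "k - {\<iota>} \<in> {k \<in> X. g k = \<iota>}"
      proof (cases "k - {\<iota>} = {}")
        case True
        then show ?thesis using kX unfolding g_def by auto
      next
        case False
        then have "\<Inter>(k - {\<iota>}) \<in> k" using min(1)[OF kX] by blast
        then show ?thesis using all[OF k] kX False unfolding g_def by auto
      qed
    qed (use finX XD in auto)
  next
    case True
    have ne: "k \<noteq> {}" if "k \<in> X" "g k = \<kappa>" for k
      using that True XD(4)[OF that(1)] unfolding g_def by auto
    have above: "\<kappa> \<subseteq> \<tau> \<and> (f \<tau> < f \<kappa> \<or> f \<tau> = f \<kappa> \<and> c \<tau> = \<kappa>)" if "k \<in> X" "g k = \<kappa>" "\<tau> \<in> k" for k \<tau>
    proof -
      obtain m where m: "m = \<Inter>k" by blast
      have mQ: "m \<in> Q" unfolding m by (rule min(2)[OF that(1) ne[OF that(1,2)]])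
      have m\<tau>: "m \<subseteq> \<tau>" unfolding m by (rule Inter_lower[OF that(3)])
      have cm: "c m = \<kappa>" using that(2) ne[OF that(1,2)] unfolding g_def m by simp
      have \<tau>: "\<tau> \<in> Q" using XD(1)[OF that(1)] that(3) by blast
      have "f \<tau> < f m \<or> f \<tau> = f m \<and> c \<tau> = c m" by (rule f[OF mQ \<tau> m\<tau>])
      moreover have "\<kappa> \<subseteq> m" "f m = f \<kappa>" using c[OF mQ] cm by auto
      ultimately show ?thesis using cm m\<tau> by (metis subset_trans)
    qed
    define Y where "Y = {k \<in> X. g k = \<kappa>}"
    \<comment> \<open>\<open>Y1\<close> collects the chains with a further member in the group of \<open>\<kappa>\<close>; the others correspond to the link of \<open>\<kappa>\<close>.\<close>
    define Y1 where "Y1 = {k \<in> Y. \<exists>\<sigma>\<in>k. \<sigma> \<noteq> \<kappa> \<and> c \<sigma> = \<kappa>}"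
    have "vanishes Y1"
    proof (rule vanishes_cone[where a = \<kappa>])
      fix k assume k1: "k \<in> Y1"
      then obtain \<sigma> where k: "k \<in> X" "g k = \<kappa>" and \<sigma>: "\<sigma> \<in> k" "\<sigma> \<noteq> \<kappa>" "c \<sigma> = \<kappa>"
        unfolding Y1_def Y_def by blast
      have "subset.chain Q (insert \<kappa> k)"
        using above[OF k] \<kappa>(1) XD(3)[OF k(1)] unfolding subset_chain_insert by blast
      then have "insert \<kappa> k \<in> X" using XD(4)[OF k(1)] unfolding X_def chains_off_def by auto
      moreover have "\<Inter>(insert \<kappa> k) = \<kappa>" using above[OF k] by auto
      ultimately show "insert \<kappa> k \<in> Y1"
        using \<sigma> \<kappa> unfolding Y1_def Y_def g_def by auto
      have \<sigma>': "\<sigma> \<in> k - {\<kappa>}" using \<sigma> by auto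
      have sub: "\<kappa> \<in> B" if "\<sigma> \<in> B" using B[OF \<kappa>(1) that] above[OF k \<sigma>(1)] by auto
      then have "\<not> k - {\<kappa>} \<subseteq> B" if \<beta> using XD(4)[OF k(1) that] \<sigma>' by blast
      then have kX: "k - {\<kappa>} \<in> X"
        using chain_subsetI[OF XD(3)[OF k(1)], of "k - {\<kappa>}"] unfolding X_def chains_off_def by auto
      have m: "\<Inter>(k - {\<kappa>}) \<in> k - {\<kappa>}" using min(1)[OF kX] \<sigma>' by blast
      have "c (\<Inter>(k - {\<kappa>})) = \<kappa>"
      proof -
        let ?m = "\<Inter>(k - {\<kappa>})"
        have "?m \<subseteq> \<sigma>" using \<sigma>' by blast
        moreover have "?m \<in> Q" "\<sigma> \<in> Q" using m \<sigma>' XD(1)[OF k(1)] by auto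
        ultimately have "f \<sigma> < f ?m \<or> c \<sigma> = c ?m" using f[of ?m \<sigma>] by blast
        moreover have "f \<sigma> = f \<kappa>" using c[OF \<open>\<sigma> \<in> Q\<close>] \<sigma>(3) by auto
        moreover have "f ?m \<le> f \<kappa>" using above[OF k, of ?m] m by auto
        ultimately show ?thesis using \<sigma>(3) by (metis linorder_not_less)
      qed
      moreover have "k - {\<kappa>} \<noteq> {}" using \<sigma>' by blast
      ultimately have "g (k - {\<kappa>}) = \<kappa>" unfolding g_def by (simp only: if_False)
      then show "k - {\<kappa>} \<in> Y1" using kX \<sigma>' \<sigma>(2,3) unfolding Y1_def Y_def by blast
    qed (use finX XD in \<open>auto simp: Y1_def Y_def\<close>)
    moreover have "vanishes (Y - Y1)"
    proof -
      let ?Q = "{\<tau> \<in> Q. \<kappa> \<subset> \<tau> \<and> f \<tau> < f \<kappa>}"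
      let ?L = "chains_off (\<kappa> \<in> B) ?Q B"
      have eq: "Y - Y1 = insert \<kappa> ` ?L"
      proof (intro subset_antisym subsetI)
        fix k assume kY: "k \<in> Y - Y1"
        then have k: "k \<in> X" "g k = \<kappa>" and no: "\<And>\<sigma>. \<sigma> \<in> k \<Longrightarrow> c \<sigma> = \<kappa> \<Longrightarrow> \<sigma> = \<kappa>"
          unfolding Y1_def Y_def by auto
        have "c (\<Inter>k) = \<kappa>" using k(2) ne[OF k] unfolding g_def by auto
        then have \<kappa>k: "\<kappa> \<in> k" using no[of "\<Inter>k"] min(1)[OF k(1) ne[OF k]] by auto
        have "k - {\<kappa>} \<subseteq> ?Q" using above[OF k] no XD(1)[OF k(1)] by fastforce
        then have "subset.chain ?Q (k - {\<kappa>})"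
          using XD(3)[OF k(1)] unfolding subset_chain_def by blast
        moreover have "\<kappa> \<in> B \<longrightarrow> \<not> k - {\<kappa>} \<subseteq> B" using \<beta> \<kappa>(1) XD(4)[OF k(1)] by blast
        ultimately have L: "k - {\<kappa>} \<in> ?L" unfolding chains_off_def by auto
        have "k = insert \<kappa> (k - {\<kappa>})" using \<kappa>k by blast
        then show "k \<in> insert \<kappa> ` ?L" using L by (rule image_eqI)
      next
        fix k assume "k \<in> insert \<kappa> ` ?L"
        then obtain l where l: "l \<in> ?L" "k = insert \<kappa> l" by blast
        then have lQ: "l \<subseteq> ?Q" and ch: "subset.chain Q l" and lB: "\<kappa> \<in> B \<Longrightarrow> \<not> l \<subseteq> B"
          unfolding chains_off_def subset_chain_def by auto
        have "subset.chain Q k" unfolding l(2)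
          using lQ \<kappa>(1) ch unfolding subset_chain_insert by blast
        moreover have "\<Inter>k = \<kappa>" using l(2) lQ by blast
        moreover have "\<beta> \<longrightarrow> \<not> k \<subseteq> B" using l(2) lB by auto
        ultimately have "k \<in> Y" using \<kappa>(2) l(2) unfolding Y_def X_def chains_off_def g_def by auto
        moreover have "k \<notin> Y1"
        proof
          assume "k \<in> Y1"
          then obtain \<sigma> where "\<sigma> \<in> l" "c \<sigma> = \<kappa>" using l(2) unfolding Y1_def by blast
          moreover from this have "\<sigma> \<in> Q" "f \<sigma> < f \<kappa>" using lQ by auto
          ultimately show False using c[of \<sigma>] by simp
        qed
        ultimately show "k \<in> Y - Y1" by blast
      qed
      have nin: "\<kappa> \<notin> k" if "k \<in> ?L" for k
        using that unfolding chains_off_def subset_chain_def by auto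
      show ?thesis unfolding eq
      proof (rule vanishes_image[OF link[OF \<kappa> True]])
        show "insert \<kappa> s \<subseteq> insert \<kappa> t \<longleftrightarrow> s \<subseteq> t" if "s \<in> ?L" "t \<in> ?L" for s t
          using nin[OF that(1)] by blast
        show "\<exists>y. insert \<kappa> (insert x s) = insert y (insert \<kappa> s)" for s x by blast
      qed
    qed
    moreover have "\<not> x \<subseteq> z" if "z \<in> Y - Y1" "x \<in> Y1" for x z
      using that unfolding Y1_def by blast
    ultimately have "vanishes (Y1 \<union> (Y - Y1))" by (rule vanishes_Un)
    moreover have "Y1 \<union> (Y - Y1) = Y" unfolding Y1_def by blast
    ultimately show ?thesis unfolding Y_def by simp
  qed
  have "vanishes X"
  proof (rule vanishes_patchwork[where g = g and r = "\<lambda>k. f (g k)"])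
    fix k k' assume kk: "k \<in> X" "k' \<in> X" "k \<subseteq> k'"
    show "f (g k) < f (g k') \<or> g k = g k'"
    proof (cases "k = {}")
      case True
      then have nb: "\<not> \<beta>" using XD(4)[OF kk(1)] by auto
      have "f \<iota> < f (g k') \<or> \<iota> = g k'" using exc[OF nb] gQ[OF kk(2)] by auto
      then show ?thesis using True unfolding g_def by auto
    next
      case False
      then have F': "k' \<noteq> {}" using kk by blast
      have m: "\<Inter>k \<in> Q" "\<Inter>k' \<in> Q" "\<Inter>k' \<subseteq> \<Inter>k" using min[OF kk(1) False] min[OF kk(2) F'] kk(3) by auto
      show ?thesis using f[OF m(2,1,3)] c[OF m(1)] c[OF m(2)] False F' unfolding g_def by auto
    qed
  next
    fix k assume "k \<in> X"
    then show "vanishes {k' \<in> X. g k' = g k}" using gQ fiber by blast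
  qed (simp_all add: finX)
  then show ?thesis unfolding X_def .
qed

section \<open>Wedges of directions\<close>

text \<open>This is the tangent cone of the cone spanned by \<open>T\<close> at the points in the relative interior of its face spanned by \<open>S\<close>. Using
coefficients, it depends on the face alone and not on a point of it.\<close>

definition wedge :: "'w::real_vector set \<Rightarrow> 'w set \<Rightarrow> 'w set"
  where "wedge S T = {\<Sum>v\<in>T. c v *\<^sub>R v | c. \<forall>v\<in>T - S. 0 \<le> c v}"

definition open_wedge :: "'w::real_vector set \<Rightarrow> 'w set \<Rightarrow> 'w set"
  where "open_wedge S T = {\<Sum>v\<in>T. c v *\<^sub>R v | c. \<forall>v\<in>T - S. 0 < c v}"

lemma wedgeI: "(\<And>v. v \<in> T \<Longrightarrow> v \<notin> S \<Longrightarrow> 0 \<le> c v) \<Longrightarrow> z = (\<Sum>v\<in>T. c v *\<^sub>R v) \<Longrightarrow> z \<in> wedge S T"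
  unfolding wedge_def by blast

lemma wedgeE:
  assumes "z \<in> wedge S T"
  obtains c where "\<And>v. v \<in> T \<Longrightarrow> v \<notin> S \<Longrightarrow> 0 \<le> c v" "z = (\<Sum>v\<in>T. c v *\<^sub>R v)"
  using assms unfolding wedge_def by blast

lemma open_wedgeE:
  assumes "z \<in> open_wedge S T"
  obtains c where "\<And>v. v \<in> T \<Longrightarrow> v \<notin> S \<Longrightarrow> 0 < c v" "z = (\<Sum>v\<in>T. c v *\<^sub>R v)"
  using assms unfolding open_wedge_def by blast

lemma open_wedge_subset: "open_wedge S T \<subseteq> wedge S T"
  unfolding open_wedge_def wedge_def by (blast intro: less_imp_le)

lemma wedge_add:
  assumes "y \<in> wedge S T" "z \<in> wedge S T"
  shows "y + z \<in> wedge S T"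
proof -
  obtain c where c: "\<And>v. v \<in> T \<Longrightarrow> v \<notin> S \<Longrightarrow> 0 \<le> c v" "y = (\<Sum>v\<in>T. c v *\<^sub>R v)"
    using assms(1) by (rule wedgeE) blast
  obtain d where d: "\<And>v. v \<in> T \<Longrightarrow> v \<notin> S \<Longrightarrow> 0 \<le> d v" "z = (\<Sum>v\<in>T. d v *\<^sub>R v)"
    using assms(2) by (rule wedgeE) blast
  show ?thesis
    by (rule wedgeI[where c = "\<lambda>v. c v + d v"]) (simp_all add: c d scaleR_add_left sum.distrib)
qed

lemma wedge_scale:
  assumes "z \<in> wedge S T" "0 \<le> a"
  shows "a *\<^sub>R z \<in> wedge S T"
proof -
  obtain c where c: "\<And>v. v \<in> T \<Longrightarrow> v \<notin> S \<Longrightarrow> 0 \<le> c v" "z = (\<Sum>v\<in>T. c v *\<^sub>R v)"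
    using assms(1) by (rule wedgeE) blast
  show ?thesis
    by (rule wedgeI[where c = "\<lambda>v. a * c v"]) (simp_all add: c assms scaleR_sum_right)
qed

lemma wedge_zero: "0 \<in> wedge S T"
  by (rule wedgeI[where c = "\<lambda>_. 0"]) auto

lemma sum_mem_wedge:
  assumes "finite T" "S' \<subseteq> T" "\<And>v. v \<in> S' \<Longrightarrow> v \<notin> S \<Longrightarrow> 0 \<le> c v"
  shows "(\<Sum>v\<in>S'. c v *\<^sub>R v) \<in> wedge S T"
proof (rule wedgeI[where c = "\<lambda>v. if v \<in> S' then c v else 0"])
  have "(\<Sum>v\<in>T. (if v \<in> S' then c v else 0) *\<^sub>R v) = (\<Sum>v\<in>T. if v \<in> S' then c v *\<^sub>R v else 0)"
    by (rule sum.cong) auto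
  then show "(\<Sum>v\<in>S'. c v *\<^sub>R v) = (\<Sum>v\<in>T. (if v \<in> S' then c v else 0) *\<^sub>R v)"
    using assms(1,2) by (simp add: sum.inter_restrict[symmetric] Int_absorb1)
qed (use assms in auto)

lemma wedge_mono:
  assumes "finite T" "S' \<subseteq> S" "T' \<subseteq> T"
  shows "wedge S' T' \<subseteq> wedge S T"
proof
  fix z assume "z \<in> wedge S' T'"
  then obtain c where c: "\<And>v. v \<in> T' \<Longrightarrow> v \<notin> S' \<Longrightarrow> 0 \<le> c v" "z = (\<Sum>v\<in>T'. c v *\<^sub>R v)"
    by (rule wedgeE) blast
  show "z \<in> wedge S T"
    unfolding c(2) by (rule sum_mem_wedge) (use assms c(1) in blast)+
qed

text \<open>Both \<open>p\<close> and \<open>- p\<close> belong to the wedge, which is closed under addition.\<close>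

lemma wedge_shift_iff:
  assumes "finite T" "S' \<subseteq> S" "S \<subseteq> T" "p = (\<Sum>v\<in>S'. c v *\<^sub>R v)"
  shows "w - p \<in> wedge S T \<longleftrightarrow> w \<in> wedge S T"
proof -
  have p: "p \<in> wedge S T"
    unfolding assms(4) by (rule sum_mem_wedge) (use assms(1-3) in blast)+
  have "- p = (\<Sum>v\<in>S'. (- c v) *\<^sub>R v)" using assms(4) by (simp add: sum_negf)
  also have "\<dots> \<in> wedge S T" by (rule sum_mem_wedge) (use assms(1-3) in blast)+
  finally have "- p \<in> wedge S T" .
  then show ?thesis
    using p wedge_add[of "w - p" S T p] wedge_add[of w S T "- p"] by auto
qed

lemma convex_cone_wedge: "convex_cone (wedge S T)"
  by (simp add: convex_cone_iff wedge_add wedge_scale wedge_zero)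

lemma wedge_eq_hull:
  assumes "finite T" "S \<subseteq> T"
  shows "wedge S T = convex_cone hull (T \<union> uminus ` S)"
proof
  have gen: "c *\<^sub>R v \<in> convex_cone hull (T \<union> uminus ` S)" if "v \<in> T" "v \<notin> S \<Longrightarrow> 0 \<le> c" for c v
  proof (cases "0 \<le> c")
    case True
    then show ?thesis using that by (intro convex_cone_hull_mul hull_inc) auto
  next
    case False
    then have "(- c) *\<^sub>R (- v) \<in> convex_cone hull (T \<union> uminus ` S)"
      using that by (intro convex_cone_hull_mul hull_inc) auto
    then show ?thesis by simp
  qed
  have "(\<Sum>v\<in>U. c v *\<^sub>R v) \<in> convex_cone hull (T \<union> uminus ` S)"
    if "finite U" "U \<subseteq> T" "\<And>v. v \<in> T \<Longrightarrow> v \<notin> S \<Longrightarrow> 0 \<le> c v" for U c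
    using that(1,2)
  proof (induction U rule: finite_induct)
    case (insert v U)
    then show ?case using gen[of v "c v"] that(3) by (simp add: convex_cone_hull_add)
  qed (simp add: convex_cone_hull_contains_0)
  then show "wedge S T \<subseteq> convex_cone hull (T \<union> uminus ` S)"
    unfolding wedge_def using assms(1) by blast
  have "v \<in> wedge S T" if "v \<in> T" for v
    using sum_mem_wedge[OF assms(1), of "{v}" S "\<lambda>_. 1"] that by auto
  moreover have "- v \<in> wedge S T" if "v \<in> S" for v
    using sum_mem_wedge[OF assms(1), of "{v}" S "\<lambda>_. - 1"] that assms(2) by auto
  ultimately show "convex_cone hull (T \<union> uminus ` S) \<subseteq> wedge S T"
    by (intro hull_minimal convex_cone_wedge) auto
qed

lemma closed_wedge:
  fixes S :: "'w::euclidean_space set"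
  assumes "finite T" "S \<subseteq> T"
  shows "closed (wedge S T)"
  using assms finite_subset[OF assms(2,1)] by (simp add: wedge_eq_hull closed_convex_cone_hull)

lemma convex_wedge: "convex (wedge S T)"
  using convex_cone_wedge unfolding convex_cone_def by blast

text \<open>Discard the generators outside \<open>S\<close> with coefficient zero.\<close>

lemma wedge_carrier:
  assumes "finite T" "S \<subseteq> T" "z \<in> wedge S T"
  obtains U where "S \<subseteq> U" "U \<subseteq> T" "z \<in> open_wedge S U"
proof -
  obtain c where c: "\<And>v. v \<in> T \<Longrightarrow> v \<notin> S \<Longrightarrow> 0 \<le> c v" "z = (\<Sum>v\<in>T. c v *\<^sub>R v)"
    using assms(3) by (rule wedgeE) blast
  define U where "U = S \<union> {v \<in> T. c v \<noteq> 0}"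
  have "z = (\<Sum>v\<in>U. c v *\<^sub>R v)"
    unfolding c(2) by (rule sum.mono_neutral_right) (use assms in \<open>auto simp: U_def\<close>)
  moreover have "0 < c v" if "v \<in> U - S" for v
    using that c(1)[of v] unfolding U_def by fastforce
  ultimately have "z \<in> open_wedge S U" unfolding open_wedge_def by blast
  then show ?thesis using that[of U] assms(2) unfolding U_def by auto
qed

text \<open>The coefficients of \<open>p\<close> at the generators in \<open>U - S\<close> are positive, hence stay nonnegative after a small step; all
other signs are under control by hypothesis.\<close>

lemma open_wedge_perturb:
  assumes "finite T" "S \<subseteq> U" "U \<subseteq> T" "p \<in> open_wedge S U" "z \<in> wedge U T"
  obtains s where "0 < s" "p + s *\<^sub>R z \<in> wedge S T"
proof -
  obtain c where c: "\<And>v. v \<in> U \<Longrightarrow> v \<notin> S \<Longrightarrow> 0 < c v" "p = (\<Sum>v\<in>U. c v *\<^sub>R v)"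
    using assms(4) by (rule open_wedgeE) blast
  obtain d where d: "\<And>v. v \<in> T \<Longrightarrow> v \<notin> U \<Longrightarrow> 0 \<le> d v" "z = (\<Sum>v\<in>T. d v *\<^sub>R v)"
    using assms(5) by (rule wedgeE) blast
  have fin: "finite (U - S)" using assms finite_subset by blast
  have "\<exists>s>0. \<forall>v\<in>V. 0 \<le> c v + s * d v" if "finite V" "V \<subseteq> U - S" for V
    using that
  proof (induction V rule: finite_induct)
    case (insert v V)
    then obtain s where s: "s > 0" "\<forall>v\<in>V. 0 \<le> c v + s * d v" by auto
    have cv: "0 < c v" using c(1) insert.prems by auto
    \<comment> \<open>The step must keep the coefficient at \<open>v\<close> nonnegative; adding \<open>1\<close> avoids a division by zero.\<close>
    define t where "t = min s (c v / (1 + \<bar>d v\<bar>))"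
    have t: "0 < t" "t \<le> s" "t \<le> c v / (1 + \<bar>d v\<bar>)" unfolding t_def using s cv by (auto simp: add_pos_nonneg)
    have tv: "0 \<le> c v + t * d v"
    proof -
      have "t * \<bar>d v\<bar> \<le> t * (1 + \<bar>d v\<bar>)" using t(1) by (simp add: mult_left_mono)
      also have "\<dots> \<le> c v" using t(3) by (simp add: field_simps add_pos_nonneg)
      finally have "\<bar>t * d v\<bar> \<le> c v" using t(1) by (simp add: abs_mult)
      then show ?thesis by linarith
    qed
    have "0 \<le> c u + t * d u" if u: "u \<in> V" for u
    proof (cases "0 \<le> d u")
      case True
      then show ?thesis using c(1)[of u] u insert.prems t(1) by (auto intro!: add_nonneg_nonneg)
    next
      case False
      then have "s * d u \<le> t * d u" using t(2) by (simp add: mult_right_mono_neg)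
      then show ?thesis using s(2) u by fastforce
    qed
    then show ?case using tv t(1) by auto
  qed (auto intro: exI[of _ 1])
  from this[OF fin subset_refl] obtain s where s: "s > 0" "\<forall>v\<in>U - S. 0 \<le> c v + s * d v" by blast
  have "p = (\<Sum>v\<in>T. (if v \<in> U then c v else 0) *\<^sub>R v)"
    unfolding c(2) by (rule sum.mono_neutral_cong_left) (use assms in auto)
  then have "p + s *\<^sub>R z = (\<Sum>v\<in>T. ((if v \<in> U then c v else 0) + s * d v) *\<^sub>R v)"
    by (simp add: d(2) scaleR_sum_right sum.distrib scaleR_add_left)
  moreover have "0 \<le> (if v \<in> U then c v else 0) + s * d v" if "v \<in> T" "v \<notin> S" for v
    using that s d(1)[of v] by auto
  ultimately have "p + s *\<^sub>R z \<in> wedge S T" by (intro wedgeI)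
  then show ?thesis using that s(1) by blast
qed


section \<open>Simplicial fans\<close>

text \<open>A cone is represented by the set of its generators. The last axiom states that different cones have disjoint relative interiors,
and is what remains here of the condition that cones meet in common faces.\<close>

locale simplicial_fan =
  fixes K :: "'w::euclidean_space set set"
  assumes finite_K: "finite K"
    and finite_mem: "S \<in> K \<Longrightarrow> finite S"
    and subset_mem: "S \<in> K \<Longrightarrow> S' \<subseteq> S \<Longrightarrow> S' \<in> K"
    and open_cones_disjoint: "S \<in> K \<Longrightarrow> S' \<in> K \<Longrightarrow> (\<And>v. v \<in> S \<Longrightarrow> 0 < c v) \<Longrightarrow>
      (\<And>v. v \<in> S' \<Longrightarrow> 0 < c' v) \<Longrightarrow> (\<Sum>v\<in>S. c v *\<^sub>R v) = (\<Sum>v\<in>S'. c' v *\<^sub>R v) \<Longrightarrow> S = S'"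
begin

text \<open>Adding a large multiple of the generators in \<open>S\<close> moves \<open>z\<close> into the relative interiors of both cones.\<close>

lemma open_wedge_unique:
  assumes K: "U1 \<in> K" "U2 \<in> K" and S: "S \<subseteq> U1" "S \<subseteq> U2"
    and z: "z \<in> open_wedge S U1" "z \<in> open_wedge S U2"
  shows "U1 = U2"
proof -
  obtain c where c: "\<And>v. v \<in> U1 \<Longrightarrow> v \<notin> S \<Longrightarrow> 0 < c v" "z = (\<Sum>v\<in>U1. c v *\<^sub>R v)"
    using z(1) by (rule open_wedgeE) blast
  obtain d where d: "\<And>v. v \<in> U2 \<Longrightarrow> v \<notin> S \<Longrightarrow> 0 < d v" "z = (\<Sum>v\<in>U2. d v *\<^sub>R v)"
    using z(2) by (rule open_wedgeE) blast
  have fin: "finite U1" "finite U2" "finite S"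
    using K S finite_mem finite_subset by blast+
  \<comment> \<open>A bound for all coefficients on \<open>S\<close>, so that adding it makes them positive.\<close>
  define M where "M = 1 + (\<Sum>v\<in>S. \<bar>c v\<bar> + \<bar>d v\<bar>)"
  have M: "\<bar>c v\<bar> + \<bar>d v\<bar> < M" if "v \<in> S" for v
    using member_le_sum[OF that, of "\<lambda>v. \<bar>c v\<bar> + \<bar>d v\<bar>"] fin(3) unfolding M_def by simp
  define m where "m v = (if v \<in> S then M else 0)" for v
  have shift: "(\<Sum>v\<in>U. (e v + m v) *\<^sub>R v) = (\<Sum>v\<in>U. e v *\<^sub>R v) + (\<Sum>v\<in>S. M *\<^sub>R v)"
    if "finite U" "S \<subseteq> U" for U and e :: "'w \<Rightarrow> real"
  proof -
    have "(\<Sum>v\<in>U. m v *\<^sub>R v) = (\<Sum>v\<in>S. M *\<^sub>R v)"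
      by (rule sum.mono_neutral_cong_right) (use that in \<open>auto simp: m_def\<close>)
    then show ?thesis by (simp add: scaleR_add_left sum.distrib)
  qed
  show ?thesis
  proof (rule open_cones_disjoint[OF K])
    show "0 < c v + m v" if "v \<in> U1" for v
      using that c(1)[of v] M[of v] unfolding m_def by (cases "v \<in> S") auto
    show "0 < d v + m v" if "v \<in> U2" for v
      using that d(1)[of v] M[of v] unfolding m_def by (cases "v \<in> S") auto
    show "(\<Sum>v\<in>U1. (c v + m v) *\<^sub>R v) = (\<Sum>v\<in>U2. (d v + m v) *\<^sub>R v)"
      using c(2) d(2) shift fin S by simp
  qed
qed

text \<open>The faces above \<open>\<kappa>\<close> that enter the open half-space of \<open>w\<close> are swept in the order of their distance from \<open>w\<close>, measured
in the wedges over \<open>\<kappa>\<close>. With \<open>p \<tau>\<close> the point of the wedge of \<open>\<tau>\<close> nearest to \<open>w\<close>, entering the half-space means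
\<open>p \<tau> \<noteq> 0\<close>. If \<open>\<mu>\<close> is the carrier of \<open>q = p \<mu>\<close>, then \<open>w - q\<close> is orthogonal to \<open>\<mu>\<close>, and a face above \<open>\<mu>\<close>
is nearer to \<open>w\<close> than \<open>\<mu>\<close> exactly if it enters the half-space of \<open>w - q\<close>. So the link of \<open>\<mu>\<close> is an instance of the theorem
for \<open>\<mu>\<close> and \<open>w - q\<close>.

The hypothesis on \<open>B\<close> says that the faces outside \<open>B\<close> are those from which one can move into the fan in the direction \<open>w\<close>.
For \<open>F = \<kappa>\<close> it decides whether \<open>w\<close> itself is attained as a nearest point. If so, the carrier of \<open>w\<close> is reached first; if not,
\<open>w - q\<close> never vanishes.\<close>

theorem chains_vanish:
  assumes "\<kappa> \<in> K" "w \<noteq> 0" "\<And>v. v \<in> \<kappa> \<Longrightarrow> w \<bullet> v = 0"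
    and "\<And>F. F \<in> K \<Longrightarrow> \<kappa> \<subseteq> F \<Longrightarrow> F \<notin> B \<longleftrightarrow> (\<exists>G\<in>K. F \<subseteq> G \<and> w \<in> wedge F G)"
    and down: "\<And>\<sigma> \<tau>. \<tau> \<in> B \<Longrightarrow> \<sigma> \<subseteq> \<tau> \<Longrightarrow> \<sigma> \<in> B"
  shows "vanishes (chains_off (\<kappa> \<in> B) {\<tau> \<in> K. \<kappa> \<subset> \<tau> \<and> (\<exists>z\<in>wedge \<kappa> \<tau>. 0 < w \<bullet> z)} B)"
  using assms(1-4)
proof (induction "card {\<tau> \<in> K. \<kappa> \<subset> \<tau>}" arbitrary: \<kappa> w rule: less_induct)
  case less
  note \<kappa> = less.prems(1) and w0 = less.prems(2) and orth = less.prems(3) and cond = less.prems(4)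
  define Q where "Q = {\<tau> \<in> K. \<kappa> \<subset> \<tau> \<and> (\<exists>z\<in>wedge \<kappa> \<tau>. 0 < w \<bullet> z)}"
  define p where "p \<tau> = closest_point (wedge \<kappa> \<tau>) w" for \<tau>
  define f where "f \<tau> = dist w (p \<tau>)" for \<tau>
  have W: "closed (wedge \<kappa> \<tau>)" "convex (wedge \<kappa> \<tau>)" "p \<tau> \<in> wedge \<kappa> \<tau>"
    if "\<tau> \<in> K" "\<kappa> \<subseteq> \<tau>" for \<tau>
  proof -
    show "closed (wedge \<kappa> \<tau>)" by (rule closed_wedge[OF finite_mem[OF that(1)] that(2)])
    then show "p \<tau> \<in> wedge \<kappa> \<tau>"
      unfolding p_def using wedge_zero[of \<kappa> \<tau>] by (intro closest_point_in_set) auto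
  qed (rule convex_wedge)
  have dot: "(w - p \<tau>) \<bullet> z \<le> 0" "(w - p \<tau>) \<bullet> p \<tau> = 0"
    if "\<tau> \<in> K" "\<kappa> \<subseteq> \<tau>" "z \<in> wedge \<kappa> \<tau>" for \<tau> z
  proof -
    \<comment> \<open>The nearest point in a convex set is seen under an obtuse angle; the points \<open>0\<close> and \<open>2 p\<close> of the cone then give orthogonality.\<close>
    have *: "(w - p \<tau>) \<bullet> (y - p \<tau>) \<le> 0" if "y \<in> wedge \<kappa> \<tau>" for y
      unfolding p_def using closest_point_dot W \<open>\<tau> \<in> K\<close> \<open>\<kappa> \<subseteq> \<tau>\<close> that by blast
    have "2 *\<^sub>R p \<tau> \<in> wedge \<kappa> \<tau>" using wedge_scale[OF W(3)[OF that(1,2)], of 2] by simp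
    from *[OF this] *[OF wedge_zero] show 0: "(w - p \<tau>) \<bullet> p \<tau> = 0"
      by (simp add: inner_diff_right)
    from *[OF that(3)] 0 show "(w - p \<tau>) \<bullet> z \<le> 0" by (simp add: inner_diff_right)
  qed
  define c where "c \<tau> = (SOME U. \<kappa> \<subseteq> U \<and> U \<subseteq> \<tau> \<and> p \<tau> \<in> open_wedge \<kappa> U)" for \<tau>
  have c: "\<kappa> \<subseteq> c \<tau>" "c \<tau> \<subseteq> \<tau>" "p \<tau> \<in> open_wedge \<kappa> (c \<tau>)" "c \<tau> \<in> K"
    if "\<tau> \<in> K" "\<kappa> \<subseteq> \<tau>" for \<tau>
  proof -
    have "\<exists>U. \<kappa> \<subseteq> U \<and> U \<subseteq> \<tau> \<and> p \<tau> \<in> open_wedge \<kappa> U"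
      by (rule wedge_carrier[OF finite_mem[OF that(1)] that(2) W(3)[OF that]]) blast
    then have "\<kappa> \<subseteq> c \<tau> \<and> c \<tau> \<subseteq> \<tau> \<and> p \<tau> \<in> open_wedge \<kappa> (c \<tau>)"
      unfolding c_def by (rule someI_ex)
    then show "\<kappa> \<subseteq> c \<tau>" "c \<tau> \<subseteq> \<tau>" "p \<tau> \<in> open_wedge \<kappa> (c \<tau>)" "c \<tau> \<in> K"
      using subset_mem[OF that(1)] by auto
  qed
  have c_unique: "c \<tau> = U" if "\<tau> \<in> K" "\<kappa> \<subseteq> \<tau>" "U \<in> K" "\<kappa> \<subseteq> U" "p \<tau> \<in> open_wedge \<kappa> U" for \<tau> U
    by (rule open_wedge_unique[OF c(4) that(3) c(1) that(4) c(3) that(5)]) (fact that)+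
  have f_mono: "f \<tau> < f \<sigma> \<or> p \<tau> = p \<sigma>"
    if "\<sigma> \<in> K" "\<tau> \<in> K" "\<kappa> \<subseteq> \<sigma>" "p \<sigma> \<in> wedge \<kappa> \<tau>" "\<kappa> \<subseteq> \<tau>" for \<sigma> \<tau>
    using closest_point_lt[OF W(2,1)[OF that(2,5)] that(4), of w] unfolding f_def p_def by fastforce
  have p_pos: "0 < w \<bullet> p \<tau>" if "\<tau> \<in> Q" for \<tau>
  proof -
    have \<tau>: "\<tau> \<in> K" "\<kappa> \<subseteq> \<tau>" using that unfolding Q_def by auto
    obtain z where z: "z \<in> wedge \<kappa> \<tau>" "0 < w \<bullet> z" using \<open>\<tau> \<in> Q\<close> unfolding Q_def by blast
    have "p \<tau> \<noteq> 0" using dot(1)[OF \<tau> z(1)] z(2) by auto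
    moreover have "w \<bullet> p \<tau> = p \<tau> \<bullet> p \<tau>" using dot(2)[OF \<tau> z(1)] by (simp add: inner_diff_left)
    ultimately show ?thesis by simp
  qed
  have QI: "\<tau> \<in> Q" if \<tau>: "\<tau> \<in> K" "\<kappa> \<subseteq> \<tau>" and zW: "z \<in> wedge \<kappa> \<tau>" and wz: "0 < w \<bullet> z" for \<tau> z
  proof -
    have "\<tau> \<noteq> \<kappa>"
    proof
      assume "\<tau> = \<kappa>"
      then obtain e where "z = (\<Sum>v\<in>\<kappa>. e v *\<^sub>R v)" using zW by (auto elim: wedgeE)
      then show False using wz orth by (simp add: inner_sum_right)
    qed
    then show ?thesis using \<tau> zW wz unfolding Q_def by blast
  qed
  have cQ: "c \<tau> \<in> Q" "p (c \<tau>) = p \<tau>" if "\<tau> \<in> Q" for \<tau>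
  proof -
    have \<tau>: "\<tau> \<in> K" "\<kappa> \<subseteq> \<tau>" using that unfolding Q_def by auto
    have pc: "p \<tau> \<in> wedge \<kappa> (c \<tau>)" using c(3)[OF \<tau>] open_wedge_subset by blast
    show "c \<tau> \<in> Q" by (rule QI[OF c(4,1)[OF \<tau>] pc p_pos[OF that]])
    have "wedge \<kappa> (c \<tau>) \<subseteq> wedge \<kappa> \<tau>"
      by (rule wedge_mono[OF finite_mem[OF \<tau>(1)] subset_refl c(2)[OF \<tau>]])
    then have "dist w (p \<tau>) \<le> dist w z" if "z \<in> wedge \<kappa> (c \<tau>)" for z
      unfolding p_def using closest_point_le[OF W(1)[OF \<tau>]] that by blast
    then show "p (c \<tau>) = p \<tau>"
      using closest_point_unique[OF W(2,1)[OF c(4,1)[OF \<tau>]] pc, of w] unfolding p_def[of "c \<tau>"] by metis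
  qed
  \<comment> \<open>If \<open>\<kappa>\<close> is not in \<open>B\<close>, then \<open>w\<close> lies in one of the wedges, and its carrier is at distance zero.\<close>
  have "\<exists>\<iota>. \<kappa> \<in> B \<or> \<iota> \<in> K \<and> \<kappa> \<subseteq> \<iota> \<and> w \<in> open_wedge \<kappa> \<iota>"
  proof (cases "\<kappa> \<in> B")
    case False
    then obtain G where G: "G \<in> K" "\<kappa> \<subseteq> G" "w \<in> wedge \<kappa> G" using cond[OF \<kappa>] by auto
    from wedge_carrier[OF finite_mem[OF G(1)] G(2,3)] subset_mem[OF G(1)] show ?thesis by metis
  qed simp
  then obtain \<iota> where \<iota>: "\<kappa> \<in> B \<or> \<iota> \<in> K \<and> \<kappa> \<subseteq> \<iota> \<and> w \<in> open_wedge \<kappa> \<iota>" by blast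
  have "vanishes (chains_off (\<kappa> \<in> B) Q B)"
  proof (rule vanishes_sweep[where f = f and c = c and \<iota> = \<iota>])
    show "finite Q" unfolding Q_def using finite_K by simp
    show "c \<sigma> \<in> Q \<and> c \<sigma> \<subseteq> \<sigma> \<and> f (c \<sigma>) = f \<sigma>" if "\<sigma> \<in> Q" for \<sigma>
    proof -
      have "\<sigma> \<in> K" "\<kappa> \<subseteq> \<sigma>" using that unfolding Q_def by auto
      then show ?thesis using cQ[OF that] c(2) unfolding f_def by simp
    qed
    show "f \<tau> < f \<sigma> \<or> (f \<tau> = f \<sigma> \<and> c \<tau> = c \<sigma>)" if "\<sigma> \<in> Q" "\<tau> \<in> Q" "\<sigma> \<subseteq> \<tau>" for \<sigma> \<tau>
    proof -
      have K: "\<sigma> \<in> K" "\<tau> \<in> K" "\<kappa> \<subseteq> \<sigma>" "\<kappa> \<subseteq> \<tau>" using that unfolding Q_def by auto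
      have "wedge \<kappa> \<sigma> \<subseteq> wedge \<kappa> \<tau>" by (rule wedge_mono[OF finite_mem[OF K(2)] subset_refl that(3)])
      then have "f \<tau> < f \<sigma> \<or> p \<tau> = p \<sigma>" using f_mono K W(3)[OF K(1,3)] by blast
      moreover have "c \<tau> = c \<sigma>" if "p \<tau> = p \<sigma>"
        using c_unique[OF K(2,4) c(4,1)[OF K(1,3)]] c(3)[OF K(1,3)] that by simp
      ultimately show ?thesis unfolding f_def by auto
    qed
    show "\<sigma> \<in> B" if "\<tau> \<in> B" "\<sigma> \<subseteq> \<tau>" for \<sigma> \<tau> using down that by blast
    show "\<kappa> \<in> B \<or> Q \<inter> B = {}" using down unfolding Q_def by blast
    show "\<iota> \<in> Q \<and> c \<iota> = \<iota> \<and> (\<forall>\<tau>\<in>Q. f \<iota> < f \<tau> \<or> f \<iota> = f \<tau> \<and> c \<tau> = \<iota>)" if "\<kappa> \<notin> B"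
    proof -
      have k0: "\<iota> \<in> K" "\<kappa> \<subseteq> \<iota>" "w \<in> open_wedge \<kappa> \<iota>" using \<iota> that by auto
      have wW: "w \<in> wedge \<kappa> \<iota>" using k0(3) open_wedge_subset by blast
      have Q0: "\<iota> \<in> Q" by (rule QI[OF k0(1,2) wW]) (use w0 in simp)
      have p0: "p \<iota> = w" unfolding p_def by (rule closest_point_self[OF wW])
      then have c0: "c \<iota> = \<iota>" using c_unique[OF k0(1,2) k0(1,2)] k0(3) by simp
      have "f \<iota> < f \<tau> \<or> f \<iota> = f \<tau> \<and> c \<tau> = \<iota>" if "\<tau> \<in> Q" for \<tau>
      proof (cases "p \<tau> = w")
        case True
        have "\<tau> \<in> K" "\<kappa> \<subseteq> \<tau>" using that unfolding Q_def by auto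
        then have "c \<tau> = \<iota>" using c_unique[OF _ _ k0(1,2)] k0(3) True by simp
        then show ?thesis using True p0 unfolding f_def by simp
      next
        case False
        then have "0 < dist w (p \<tau>)" by simp
        then show ?thesis using p0 unfolding f_def by simp
      qed
      then show ?thesis using Q0 c0 by blast
    qed
    show "vanishes (chains_off (\<mu> \<in> B) {\<tau> \<in> Q. \<mu> \<subset> \<tau> \<and> f \<tau> < f \<mu>} B)"
      if \<mu>: "\<mu> \<in> Q" "c \<mu> = \<mu>" "\<kappa> \<in> B \<or> \<mu> \<noteq> \<iota>" for \<mu>
    proof -
      have \<mu>K: "\<mu> \<in> K" "\<kappa> \<subset> \<mu>" "\<kappa> \<subseteq> \<mu>" using \<mu>(1) unfolding Q_def by auto
      define q where "q = p \<mu>"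
      have q: "q \<in> open_wedge \<kappa> \<mu>" using c(3)[OF \<mu>K(1,3)] \<mu>(2) unfolding q_def by simp
      then obtain e where e: "\<And>v. v \<in> \<mu> \<Longrightarrow> v \<notin> \<kappa> \<Longrightarrow> 0 < e v" "q = (\<Sum>v\<in>\<mu>. e v *\<^sub>R v)"
        by (rule open_wedgeE) blast
      have qW: "q \<in> wedge \<kappa> \<mu>" using q open_wedge_subset by blast
      have wq0: "w - q \<noteq> 0"
      proof
        assume "w - q = 0"
        then have w: "w \<in> open_wedge \<kappa> \<mu>" using q by simp
        then have "\<kappa> \<notin> B" using cond[OF \<kappa> subset_refl] \<mu>K qW open_wedge_subset by blast
        then show False using \<iota> \<mu>(3) open_wedge_unique[OF \<mu>K(1) _ \<mu>K(3) _ w] by blast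
      qed
      have orth': "(w - q) \<bullet> v = 0" if v: "v \<in> \<mu>" for v
      proof -
        \<comment> \<open>Moving from \<open>q\<close> along a generator of its carrier stays in the wedge for a while in both directions.\<close>
        have wedge: "\<exists>s>0. q + s *\<^sub>R z \<in> wedge \<kappa> \<mu>" if "z \<in> {v, - v}" for z
        proof -
          have "z \<in> wedge \<mu> \<mu>"
            using sum_mem_wedge[OF finite_mem[OF \<mu>K(1)], of "{v}" \<mu> "\<lambda>_. 1"]
              sum_mem_wedge[OF finite_mem[OF \<mu>K(1)], of "{v}" \<mu> "\<lambda>_. - 1"] v that by auto
          from open_wedge_perturb[OF finite_mem[OF \<mu>K(1)] \<mu>K(3) subset_refl q this] show ?thesis by metis
        qed
        have "(w - q) \<bullet> z \<le> 0" if z: "z \<in> {v, - v}" for z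
        proof -
          obtain s where s: "s > 0" "q + s *\<^sub>R z \<in> wedge \<kappa> \<mu>" using wedge[OF z] by blast
          have "(w - q) \<bullet> (q + s *\<^sub>R z) \<le> 0" using dot(1)[OF \<mu>K(1,3) s(2)] unfolding q_def .
          moreover have "(w - q) \<bullet> q = 0" using dot(2)[OF \<mu>K(1,3) s(2)] unfolding q_def .
          ultimately have "s * ((w - q) \<bullet> z) \<le> 0" by (simp add: inner_add_right)
          then show ?thesis using s(1) by (simp add: mult_le_0_iff)
        qed
        from this[of v] this[of "- v"] show ?thesis by simp
      qed
      have cond': "F \<notin> B \<longleftrightarrow> (\<exists>G\<in>K. F \<subseteq> G \<and> w - q \<in> wedge F G)" if "F \<in> K" "\<mu> \<subseteq> F" for F
      proof -
        have "w - q \<in> wedge F G \<longleftrightarrow> w \<in> wedge F G" if "G \<in> K" "F \<subseteq> G" for G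
          by (rule wedge_shift_iff[OF finite_mem[OF that(1)] \<open>\<mu> \<subseteq> F\<close> that(2) e(2)])
        then show ?thesis using cond[OF that(1)] \<mu>K(3) that(2) by blast
      qed
      have "{\<tau> \<in> K. \<mu> \<subset> \<tau>} \<subset> {\<tau> \<in> K. \<kappa> \<subset> \<tau>}" using \<mu>K by blast
      then have "card {\<tau> \<in> K. \<mu> \<subset> \<tau>} < card {\<tau> \<in> K. \<kappa> \<subset> \<tau>}"
        using finite_K by (intro psubset_card_mono) auto
      \<comment> \<open>Passing from \<open>w\<close> to \<open>w - q\<close> subtracts a vector in the span of \<open>\<mu>\<close>, so the hypothesis on \<open>B\<close> is inherited.\<close>
      note IH = less.hyps[OF this \<mu>K(1) wq0 orth' cond']
      have "{\<tau> \<in> Q. \<mu> \<subset> \<tau> \<and> f \<tau> < f \<mu>} = {\<tau> \<in> K. \<mu> \<subset> \<tau> \<and> (\<exists>z\<in>wedge \<mu> \<tau>. 0 < (w - q) \<bullet> z)}"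
      proof (intro subset_antisym subsetI)
        fix \<tau> assume "\<tau> \<in> {\<tau> \<in> Q. \<mu> \<subset> \<tau> \<and> f \<tau> < f \<mu>}"
        then have \<tau>: "\<tau> \<in> K" "\<mu> \<subset> \<tau>" "\<kappa> \<subseteq> \<tau>" "\<mu> \<subseteq> \<tau>" and lt: "f \<tau> < f \<mu>" using \<mu>K unfolding Q_def by auto
        have "p \<tau> \<in> wedge \<mu> \<tau>"
          using W(3)[OF \<tau>(1,3)] wedge_mono[OF finite_mem[OF \<tau>(1)] \<mu>K(3) subset_refl] by blast
        then have z: "p \<tau> - q \<in> wedge \<mu> \<tau>"
          using wedge_shift_iff[OF finite_mem[OF \<tau>(1)] subset_refl \<tau>(4) e(2)] by blast
        have "(norm (w - p \<tau>))\<^sup>2 < (norm (w - q))\<^sup>2"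
          using lt unfolding f_def q_def dist_norm by (intro power_strict_mono) auto
        moreover have "(norm (w - p \<tau>))\<^sup>2 = (norm (w - q))\<^sup>2 - 2 * ((w - q) \<bullet> (p \<tau> - q)) + (norm (p \<tau> - q))\<^sup>2"
          by (simp add: power2_norm_eq_inner algebra_simps inner_commute)
        ultimately have "0 < (w - q) \<bullet> (p \<tau> - q)" using zero_le_power2[of "norm (p \<tau> - q)"] by linarith
        then show "\<tau> \<in> {\<tau> \<in> K. \<mu> \<subset> \<tau> \<and> (\<exists>z\<in>wedge \<mu> \<tau>. 0 < (w - q) \<bullet> z)}" using z \<tau> by blast
      next
        fix \<tau> assume "\<tau> \<in> {\<tau> \<in> K. \<mu> \<subset> \<tau> \<and> (\<exists>z\<in>wedge \<mu> \<tau>. 0 < (w - q) \<bullet> z)}"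
        then obtain z where \<tau>: "\<tau> \<in> K" "\<mu> \<subset> \<tau>" "\<mu> \<subseteq> \<tau>" and z: "z \<in> wedge \<mu> \<tau>" "0 < (w - q) \<bullet> z" by blast
        have \<kappa>\<tau>: "\<kappa> \<subseteq> \<tau>" using \<mu>K \<tau> by blast
        have q\<tau>: "q \<in> wedge \<kappa> \<tau>"
          using qW wedge_mono[OF finite_mem[OF \<tau>(1)] subset_refl \<tau>(3)] by blast
        obtain s where s: "0 < s" "q + s *\<^sub>R z \<in> wedge \<kappa> \<tau>"
          by (rule open_wedge_perturb[OF finite_mem[OF \<tau>(1)] \<mu>K(3) \<tau>(3) q z(1)])
        have "p \<tau> \<noteq> q"
        proof
          assume "p \<tau> = q"
          then have "(w - q) \<bullet> (q + s *\<^sub>R z) \<le> 0" "(w - q) \<bullet> q = 0"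
            using dot[OF \<tau>(1) \<kappa>\<tau> s(2)] by auto
          then have "s * ((w - q) \<bullet> z) \<le> 0" by (simp add: inner_add_right)
          then show False using s(1) z(2) by (simp add: mult_le_0_iff)
        qed
        then have "f \<tau> < f \<mu>" using f_mono[OF \<mu>K(1) \<tau>(1) \<mu>K(3) _ \<kappa>\<tau>] q\<tau> unfolding q_def by blast
        moreover have "\<tau> \<in> Q" by (rule QI[OF \<tau>(1) \<kappa>\<tau> q\<tau>]) (use p_pos[OF \<mu>(1)] q_def in simp)
        ultimately show "\<tau> \<in> {\<tau> \<in> Q. \<mu> \<subset> \<tau> \<and> f \<tau> < f \<mu>}" using \<tau> by blast
      qed
      then show ?thesis using IH by simp
    qed
  qed
  then show ?case unfolding Q_def .
qed

end

section \<open>Faces of a simplicial complex\<close>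

definition verts :: "'a::real_vector set \<Rightarrow> 'a set"
  where "verts F = {x. x extreme_point_of F}"

lemma verts_convex_hull:
  fixes S :: "'a::euclidean_space set"
  shows "\<not> affine_dependent S \<Longrightarrow> verts (convex hull S) = S"
  unfolding verts_def using extreme_point_of_convex_hull_affine_independent by blast

locale geometric_complex =
  fixes C :: "'a::euclidean_space set set"
  assumes complex: "simplicial_complex C"
begin

lemma finite_C: "finite C"
  using complex unfolding simplicial_complex_def by blast

lemma face_mem: "F \<in> C \<Longrightarrow> G face_of F \<Longrightarrow> G \<in> C"
  using complex unfolding simplicial_complex_def by blast

lemma Int_face: "F \<in> C \<Longrightarrow> G \<in> C \<Longrightarrow> F \<inter> G face_of F"
  using complex unfolding simplicial_complex_def by blast

lemma verts:
  assumes "F \<in> C"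
  shows "\<not> affine_dependent (verts F)" "finite (verts F)" "convex hull (verts F) = F"
proof -
  obtain S where "\<not> affine_dependent S" "F = convex hull S"
    using complex assms unfolding simplicial_complex_def simplex_def by blast
  then show "\<not> affine_dependent (verts F)" "convex hull (verts F) = F"
    using verts_convex_hull by metis+
  then show "finite (verts F)" by (simp add: aff_independent_finite)
qed

lemma convex_mem: "F \<in> C \<Longrightarrow> convex F" and compact_mem: "F \<in> C \<Longrightarrow> compact F"
  using verts convex_convex_hull finite_imp_compact_convex_hull by metis+

lemma closed_mem: "F \<in> C \<Longrightarrow> closed F"
  by (simp add: compact_mem compact_imp_closed)

lemma subset_imp_face: "F \<in> C \<Longrightarrow> G \<in> C \<Longrightarrow> F \<subseteq> G \<Longrightarrow> F face_of G"
  using Int_face[of G F] by (simp add: Int_absorb1)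

lemma verts_subset_face:
  assumes "F \<in> C" "S \<subseteq> verts F"
  shows "convex hull S \<in> C" "verts (convex hull S) = S"
proof -
  have "convex hull S face_of convex hull (verts F)"
    using face_of_convex_hull_affine_independent[OF verts(1)[OF assms(1)]] assms(2) by blast
  then show "convex hull S \<in> C" using face_mem assms(1) verts(3) by metis
  show "verts (convex hull S) = S"
    using verts(1)[OF assms(1)] assms(2) affine_independent_subset by (intro verts_convex_hull) blast
qed

lemma verts_subset_iff:
  assumes "F \<in> C" "G \<in> C"
  shows "verts F \<subseteq> verts G \<longleftrightarrow> F \<subseteq> G"
proof
  assume "verts F \<subseteq> verts G"
  then show "F \<subseteq> G" using hull_mono[of "verts F" "verts G" convex] verts(3) assms by simp
next
  assume "F \<subseteq> G"
  then have "F face_of G" using subset_imp_face assms by blast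
  then show "verts F \<subseteq> verts G"
    unfolding verts_def using extreme_point_of_face by blast
qed

lemma verts_eq_iff: "F \<in> C \<Longrightarrow> G \<in> C \<Longrightarrow> verts F = verts G \<longleftrightarrow> F = G"
  using verts(3) by metis

lemma verts_empty_iff: "F \<in> C \<Longrightarrow> verts F = {} \<longleftrightarrow> F = {}"
  using verts(3) convex_hull_eq_empty by metis

lemma empty_mem: "C \<noteq> {} \<Longrightarrow> {} \<in> C"
  using face_mem empty_face_of by blast

lemma rel_interior_mem_iff:
  assumes "F \<in> C"
  shows "x \<in> rel_interior F \<longleftrightarrow>
    (\<exists>c. (\<forall>v\<in>verts F. 0 < c v) \<and> sum c (verts F) = 1 \<and> (\<Sum>v\<in>verts F. c v *\<^sub>R v) = x)"
  using rel_interior_convex_hull_explicit[OF verts(1)[OF assms]] verts(3)[OF assms] by auto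

lemma mem_iff:
  assumes "F \<in> C"
  shows "x \<in> F \<longleftrightarrow>
    (\<exists>c. (\<forall>v\<in>verts F. 0 \<le> c v) \<and> sum c (verts F) = 1 \<and> (\<Sum>v\<in>verts F. c v *\<^sub>R v) = x)"
  using convex_hull_finite[OF verts(2)[OF assms]] verts(3)[OF assms] by auto

lemma rel_interior_subset_mem:
  assumes "F \<in> C" "G \<in> C" "x \<in> rel_interior F" "x \<in> G"
  shows "F \<subseteq> G"
  using subset_of_face_of[OF Int_face[OF assms(1,2)], of F] assms(3,4) rel_interior_subset[of F] by blast

lemma rel_interior_unique:
  assumes "F \<in> C" "G \<in> C" "x \<in> rel_interior F" "x \<in> rel_interior G"
  shows "F = G"
  using rel_interior_subset_mem[of F G x] rel_interior_subset_mem[of G F x] assms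
    rel_interior_subset[of F] rel_interior_subset[of G] by blast

lemma carrier:
  assumes "F \<in> C" "x \<in> F"
  obtains G where "G \<in> C" "G \<subseteq> F" "x \<in> rel_interior G"
proof -
  obtain c where c: "\<forall>v\<in>verts F. 0 \<le> c v" "sum c (verts F) = 1" "(\<Sum>v\<in>verts F. c v *\<^sub>R v) = x"
    using mem_iff[OF assms(1)] assms(2) by auto
  define S where "S = {v \<in> verts F. c v \<noteq> 0}"
  have S: "S \<subseteq> verts F" unfolding S_def by blast
  note G = verts_subset_face[OF assms(1) S]
  have "sum c S = 1" "(\<Sum>v\<in>S. c v *\<^sub>R v) = x"
    unfolding c(2,3)[symmetric] by (rule sum.mono_neutral_left; use verts(2)[OF assms(1)] in \<open>auto simp: S_def\<close>)+
  moreover have "\<forall>v\<in>S. 0 < c v" using c(1) unfolding S_def by fastforce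
  ultimately have "x \<in> rel_interior (convex hull S)"
    using rel_interior_mem_iff[OF G(1)] G(2) by auto
  moreover have "convex hull S \<subseteq> F" using verts_subset_iff[OF G(1) assms(1)] G(2) S by blast
  ultimately show ?thesis using that G(1) by blast
qed

lemma rel_interior_nonempty: "F \<in> C \<Longrightarrow> F \<noteq> {} \<Longrightarrow> rel_interior F \<noteq> {}"
  using convex_mem rel_interior_eq_empty by blast

text \<open>The faces that do not contain \<open>x\<close> keep a positive distance from it, so a point of the segment close to \<open>x\<close> lies in a face
that contains \<open>x\<close>, and such a face contains \<open>F\<close>.\<close>

lemma initial_segment_in_face:
  assumes "F \<in> C" "x \<in> rel_interior F" "0 < e"
    and seg: "\<And>s. 0 < s \<Longrightarrow> s \<le> e \<Longrightarrow> x + s *\<^sub>R d \<in> \<Union>C"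
  shows "\<exists>G\<in>C. F \<subseteq> G \<and> (\<exists>s>0. x + s *\<^sub>R d \<in> G)"
proof -
  let ?Z = "\<Union>{G \<in> C. x \<notin> G}"
  have "closed ?Z" using finite_C closed_mem by (intro closed_Union) auto
  then have op: "open (- ?Z)" by (simp add: open_Compl)
  have lim: "((\<lambda>s. x + s *\<^sub>R d) \<longlongrightarrow> x + 0 *\<^sub>R d) (at_right 0)"
    by (intro tendsto_intros)
  have "\<forall>\<^sub>F s in at_right 0. x + s *\<^sub>R d \<in> - ?Z"
    by (rule topological_tendstoD[OF lim op]) simp
  moreover have "\<forall>\<^sub>F s in at_right 0. s \<in> {0<..<e}"
    using assms(3) by (rule eventually_at_rightI[rotated]) auto
  ultimately have "\<forall>\<^sub>F s in at_right (0::real). x + s *\<^sub>R d \<in> - ?Z \<and> s \<in> {0<..<e}"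
    by (rule eventually_conj)
  then obtain s where s: "x + s *\<^sub>R d \<in> - ?Z" "0 < s" "s < e"
    using eventually_happens[of _ "at_right (0::real)"] by auto
  obtain G where "G \<in> C" "x + s *\<^sub>R d \<in> G" using seg[of s] s by auto
  moreover from this have "x \<in> G" using s(1) by blast
  ultimately show ?thesis using rel_interior_subset_mem[OF assms(1) _ assms(2)] s(2) by blast
qed

end

section \<open>Sweeping a complex from a point\<close>

text \<open>The complex is placed at height one with \<open>z\<close> above the origin. Then the direction \<open>lift_at z z\<close> is vertical, and every
nonempty face enters its open half-space.\<close>

definition lift_at :: "'a \<Rightarrow> 'a \<Rightarrow> 'a::real_vector \<times> real"
  where "lift_at z x = (x - z, 1)"

lemma inj_lift_at: "inj (lift_at z)"
  unfolding lift_at_def inj_on_def by simp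

lemma sum_lift_at:
  "(\<Sum>v\<in>lift_at z ` S. c v *\<^sub>R v) =
    ((\<Sum>v\<in>S. c (lift_at z v) *\<^sub>R v) - (\<Sum>v\<in>S. c (lift_at z v)) *\<^sub>R z, \<Sum>v\<in>S. c (lift_at z v))"
proof -
  have "(\<Sum>v\<in>lift_at z ` S. c v *\<^sub>R v) = (\<Sum>v\<in>S. c (lift_at z v) *\<^sub>R lift_at z v)"
    by (simp add: sum.reindex[OF inj_on_subset[OF inj_lift_at subset_UNIV]])
  also have "\<dots> = (\<Sum>v\<in>S. (c (lift_at z v) *\<^sub>R v - c (lift_at z v) *\<^sub>R z, c (lift_at z v)))"
    by (simp add: lift_at_def scaleR_diff_right)
  finally show ?thesis by (simp add: sum_prod sum_subtractf scaleR_sum_left)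
qed

context geometric_complex
begin

abbreviation flag :: "'a set set \<Rightarrow> bool"
  where "flag \<equiv> subset.chain (C - {{}})"

text \<open>The wedge over the empty set is the cone spanned by the lifted face; the height of a point of the cone is the sum of
its coefficients.\<close>

lemma scaled_lift_mem_wedge_iff:
  assumes "G \<in> C" "0 < m"
  shows "m *\<^sub>R lift_at z y \<in> wedge {} (lift_at z ` verts G) \<longleftrightarrow> y \<in> G"
proof
  assume "m *\<^sub>R lift_at z y \<in> wedge {} (lift_at z ` verts G)"
  then obtain c where c: "\<And>v. v \<in> lift_at z ` verts G \<Longrightarrow> v \<notin> {} \<Longrightarrow> 0 \<le> c v"
      "m *\<^sub>R lift_at z y = (\<Sum>v\<in>lift_at z ` verts G. c v *\<^sub>R v)"
    by (rule wedgeE) blast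
  let ?c = "\<lambda>v. c (lift_at z v)"
  have "m *\<^sub>R lift_at z y = (m *\<^sub>R (y - z), m)" by (simp add: lift_at_def)
  from c(2)[unfolded this sum_lift_at prod.inject]
  have m: "m = sum ?c (verts G)" and "m *\<^sub>R (y - z) = (\<Sum>v\<in>verts G. ?c v *\<^sub>R v) - sum ?c (verts G) *\<^sub>R z"
    by blast+
  then have "m *\<^sub>R y = (\<Sum>v\<in>verts G. ?c v *\<^sub>R v)" by (simp add: scaleR_diff_right)
  then have "(1/m) *\<^sub>R m *\<^sub>R y = (1/m) *\<^sub>R (\<Sum>v\<in>verts G. ?c v *\<^sub>R v)" by simp
  then have "y = (1/m) *\<^sub>R (\<Sum>v\<in>verts G. ?c v *\<^sub>R v)" using assms(2) by simp
  then have "y = (\<Sum>v\<in>verts G. (?c v / m) *\<^sub>R v)" by (simp add: scaleR_sum_right)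
  moreover have "(\<Sum>v\<in>verts G. ?c v / m) = 1"
    using m assms(2) by (simp flip: sum_divide_distrib)
  ultimately show "y \<in> G"
    using mem_iff[OF assms(1)] c(1) assms(2) by (intro iffD2[OF mem_iff[OF assms(1)]] exI[of _ "\<lambda>v. ?c v / m"]) auto
next
  assume "y \<in> G"
  then obtain c where c: "\<forall>v\<in>verts G. 0 \<le> c v" "sum c (verts G) = 1" "(\<Sum>v\<in>verts G. c v *\<^sub>R v) = y"
    using mem_iff[OF assms(1)] by auto
  let ?d = "\<lambda>u. c (fst u + z)"
  have d: "?d (lift_at z v) = c v" for v by (simp add: lift_at_def)
  have "lift_at z y \<in> wedge {} (lift_at z ` verts G)"
    by (rule wedgeI[where c = ?d]) (use c in \<open>auto simp: sum_lift_at d, auto simp: lift_at_def\<close>)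
  then show "m *\<^sub>R lift_at z y \<in> wedge {} (lift_at z ` verts G)"
    using wedge_scale assms(2) by fastforce
qed

lemma lift_mem_open_wedge:
  assumes "F \<in> C" "x \<in> rel_interior F"
  shows "lift_at z x \<in> open_wedge {} (lift_at z ` verts F)"
proof -
  obtain c where c: "\<forall>v\<in>verts F. 0 < c v" "sum c (verts F) = 1" "(\<Sum>v\<in>verts F. c v *\<^sub>R v) = x"
    using rel_interior_mem_iff[OF assms(1)] assms(2) by auto
  let ?d = "\<lambda>u. c (fst u + z)"
  have d: "?d (lift_at z v) = c v" for v by (simp add: lift_at_def)
  have "lift_at z x = (\<Sum>v\<in>lift_at z ` verts F. ?d v *\<^sub>R v)"
    using c by (simp add: sum_lift_at d) (simp add: lift_at_def)
  moreover have "\<forall>v\<in>lift_at z ` verts F - {}. 0 < ?d v" using c(1) by (auto simp: d)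
  ultimately show ?thesis unfolding open_wedge_def by (intro CollectI exI[of _ ?d] conjI)
qed

lemma fan: "simplicial_fan ((\<lambda>F. lift_at z ` verts F) ` C)"
proof
  show "finite ((\<lambda>F. lift_at z ` verts F) ` C)" using finite_C by simp
  show "finite S" if "S \<in> (\<lambda>F. lift_at z ` verts F) ` C" for S using that verts(2) by auto
next
  fix S S' assume "S \<in> (\<lambda>F. lift_at z ` verts F) ` C" "S' \<subseteq> S"
  then obtain F where F: "F \<in> C" "S' \<subseteq> lift_at z ` verts F" by blast
  then obtain U where U: "U \<subseteq> verts F" "S' = lift_at z ` U" by (auto simp: subset_image_iff)
  show "S' \<in> (\<lambda>F. lift_at z ` verts F) ` C"
    using verts_subset_face[OF F(1) U(1)] U(2) by (intro image_eqI[of _ _ "convex hull U"]) auto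
next
  fix S S' and c c' :: "'a \<times> real \<Rightarrow> real"
  assume S: "S \<in> (\<lambda>F. lift_at z ` verts F) ` C" "S' \<in> (\<lambda>F. lift_at z ` verts F) ` C"
    and c: "\<And>v. v \<in> S \<Longrightarrow> 0 < c v" "\<And>v. v \<in> S' \<Longrightarrow> 0 < c' v"
    and eq: "(\<Sum>v\<in>S. c v *\<^sub>R v) = (\<Sum>v\<in>S'. c' v *\<^sub>R v)"
  obtain F F' where F: "F \<in> C" "S = lift_at z ` verts F" and F': "F' \<in> C" "S' = lift_at z ` verts F'"
    using S by blast
  define m where "m = (\<Sum>v\<in>verts F. c (lift_at z v))"
  have sums: "m = (\<Sum>v\<in>verts F'. c' (lift_at z v))"
      "(\<Sum>v\<in>verts F. c (lift_at z v) *\<^sub>R v) = (\<Sum>v\<in>verts F'. c' (lift_at z v) *\<^sub>R v)"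
  proof -
    have *: "(\<Sum>v\<in>verts F. c (lift_at z v) *\<^sub>R v) - m *\<^sub>R z =
        (\<Sum>v\<in>verts F'. c' (lift_at z v) *\<^sub>R v) - (\<Sum>v\<in>verts F'. c' (lift_at z v)) *\<^sub>R z"
      and m: "m = (\<Sum>v\<in>verts F'. c' (lift_at z v))"
      using eq unfolding F F' sum_lift_at prod.inject m_def by blast+
    show "m = (\<Sum>v\<in>verts F'. c' (lift_at z v))" by (fact m)
    show "(\<Sum>v\<in>verts F. c (lift_at z v) *\<^sub>R v) = (\<Sum>v\<in>verts F'. c' (lift_at z v) *\<^sub>R v)"
      using *[folded m] by simp
  qed
  have pos: "0 < m" if "verts F \<noteq> {} \<or> verts F' \<noteq> {}"
    using that
  proof
    assume "verts F \<noteq> {}"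
    then show ?thesis unfolding m_def by (rule sum_pos[OF verts(2)[OF F(1)]]) (use c F in auto)
  next
    assume "verts F' \<noteq> {}"
    then show ?thesis unfolding sums(1) by (rule sum_pos[OF verts(2)[OF F'(1)]]) (use c F' in auto)
  qed
  have "verts F = verts F'"
  proof (cases "verts F = {} \<and> verts F' = {}")
    case False
    then have m: "0 < m" using pos by blast
    define x where "x = (1/m) *\<^sub>R (\<Sum>v\<in>verts F. c (lift_at z v) *\<^sub>R v)"
    have "x \<in> rel_interior F"
      unfolding rel_interior_mem_iff[OF F(1)]
      by (rule exI[of _ "\<lambda>v. c (lift_at z v) / m"])
        (use c(1) F m in \<open>simp add: x_def scaleR_sum_right m_def flip: sum_divide_distrib\<close>)
    moreover have "x \<in> rel_interior F'"
      unfolding rel_interior_mem_iff[OF F'(1)]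
      by (rule exI[of _ "\<lambda>v. c' (lift_at z v) / m"])
        (use c(2) F' m in \<open>simp add: x_def scaleR_sum_right sums flip: sum_divide_distrib\<close>)
    ultimately show ?thesis using rel_interior_unique F(1) F'(1) by blast
  qed simp
  then show "S = S'" using F F' by simp
qed

text \<open>Lifting turns the motion from a point of \<open>F\<close> towards \<open>z\<close> into the vertical direction, up to vectors in the span of \<open>F\<close>,
so the hypotheses \<open>empty\<close> and \<open>exit\<close> become the condition on \<open>B\<close> in \<open>chains_vanish\<close>. The empty face
plays the role of \<open>\<kappa>\<close>.\<close>

lemma chains_vanish_from_point:
  assumes B: "B \<subseteq> C" "\<And>F G. F \<in> C \<Longrightarrow> G \<in> B \<Longrightarrow> F \<subseteq> G \<Longrightarrow> F \<in> B"
    and ne: "C \<noteq> {}"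
    and empty: "{} \<notin> B \<longleftrightarrow> z \<in> \<Union>C"
    and exit: "\<And>F x. F \<in> C \<Longrightarrow> x \<in> rel_interior F \<Longrightarrow>
      F \<notin> B \<longleftrightarrow> (\<exists>G\<in>C. F \<subseteq> G \<and> (\<exists>s>0. x + s *\<^sub>R (z - x) \<in> G))"
  shows "vanishes (chains_off ({} \<in> B) (C - {{}}) B)"
proof -
  define g where "g F = lift_at z ` verts F" for F
  interpret fan: simplicial_fan "g ` C" unfolding g_def by (rule fan)
  have gle: "g F \<subseteq> g G \<longleftrightarrow> F \<subseteq> G" if "F \<in> C" "G \<in> C" for F G
    using inj_image_subset_iff[OF inj_lift_at, of z] verts_subset_iff[OF that] unfolding g_def by simp
  then have ginj: "inj_on g C" by (intro inj_onI subset_antisym) (metis order_refl)+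
  have g0: "g {} = {}" using verts_empty_iff[OF empty_mem[OF ne]] unfolding g_def by simp
  define w :: "'a \<times> real" where "w = (0, 1)"
  have wz: "w = lift_at z z" unfolding w_def lift_at_def by simp
  have gB: "g F \<in> g ` B \<longleftrightarrow> F \<in> B" if "F \<in> C" for F
    using inj_on_image_mem_iff[OF ginj that B(1)] .
  have fin: "finite (g F)" if "F \<in> C" for F using verts(2)[OF that] unfolding g_def by simp
  have wedge_iff: "w \<in> wedge (g F) (g G) \<longleftrightarrow> (\<exists>s>0. x + s *\<^sub>R (z - x) \<in> G)"
    if FG: "F \<in> C" "G \<in> C" "F \<subseteq> G" and x: "x \<in> rel_interior F" for F G x
  proof
    have x_open: "lift_at z x \<in> open_wedge {} (g F)"
      using lift_mem_open_wedge[OF FG(1) x] unfolding g_def .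
    {
      assume "w \<in> wedge (g F) (g G)"
      from open_wedge_perturb[OF fin[OF FG(2)] empty_subsetI _ x_open this] gle[OF FG(1,2)] FG(3)
      obtain s where s: "0 < s" "lift_at z x + s *\<^sub>R w \<in> wedge {} (g G)" by blast
      have "lift_at z x + s *\<^sub>R w = (1 + s) *\<^sub>R lift_at z (x + (s/(1+s)) *\<^sub>R (z - x))"
      proof -
        have "x - z = (1+s) *\<^sub>R (x - z) + s *\<^sub>R (z - x)" by (simp add: algebra_simps)
        also have "\<dots> = (1+s) *\<^sub>R (x - z) + ((1+s) * (s/(1+s))) *\<^sub>R (z - x)" using s(1) by simp
        finally show ?thesis
          unfolding lift_at_def w_def by (simp add: scaleR_add_right add_diff_eq scaleR_diff_right)
      qed
      then have "x + (s/(1+s)) *\<^sub>R (z - x) \<in> G"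
        using scaled_lift_mem_wedge_iff[OF FG(2), of "1 + s"] s unfolding g_def by simp
      then show "\<exists>s>0. x + s *\<^sub>R (z - x) \<in> G" using s(1) by (intro exI[of _ "s/(1+s)"]) simp
    }
    {
      assume "\<exists>s>0. x + s *\<^sub>R (z - x) \<in> G"
      then obtain s where s: "0 < s" "x + s *\<^sub>R (z - x) \<in> G" by blast
      have "(1/s) *\<^sub>R lift_at z (x + s *\<^sub>R (z - x)) \<in> wedge {} (g G)"
        using scaled_lift_mem_wedge_iff[OF FG(2), of "1/s"] s unfolding g_def by simp
      then have mem: "(1/s) *\<^sub>R lift_at z (x + s *\<^sub>R (z - x)) \<in> wedge (g F) (g G)"
        using wedge_mono[OF fin[OF FG(2)] empty_subsetI subset_refl] by blast
      obtain c where c: "lift_at z x = (\<Sum>v\<in>g F. c v *\<^sub>R v)" using x_open by (rule open_wedgeE) blast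
      have "(1/s - 1) *\<^sub>R lift_at z x = (\<Sum>v\<in>g F. ((1/s - 1) * c v) *\<^sub>R v)"
        unfolding c by (simp add: scaleR_sum_right)
      from iffD2[OF wedge_shift_iff[OF fin[OF FG(2)] subset_refl _ this] mem] gle[OF FG(1,2)] FG(3)
      have "(1/s) *\<^sub>R lift_at z (x + s *\<^sub>R (z - x)) - (1/s - 1) *\<^sub>R lift_at z x \<in> wedge (g F) (g G)"
        by blast
      moreover have "(1/s) *\<^sub>R lift_at z (x + s *\<^sub>R (z - x)) - (1/s - 1) *\<^sub>R lift_at z x = w"
        using s(1) unfolding lift_at_def w_def by (simp add: algebra_simps)
      ultimately show "w \<in> wedge (g F) (g G)" by simp
    }
  qed
  have cond: "S \<notin> g ` B \<longleftrightarrow> (\<exists>T\<in>g ` C. S \<subseteq> T \<and> w \<in> wedge S T)" if "S \<in> g ` C" for S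
  proof -
    obtain F where F: "F \<in> C" "S = g F" using \<open>S \<in> g ` C\<close> by blast
    have "(\<exists>T\<in>g ` C. S \<subseteq> T \<and> w \<in> wedge S T) \<longleftrightarrow> (\<exists>G\<in>C. F \<subseteq> G \<and> w \<in> wedge (g F) (g G))"
      using gle[OF F(1)] F(2) by auto
    also have "\<dots> \<longleftrightarrow> F \<notin> B"
    proof (cases "F = {}")
      case True
      have "w \<in> wedge {} (g G) \<longleftrightarrow> z \<in> G" if "G \<in> C" for G
        using scaled_lift_mem_wedge_iff[OF that, of 1 z z] wz unfolding g_def by simp
      then show ?thesis using True g0 empty by auto
    next
      case False
      then obtain x where x: "x \<in> rel_interior F" using rel_interior_nonempty[OF F(1)] by blast
      show ?thesis using exit[OF F(1) x] wedge_iff[OF F(1) _ _ x] by blast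
    qed
    finally show ?thesis using gB[OF F(1)] F(2) by simp
  qed
  have "vanishes (chains_off ({} \<in> g ` B) {\<tau> \<in> g ` C. {} \<subset> \<tau> \<and> (\<exists>y\<in>wedge {} \<tau>. 0 < w \<bullet> y)} (g ` B))"
  proof (rule fan.chains_vanish)
    show "{} \<in> g ` C" using g0 empty_mem[OF ne] by (metis imageI)
    show "w \<noteq> 0" unfolding w_def by (simp add: zero_prod_def)
    show "\<sigma> \<in> g ` B" if \<sigma>\<tau>: "\<tau> \<in> g ` B" "\<sigma> \<subseteq> \<tau>" for \<sigma> \<tau>
    proof -
      obtain G where G: "G \<in> B" "\<tau> = g G" using \<sigma>\<tau>(1) by blast
      have "\<sigma> \<in> g ` C" using fan.subset_mem[of \<tau> \<sigma>] G B(1) \<sigma>\<tau>(2) by blast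
      then obtain F where F: "F \<in> C" "\<sigma> = g F" by blast
      then have "F \<subseteq> G" using gle[OF F(1), of G] G B(1) \<sigma>\<tau>(2) by blast
      then show ?thesis using B(2)[OF F(1) G(1)] F(2) by blast
    qed
  qed (use cond in auto)
  moreover have "{\<tau> \<in> g ` C. {} \<subset> \<tau> \<and> (\<exists>y\<in>wedge {} \<tau>. 0 < w \<bullet> y)} = g ` (C - {{}})"
  proof -
    have "\<exists>y\<in>wedge {} (g F). 0 < w \<bullet> y" if F: "F \<in> C" "F \<noteq> {}" for F
    proof -
      obtain x where "x \<in> F" using F(2) by blast
      then have "lift_at z x \<in> wedge {} (g F)"
        using scaled_lift_mem_wedge_iff[OF F(1), of 1 z x] unfolding g_def by simp
      moreover have "0 < w \<bullet> lift_at z x" unfolding w_def lift_at_def by simp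
      ultimately show ?thesis by blast
    qed
    moreover have "g F = {} \<longleftrightarrow> F = {}" if "F \<in> C" for F
      using verts_empty_iff[OF that] unfolding g_def by simp
    ultimately show ?thesis by blast
  qed
  moreover have "{} \<in> g ` B \<longleftrightarrow> {} \<in> B" using gB[OF empty_mem[OF ne]] g0 by simp
  ultimately have vanish: "vanishes (chains_off ({} \<in> B) (g ` (C - {{}})) (g ` B))" by simp
  \<comment> \<open>Return from chains of cones to chains of faces.\<close>
  define h where "h = inv_into C g"
  have hg: "h (g F) = F" if "F \<in> C" for F unfolding h_def using ginj that by simp
  have hgk: "h ` g ` k = k" if "k \<subseteq> C" for k
    using that hg by (force simp: image_image)
  let ?X = "chains_off ({} \<in> B) (g ` (C - {{}})) (g ` B)"
  have mem_X: "g ` l \<in> ?X \<longleftrightarrow> l \<in> chains_off ({} \<in> B) (C - {{}}) B" if l: "l \<subseteq> C - {{}}" for l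
  proof -
    have "(\<forall>X\<in>g ` l. \<forall>Y\<in>g ` l. X \<subseteq> Y \<or> Y \<subseteq> X) \<longleftrightarrow> (\<forall>F\<in>l. \<forall>G\<in>l. g F \<subseteq> g G \<or> g G \<subseteq> g F)"
      by (simp only: ball_simps)
    also have "\<dots> \<longleftrightarrow> (\<forall>F\<in>l. \<forall>G\<in>l. F \<subseteq> G \<or> G \<subseteq> F)"
      by (intro ball_cong refl) (use gle l in blast)
    finally have "subset.chain (g ` (C - {{}})) (g ` l) \<longleftrightarrow> subset.chain (C - {{}}) l"
      using l image_mono[OF l, of g] by (simp only: subset_chain_def simp_thms)
    moreover have "g ` l \<subseteq> g ` B \<longleftrightarrow> l \<subseteq> B"
      by (rule inj_on_image_subset_iff[OF ginj _ B(1)]) (use l in blast)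
    ultimately show ?thesis unfolding chains_off_def by simp
  qed
  have X: "?X = (`) g ` chains_off ({} \<in> B) (C - {{}}) B"
  proof (intro subset_antisym subsetI)
    fix k assume k: "k \<in> ?X"
    then have "k \<subseteq> g ` (C - {{}})" unfolding chains_off_def subset_chain_def by blast
    then obtain l where l: "l \<subseteq> C - {{}}" "k = g ` l" by (auto simp: subset_image_iff)
    then show "k \<in> (`) g ` chains_off ({} \<in> B) (C - {{}}) B"
      using k mem_X[OF l(1)] by simp
  next
    fix k assume "k \<in> (`) g ` chains_off ({} \<in> B) (C - {{}}) B"
    then obtain l where l: "l \<in> chains_off ({} \<in> B) (C - {{}}) B" "k = g ` l" by (rule imageE) simp
    then have "l \<subseteq> C - {{}}" by (simp add: chains_off_def subset_chain_def)
    then show "k \<in> ?X" using mem_X l by simp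
  qed
  let ?Y = "chains_off ({} \<in> B) (C - {{}}) B"
  have Y: "l \<subseteq> C" if "l \<in> ?Y" for l
    using that by (auto simp: chains_off_def subset_chain_def)
  have "vanishes ((`) h ` ?X)"
  proof (rule vanishes_image[OF vanish])
    show "h ` s \<subseteq> h ` t \<longleftrightarrow> s \<subseteq> t" if st: "s \<in> ?X" "t \<in> ?X" for s t
    proof -
      obtain l where l: "s = g ` l" "l \<in> ?Y" using st(1) unfolding X by (rule imageE)
      obtain l' where l': "t = g ` l'" "l' \<in> ?Y" using st(2) unfolding X by (rule imageE)
      have "g ` l \<subseteq> g ` l' \<longleftrightarrow> l \<subseteq> l'"
        by (rule inj_on_image_subset_iff[OF ginj Y[OF l(2)] Y[OF l'(2)]])
      then show ?thesis by (simp only: l(1) l'(1) hgk[OF Y[OF l(2)]] hgk[OF Y[OF l'(2)]])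
    qed
    show "\<exists>y. h ` insert x s = insert y (h ` s)" for s x by blast
  qed
  moreover have "(`) h ` ?X = ?Y"
  proof -
    have "(`) h ` ?X = (\<lambda>l. h ` g ` l) ` ?Y" unfolding X by (simp only: image_image)
    also have "\<dots> = (\<lambda>l. l) ` ?Y" by (rule image_cong[OF refl]) (rule hgk[OF Y])
    finally show ?thesis by simp
  qed
  ultimately show ?thesis by simp
qed

text \<open>No point leaves the complex when it moves towards a star-centre, so \<open>B\<close> is empty.\<close>

lemma starlike_chains_vanish:
  assumes "starlike (\<Union>C)"
  shows "vanishes {k. flag k}"
proof -
  obtain z where z: "z \<in> \<Union>C" "\<And>x. x \<in> \<Union>C \<Longrightarrow> closed_segment z x \<subseteq> \<Union>C"
    using assms unfolding starlike_def by blast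
  have "vanishes (chains_off (({} :: 'a set) \<in> {}) (C - {{}}) {})"
  proof (rule chains_vanish_from_point[where z = z])
    fix F x assume F: "F \<in> C" "x \<in> rel_interior F"
    have "x + s *\<^sub>R (z - x) \<in> \<Union>C" if "0 < s" "s \<le> 1" for s
    proof -
      have "x \<in> \<Union>C" using F rel_interior_subset by blast
      moreover have "x + s *\<^sub>R (z - x) \<in> closed_segment z x"
        unfolding in_segment by (rule exI[of _ "1 - s"]) (use that in \<open>auto simp: algebra_simps\<close>)
      ultimately show ?thesis using z(2) by blast
    qed
    from initial_segment_in_face[OF F zero_less_one this]
    show "F \<notin> {} \<longleftrightarrow> (\<exists>G\<in>C. F \<subseteq> G \<and> (\<exists>s>0. x + s *\<^sub>R (z - x) \<in> G))" by blast
  qed (use z(1) in auto)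
  then show ?thesis by (simp add: chains_off_def)
qed

end

section \<open>Derived subdivisions\<close>

locale derived_complex = geometric_complex C for C :: "'a::euclidean_space set set" +
  fixes p :: "'a set \<Rightarrow> 'a"
  assumes p: "F \<in> C \<Longrightarrow> F \<noteq> {} \<Longrightarrow> p F \<in> rel_interior F"
begin

definition simplex_of :: "'a set set \<Rightarrow> 'a set"
  where "simplex_of K = convex hull (p ` K)"

definition sd :: "'a set set"
  where "sd = {simplex_of K | K. flag K}"

lemma chainD:
  assumes "flag K"
  shows "finite K" "F \<in> K \<Longrightarrow> F \<in> C" "F \<in> K \<Longrightarrow> F \<noteq> {}"
  using assms finite_subset[OF _ finite_C, of K] by (auto simp: subset_chain_def)

lemma p_mem: "F \<in> C \<Longrightarrow> F \<noteq> {} \<Longrightarrow> p F \<in> F"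
  using p rel_interior_subset by blast

lemma inj_on_p: "inj_on p (C - {{}})"
  using p rel_interior_unique by (intro inj_onI) (metis Diff_iff singletonI)

lemma chain_Union:
  assumes "flag K" "K \<noteq> {}"
  shows "\<Union>K \<in> K"
  by (rule Union_in_chain[OF chainD(1)[OF assms(1)] assms(2,1)])

text \<open>The largest face of the chain contains all the points, and contributes one of its relative interior.\<close>

lemma chain_sum_mem_rel_interior:
  assumes K: "flag K" "K \<noteq> {}" and c: "\<And>F. F \<in> K \<Longrightarrow> 0 < c F"
  shows "(1 / sum c K) *\<^sub>R (\<Sum>F\<in>K. c F *\<^sub>R p F) \<in> rel_interior (\<Union>K)"
proof -
  define F where "F = \<Union>K"
  have F: "F \<in> K" unfolding F_def by (rule chain_Union[OF K])
  have FC: "F \<in> C" "F \<noteq> {}" using chainD[OF K(1)] F by auto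
  note fin = chainD(1)[OF K(1)]
  have pos: "0 < sum c K" by (rule sum_pos[OF fin K(2) c])
  define r where "r = sum c (K - {F})"
  have tot: "sum c K = c F + r" unfolding r_def using sum.remove[OF fin F] .
  have sumF: "(\<Sum>G\<in>K. c G *\<^sub>R p G) = c F *\<^sub>R p F + (\<Sum>G\<in>K - {F}. c G *\<^sub>R p G)"
    by (rule sum.remove[OF fin F])
  show ?thesis
  proof (cases "K - {F} = {}")
    case True
    then have "K = {F}" using F by blast
    then show ?thesis using p[OF FC] c[OF F] by simp
  next
    case False
    have r: "0 < r" unfolding r_def by (rule sum_pos) (use fin False c in auto)
    define y where "y = (\<Sum>G\<in>K - {F}. (c G / r) *\<^sub>R p G)"
    have "y \<in> F" unfolding y_def
    proof (rule convex_sum)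
      show "(\<Sum>G\<in>K - {F}. c G / r) = 1" using r unfolding r_def by (simp flip: sum_divide_distrib)
      show "p G \<in> F" if "G \<in> K - {F}" for G
        using p_mem[of G] chainD(2,3)[OF K(1), of G] that unfolding F_def by blast
    qed (use fin convex_mem[OF FC(1)] c r in \<open>auto intro: less_imp_le\<close>)
    then have "y - (c F / sum c K) *\<^sub>R (y - p F) \<in> rel_interior F"
      using c[OF F] r tot by (intro rel_interior_convex_shrink convex_mem[OF FC(1)] p[OF FC]) auto
    moreover have "(1 / sum c K) *\<^sub>R (\<Sum>G\<in>K. c G *\<^sub>R p G) = y - (c F / sum c K) *\<^sub>R (y - p F)"
    proof -
      have ry: "(\<Sum>G\<in>K - {F}. c G *\<^sub>R p G) = r *\<^sub>R y" using r by (simp add: y_def scaleR_sum_right)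
      have "r / sum c K = 1 - c F / sum c K" using pos tot by (simp add: field_simps)
      have "(1 / sum c K) *\<^sub>R (c F *\<^sub>R p F + r *\<^sub>R y) = (c F / sum c K) *\<^sub>R p F + (r / sum c K) *\<^sub>R y"
        by (simp add: scaleR_add_right)
      also have "\<dots> = (c F / sum c K) *\<^sub>R p F + (1 - c F / sum c K) *\<^sub>R y"
        by (simp only: \<open>r / sum c K = 1 - c F / sum c K\<close>)
      also have "\<dots> = y - (c F / sum c K) *\<^sub>R (y - p F)" by (simp add: algebra_simps)
      finally show ?thesis unfolding sumF ry .
    qed
    ultimately show ?thesis unfolding F_def by simp
  qed
qed

text \<open>Both sums, divided by the total weight, lie in the relative interior of the largest face of their chain, so the largest faces agree.
Subtract the smaller of its two weights on both sides. This face then disappears from one chain at least, and hence from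
both by the uniqueness for shorter chains, so its weights are equal.\<close>

lemma chain_coordinates_unique:
  assumes "flag K" "flag L"
    and "\<And>F. F \<in> K \<Longrightarrow> 0 < a F" "\<And>F. F \<in> L \<Longrightarrow> 0 < b F"
    and "sum a K = sum b L" "(\<Sum>F\<in>K. a F *\<^sub>R p F) = (\<Sum>F\<in>L. b F *\<^sub>R p F)"
  shows "K = L \<and> (\<forall>F\<in>K. a F = b F)"
  using assms
proof (induction "card K + card L" arbitrary: K L a b rule: less_induct)
  case less
  note ch = less.prems(1,2) and a = less.prems(3) and b = less.prems(4)
    and tot = less.prems(5) and eq = less.prems(6)
  have fin: "finite K" "finite L" using chainD(1) ch by blast+
  have pos: "K \<noteq> {} \<Longrightarrow> 0 < sum a K" "L \<noteq> {} \<Longrightarrow> 0 < sum b L"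
    by (rule sum_pos[OF fin(1) _ a], assumption+) (rule sum_pos[OF fin(2) _ b], assumption+)
  show ?case
  proof (cases "K = {} \<or> L = {}")
    case True
    then have "K = {} \<and> L = {}" using pos tot by (metis less_irrefl sum.empty)
    then show ?thesis by simp
  next
    case False
    have "\<Union>K = \<Union>L"
    proof (rule rel_interior_unique)
      show "\<Union>K \<in> C" "\<Union>L \<in> C" using chain_Union[OF ch(1)] chain_Union[OF ch(2)] chainD(2) ch False by blast+
      show "(1 / sum a K) *\<^sub>R (\<Sum>F\<in>K. a F *\<^sub>R p F) \<in> rel_interior (\<Union>K)"
        by (rule chain_sum_mem_rel_interior[OF ch(1)]) (use False a in auto)
      show "(1 / sum a K) *\<^sub>R (\<Sum>F\<in>K. a F *\<^sub>R p F) \<in> rel_interior (\<Union>L)"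
        unfolding tot eq by (rule chain_sum_mem_rel_interior[OF ch(2)]) (use False b in auto)
    qed
    then obtain F where F: "F \<in> K" "F \<in> L"
      using chain_Union[OF ch(1)] chain_Union[OF ch(2)] False by metis
    define t where "t = min (a F) (b F)"
    have t: "0 < t" "t \<le> a F" "t \<le> b F" unfolding t_def using a F b by auto
    define a' b' where "a' = a(F := a F - t)" and "b' = b(F := b F - t)"
    define K' L' where "K' = {G \<in> K. a' G \<noteq> 0}" and "L' = {G \<in> L. b' G \<noteq> 0}"
    have part: "sum c' M' = sum c M - t \<and> (\<Sum>G\<in>M'. c' G *\<^sub>R p G) = (\<Sum>G\<in>M. c G *\<^sub>R p G) - t *\<^sub>R p F"
      if M: "finite M" "F \<in> M" "c' = c(F := c F - t)" "M' = {G \<in> M. c' G \<noteq> 0}" for c c' M M'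
    proof -
      have "sum c' M' = sum c' M" "(\<Sum>G\<in>M'. c' G *\<^sub>R p G) = (\<Sum>G\<in>M. c' G *\<^sub>R p G)"
        unfolding M(4) by (rule sum.mono_neutral_left; use M(1) in auto)+
      moreover have "c' = (\<lambda>G. c G - (if G = F then t else 0))" unfolding M(3) by auto
      ultimately show ?thesis
        using M(1,2) by (simp add: sum_subtractf scaleR_diff_left if_distrib[of "\<lambda>t. t *\<^sub>R _"] cong: if_cong)
    qed
    have sub: "K' \<subseteq> K" "L' \<subseteq> L" unfolding K'_def L'_def by auto
    have notin: "F \<notin> K' \<or> F \<notin> L'" unfolding K'_def L'_def a'_def b'_def t_def by auto
    then have "K' \<subset> K \<or> L' \<subset> L" using sub F by blast
    then have "card K' + card L' < card K + card L"
      using card_mono[OF fin(1) sub(1)] card_mono[OF fin(2) sub(2)]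
        psubset_card_mono[OF fin(1), of K'] psubset_card_mono[OF fin(2), of L'] by linarith
    then have IH: "K' = L' \<and> (\<forall>G\<in>K'. a' G = b' G)"
    proof (rule less.hyps[OF _ chain_subsetI[OF ch(1) sub(1)] chain_subsetI[OF ch(2) sub(2)]])
      show "0 < a' G" if "G \<in> K'" for G using that a[of G] t unfolding K'_def a'_def by auto
      show "0 < b' G" if "G \<in> L'" for G using that b[of G] t unfolding L'_def b'_def by auto
      show "sum a' K' = sum b' L'"
        using part[OF fin(1) F(1) a'_def K'_def] part[OF fin(2) F(2) b'_def L'_def] tot by simp
      show "(\<Sum>G\<in>K'. a' G *\<^sub>R p G) = (\<Sum>G\<in>L'. b' G *\<^sub>R p G)"
        using part[OF fin(1) F(1) a'_def K'_def] part[OF fin(2) F(2) b'_def L'_def] eq by simp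
    qed
    then have "F \<notin> K'" "F \<notin> L'" using notin by auto
    then have tF: "a F = t" "b F = t" using F unfolding K'_def L'_def a'_def b'_def by auto
    have same: "G \<in> K' \<longleftrightarrow> G \<in> K" "G \<in> L' \<longleftrightarrow> G \<in> L" "a' G = a G" "b' G = b G" if "G \<noteq> F" for G
      using that a[of G] b[of G] unfolding K'_def L'_def a'_def b'_def by auto
    have "G \<in> K \<longleftrightarrow> G \<in> L" for G
      using IH same(1,2)[of G] F by (cases "G = F") auto
    then have "K = L" by blast
    moreover have "a G = b G" if "G \<in> K" for G
      using IH same(1,3,4)[of G] tF that by (cases "G = F") auto
    ultimately show ?thesis by blast
  qed
qed

lemma simplex_of_memI:
  assumes "flag K" "\<And>F. F \<in> K \<Longrightarrow> 0 \<le> c F" "sum c K = 1"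
  shows "(\<Sum>F\<in>K. c F *\<^sub>R p F) \<in> simplex_of K"
  unfolding simplex_of_def using chainD(1)[OF assms(1)] assms(2,3)
  by (intro convex_sum) (auto intro: hull_inc)

lemma simplex_of_memE:
  assumes "flag K" "x \<in> simplex_of K"
  obtains L c where "L \<subseteq> K" "\<And>F. F \<in> L \<Longrightarrow> 0 < c F" "sum c L = 1" "x = (\<Sum>F\<in>L. c F *\<^sub>R p F)"
proof -
  have fin: "finite K" using chainD(1) assms(1) .
  have inj: "inj_on p K"
    by (rule inj_on_subset[OF inj_on_p]) (use assms(1) in \<open>auto simp: subset_chain_def\<close>)
  obtain u where u: "\<forall>x\<in>p ` K. 0 \<le> u x" "sum u (p ` K) = 1" "(\<Sum>x\<in>p ` K. u x *\<^sub>R x) = x"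
    using assms(2) unfolding simplex_of_def convex_hull_finite[OF finite_imageI[OF fin]] by blast
  define c where "c F = u (p F)" for F
  define L where "L = {F \<in> K. c F \<noteq> 0}"
  have "sum c K = 1" "(\<Sum>F\<in>K. c F *\<^sub>R p F) = x"
    using u(2,3) by (simp_all add: sum.reindex[OF inj] c_def)
  moreover have "sum c L = sum c K" "(\<Sum>F\<in>L. c F *\<^sub>R p F) = (\<Sum>F\<in>K. c F *\<^sub>R p F)"
    by (rule sum.mono_neutral_left; use fin in \<open>auto simp: L_def\<close>)+
  moreover have "0 < c F" if "F \<in> L" for F using that u(1) unfolding L_def c_def by fastforce
  moreover have "L \<subseteq> K" unfolding L_def by blast
  ultimately show ?thesis using that[of L c] by simp
qed

lemma simplex_of_subset_iff:
  assumes K: "flag K" and L: "flag L"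
  shows "simplex_of K \<subseteq> simplex_of L \<longleftrightarrow> K \<subseteq> L"
proof
  assume "K \<subseteq> L"
  then show "simplex_of K \<subseteq> simplex_of L" unfolding simplex_of_def by (intro hull_mono image_mono)
next
  assume sub: "simplex_of K \<subseteq> simplex_of L"
  show "K \<subseteq> L"
  proof (cases "K = {}")
    case False
    have cK: "0 < real (card K)" using chainD(1)[OF K] False by (simp add: card_gt_0_iff)
    let ?c = "\<lambda>F. 1 / real (card K)"
    have "(\<Sum>F\<in>K. ?c F *\<^sub>R p F) \<in> simplex_of K" by (rule simplex_of_memI[OF K]) (use cK in auto)
    then have "(\<Sum>F\<in>K. ?c F *\<^sub>R p F) \<in> simplex_of L" using sub by blast
    then obtain M c where M: "M \<subseteq> L" "\<And>F. F \<in> M \<Longrightarrow> 0 < c F" "sum c M = 1"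
        "(\<Sum>F\<in>K. ?c F *\<^sub>R p F) = (\<Sum>F\<in>M. c F *\<^sub>R p F)"
      by (rule simplex_of_memE[OF L]) blast
    have "K = M \<and> (\<forall>F\<in>K. ?c F = c F)"
      by (rule chain_coordinates_unique[OF K chain_subsetI[OF L M(1)] _ M(2) _ M(4)]) (use cK M(3) in auto)
    then show ?thesis using M(1) by blast
  qed simp
qed

lemma simplex_of_Int:
  assumes K: "flag K" and L: "flag L"
  shows "simplex_of K \<inter> simplex_of L = simplex_of (K \<inter> L)"
proof
  show "simplex_of (K \<inter> L) \<subseteq> simplex_of K \<inter> simplex_of L"
    unfolding simplex_of_def by (intro Int_greatest hull_mono image_mono) auto
  show "simplex_of K \<inter> simplex_of L \<subseteq> simplex_of (K \<inter> L)"
  proof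
    fix x assume x: "x \<in> simplex_of K \<inter> simplex_of L"
    obtain M c where M: "M \<subseteq> K" "\<And>F. F \<in> M \<Longrightarrow> 0 < c F" "sum c M = 1" "x = (\<Sum>F\<in>M. c F *\<^sub>R p F)"
      by (rule simplex_of_memE[OF K]) (use x in auto)
    obtain N d where N: "N \<subseteq> L" "\<And>F. F \<in> N \<Longrightarrow> 0 < d F" "sum d N = 1" "x = (\<Sum>F\<in>N. d F *\<^sub>R p F)"
      by (rule simplex_of_memE[OF L]) (use x in auto)
    have chM: "flag M" by (rule chain_subsetI[OF K M(1)])
    have "M = N"
      using chain_coordinates_unique[OF chM chain_subsetI[OF L N(1)] M(2) N(2)] M(3,4) N(3,4) by simp
    then have "simplex_of M \<subseteq> simplex_of (K \<inter> L)"
      unfolding simplex_of_def using M(1) N(1) by (intro hull_mono image_mono) auto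
    moreover have "x \<in> simplex_of M" unfolding M(4) by (rule simplex_of_memI[OF chM _ M(3)]) (use M(2) less_imp_le in blast)
    ultimately show "x \<in> simplex_of (K \<inter> L)" by blast
  qed
qed

text \<open>Perturbing equal weights by an affine dependence would give a second representation of the same point.\<close>

lemma affine_independent_chain:
  assumes K: "flag K"
  shows "\<not> affine_dependent (p ` K)"
proof
  note fin = chainD(1)[OF K]
  have inj: "inj_on p K"
    by (rule inj_on_subset[OF inj_on_p]) (use K in \<open>auto simp: subset_chain_def\<close>)
  assume "affine_dependent (p ` K)"
  then obtain u where u: "sum u (p ` K) = 0" "\<exists>v\<in>p ` K. u v \<noteq> 0" "(\<Sum>v\<in>p ` K. u v *\<^sub>R v) = 0"
    using affine_dependent_explicit_finite[OF finite_imageI[OF fin]] by blast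
  define a where "a F = u (p F)" for F
  have s: "sum a K = 0" "(\<Sum>F\<in>K. a F *\<^sub>R p F) = 0"
    using u(1,3) by (simp_all add: sum.reindex[OF inj] a_def)
  define M where "M = 1 + (\<Sum>F\<in>K. \<bar>a F\<bar>)"
  have M: "\<bar>a F\<bar> < M" if "F \<in> K" for F
    using member_le_sum[OF that, of "\<lambda>F. \<bar>a F\<bar>"] fin unfolding M_def by simp
  have "K = K \<and> (\<forall>F\<in>K. M + a F = M)"
  proof (rule chain_coordinates_unique[OF K K])
    show "0 < M + a F" "0 < M" if "F \<in> K" for F using M[OF that] by linarith+
    show "(\<Sum>F\<in>K. M + a F) = (\<Sum>F\<in>K. M)" using s(1) by (simp add: sum.distrib)
    show "(\<Sum>F\<in>K. (M + a F) *\<^sub>R p F) = (\<Sum>F\<in>K. M *\<^sub>R p F)"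
      using s(2) by (simp add: scaleR_add_left sum.distrib)
  qed
  then show False using u(2) unfolding a_def by auto
qed

lemma sd_simplicial_complex: "simplicial_complex sd"
  unfolding simplicial_complex_def
proof (intro conjI ballI allI impI)
  have "sd \<subseteq> simplex_of ` Pow C" unfolding sd_def by (auto simp: subset_chain_def)
  then show "finite sd" using finite_subset finite_C by blast
next
  fix S assume "S \<in> sd"
  then obtain K where K: "flag K" "S = simplex_of K" unfolding sd_def by blast
  then show "\<exists>n. n simplex S"
    unfolding simplex_def simplex_of_def using affine_independent_chain[OF K(1)]
    by (intro exI[of _ "int (card (p ` K)) - 1"] exI[of _ "p ` K"]) auto
next
  fix F S assume "S \<in> sd \<and> F face_of S"
  then obtain K where K: "flag K" "F face_of simplex_of K" unfolding sd_def by blast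
  then obtain c where "c \<subseteq> p ` K" "F = convex hull c"
    using face_of_convex_hull_affine_independent[OF affine_independent_chain[OF K(1)]] unfolding simplex_of_def by blast
  then obtain L where "L \<subseteq> K" "F = simplex_of L" unfolding simplex_of_def by (auto simp: subset_image_iff)
  then show "F \<in> sd" unfolding sd_def using chain_subsetI[OF K(1)] by blast
next
  fix S S' assume "S \<in> sd \<and> S' \<in> sd"
  then obtain K L where K: "flag K" "S = simplex_of K"
    and L: "flag L" "S' = simplex_of L" unfolding sd_def by blast
  show "(S \<inter> S') face_of S"
    unfolding K(2) L(2) simplex_of_Int[OF K(1) L(1)] unfolding simplex_of_def
      face_of_convex_hull_affine_independent[OF affine_independent_chain[OF K(1)]]
    by (intro exI[of _ "p ` (K \<inter> L)"]) auto
qed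

text \<open>Move away from \<open>p F\<close> through \<open>x\<close> until the boundary of \<open>F\<close> is met, and use a chain of the proper face found there.\<close>

lemma mem_simplex_of_of_mem:
  assumes "F \<in> C" "x \<in> F"
  shows "\<exists>K. flag K \<and> \<Union>K \<subseteq> F \<and> x \<in> simplex_of K"
  using assms
proof (induction "card (verts F)" arbitrary: F x rule: less_induct)
  case less
  note F = less.prems
  have F0: "F \<noteq> {}" using F by blast
  note V = verts(1,2)[OF F(1)]
  obtain a where a: "\<forall>v\<in>verts F. 0 \<le> a v" "sum a (verts F) = 1" "(\<Sum>v\<in>verts F. a v *\<^sub>R v) = x"
    using mem_iff[OF F(1)] F(2) by auto
  obtain b where b: "\<forall>v\<in>verts F. 0 < b v" "sum b (verts F) = 1" "(\<Sum>v\<in>verts F. b v *\<^sub>R v) = p F"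
    using rel_interior_mem_iff[OF F(1)] p[OF F(1) F0] by auto
  have ne: "verts F \<noteq> {}" using verts_empty_iff F(1) F0 by blast
  obtain u where u: "u \<in> verts F" "\<And>v. v \<in> verts F \<Longrightarrow> a u / b u \<le> a v / b v"
    using ex_is_arg_min_if_finite[OF V(2) ne, of "\<lambda>v. a v / b v"] unfolding is_arg_min_linorder by blast
  \<comment> \<open>The largest multiple of \<open>p F\<close> whose subtraction from \<open>x\<close> leaves nonnegative coordinates.\<close>
  define t where "t = a u / b u"
  have t0: "0 \<le> t" unfolding t_def using a(1) b(1) u(1) by (simp add: less_imp_le)
  have le: "t * b v \<le> a v" if "v \<in> verts F" for v
    using u(2)[OF that] b(1) that unfolding t_def by (simp add: pos_le_divide_eq)
  have "t = (\<Sum>v\<in>verts F. t * b v)" using b(2) by (simp flip: sum_distrib_left)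
  also have "\<dots> \<le> sum a (verts F)" using le by (rule sum_mono)
  finally have t1: "t \<le> 1" using a(2) by simp
  have chF: "flag {F}" using F(1) F0 by (simp add: subset_chain_def)
  show ?case
  proof (cases "t = 1")
    case True
    have "\<forall>v\<in>verts F. 0 = a v - t * b v"
    proof -
      have "(\<Sum>v\<in>verts F. a v - t * b v) = 0"
        using a(2) b(2) True by (simp add: sum_subtractf)
      then show ?thesis using le sum_nonneg_eq_0_iff[OF V(2), of "\<lambda>v. a v - t * b v"] by simp
    qed
    then have "x = (\<Sum>v\<in>verts F. b v *\<^sub>R v)" unfolding a(3)[symmetric] using True by (intro sum.cong) auto
    then have "x = p F" using b(3) by simp
    then show ?thesis using chF by (intro exI[of _ "{F}"]) (simp add: simplex_of_def)
  next
    case False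
    then have t: "0 < 1 - t" using t1 by simp
    define S where "S = verts F - {u}"
    have S: "S \<subseteq> verts F" unfolding S_def by blast
    define G where "G = convex hull S"
    have G: "G \<in> C" "verts G = S" unfolding G_def using verts_subset_face[OF F(1) S] by auto
    have GF: "G \<subseteq> F" using verts_subset_iff[OF G(1) F(1)] G(2) S by simp
    define d where "d v = (a v - t * b v) / (1 - t)" for v
    have du: "d u = 0" unfolding d_def t_def using b(1) u(1) by (simp add: less_imp_neq[symmetric])
    have "(\<Sum>v\<in>verts F. a v - t * b v) = 1 - t"
      using a(2) b(2) by (simp add: sum_subtractf flip: sum_distrib_left)
    then have "sum d (verts F) = 1" unfolding d_def using t by (simp flip: sum_divide_distrib)
    then have d1: "sum d S = 1" using sum.remove[OF V(2) u(1), of d] du unfolding S_def by simp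
    define y where "y = (\<Sum>v\<in>S. d v *\<^sub>R v)"
    have "y \<in> G"
      unfolding mem_iff[OF G(1)] G(2) y_def
      by (rule exI[of _ d]) (use d1 le t in \<open>auto simp: d_def S_def\<close>)
    moreover have "card (verts G) < card (verts F)"
      unfolding G(2) S_def by (rule card_Diff1_less[OF V(2) u(1)])
    ultimately obtain K where K: "flag K" "\<Union>K \<subseteq> G" "y \<in> simplex_of K"
      using less.hyps[OF _ G(1)] by blast
    have "y = (\<Sum>v\<in>verts F. d v *\<^sub>R v)"
      using sum.remove[OF V(2) u(1), of "\<lambda>v. d v *\<^sub>R v"] du unfolding y_def S_def by simp
    then have "(1 - t) *\<^sub>R y = (\<Sum>v\<in>verts F. (a v - t * b v) *\<^sub>R v)"
      using t by (simp add: scaleR_sum_right d_def)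
    also have "\<dots> = x - t *\<^sub>R p F"
      by (simp add: scaleR_diff_left sum_subtractf a(3) b(3)[symmetric] scaleR_sum_right)
    finally have x: "x = (1 - t) *\<^sub>R y + t *\<^sub>R p F" by simp
    have "\<forall>H\<in>K. H \<subseteq> F" using K(2) GF by blast
    then have "flag (insert F K)"
      using K(1) F(1) F0 unfolding subset_chain_insert by blast
    moreover have "x \<in> simplex_of (insert F K)"
      unfolding x simplex_of_def
    proof (rule convexD[OF convex_convex_hull])
      show "y \<in> convex hull (p ` insert F K)"
        using K(3) hull_mono[of "p ` K" "p ` insert F K" convex] unfolding simplex_of_def by blast
    qed (use t0 t in \<open>auto intro: hull_inc\<close>)
    ultimately show ?thesis using K(2) GF by (intro exI[of _ "insert F K"]) auto
  qed
qed

lemma simplex_of_subset_Union: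
  assumes "flag K"
  shows "simplex_of K \<subseteq> \<Union>K"
proof (cases "K = {}")
  case False
  have "\<Union>K \<in> C" using chain_Union[OF assms False] chainD(2)[OF assms] by blast
  moreover have "p ` K \<subseteq> \<Union>K" using p_mem chainD[OF assms] by blast
  ultimately show ?thesis unfolding simplex_of_def by (simp add: hull_minimal convex_mem)
qed (simp add: simplex_of_def)

lemma Union_sd: "\<Union>sd = \<Union>C"
proof
  show "\<Union>sd \<subseteq> \<Union>C"
    unfolding sd_def using simplex_of_subset_Union chainD(2) by blast
  show "\<Union>C \<subseteq> \<Union>sd"
  proof
    fix x assume "x \<in> \<Union>C"
    then obtain K where "flag K" "x \<in> simplex_of K" using mem_simplex_of_of_mem by blast
    then show "x \<in> \<Union>sd" unfolding sd_def by blast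
  qed
qed

text \<open>As long as the empty chain stays, only nonempty faces are removed, as a free face has to be.\<close>

lemma pair_removals_imp_collapses:
  assumes "pair_removal^** X Y" "{} \<in> Y" "\<And>K. K \<in> X \<Longrightarrow> flag K"
  shows "collapses_to (simplex_of ` X) (simplex_of ` Y)"
  using assms
proof (induction rule: converse_rtranclp_induct)
  case base
  then show ?case by (simp add: collapses_to_def)
next
  case (step X X1)
  obtain s x where sx: "x \<notin> s" "s \<in> X" "insert x s \<in> X"
    "\<forall>u\<in>X. s \<subseteq> u \<longrightarrow> u = s \<or> u = insert x s" "X1 = X - {s, insert x s}"
    using step.hyps(1) unfolding pair_removal_def by blast
  have ch: "flag K" if "K \<in> X" for K using step.prems(2) that by blast
  have "{} \<in> X1" using pair_removals_subset[OF step.hyps(2)] step.prems(1) by blast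
  then have s0: "s \<noteq> {}" using sx(5) by blast
  have le: "simplex_of K \<subseteq> simplex_of L \<longleftrightarrow> K \<subseteq> L" if "K \<in> X" "L \<in> X" for K L
    using simplex_of_subset_iff ch that by blast
  have inj: "inj_on simplex_of X" using le by (intro inj_onI subset_antisym) (metis order_refl)+
  have "simplex_of s \<noteq> {}" using s0 unfolding simplex_of_def by simp
  moreover have "simplex_of s \<subset> simplex_of (insert x s)"
    using le[OF sx(2,3)] le[OF sx(3,2)] sx(1) by blast
  moreover have "\<tau> = simplex_of (insert x s)" if \<tau>: "\<tau> \<in> simplex_of ` X" "simplex_of s \<subset> \<tau>" for \<tau>
  proof -
    obtain u where u: "u \<in> X" "\<tau> = simplex_of u" using \<tau>(1) by blast
    then have "s \<subseteq> u" "u \<noteq> s" using le[OF sx(2) u(1)] \<tau>(2) by blast+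
    then show ?thesis using sx(4) u by blast
  qed
  ultimately have "free_face (simplex_of ` X) (simplex_of s)"
    unfolding free_face_def using sx(2,3) by (intro conjI ex1I[of _ "simplex_of (insert x s)"]) auto
  moreover have "deletion (simplex_of ` X) (simplex_of s) = simplex_of ` X1"
  proof -
    have "simplex_of s \<subseteq> simplex_of u \<longleftrightarrow> simplex_of u \<in> simplex_of ` {s, insert x s}" if "u \<in> X" for u
    proof -
      have "simplex_of s \<subseteq> simplex_of u \<longleftrightarrow> u \<in> {s, insert x s}" using le[OF sx(2) that] sx(4) that by blast
      also have "\<dots> \<longleftrightarrow> simplex_of u \<in> simplex_of ` {s, insert x s}"
        using inj_on_image_mem_iff[OF inj that, of "{s, insert x s}"] sx(2,3) by simp
      finally show ?thesis .
    qed
    then have "deletion (simplex_of ` X) (simplex_of s) = simplex_of ` X - simplex_of ` {s, insert x s}"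
      unfolding deletion_def by auto
    also have "\<dots> = simplex_of ` X1"
      unfolding sx(5) by (rule inj_on_image_set_diff[OF inj, symmetric]) (use sx in auto)
    finally show ?thesis .
  qed
  ultimately have "elementary_collapse (simplex_of ` X) (simplex_of ` X1)" unfolding elementary_collapse_def by metis
  moreover have "collapses_to (simplex_of ` X1) (simplex_of ` Y)"
    using step.IH step.prems(1) ch sx(5) by blast
  ultimately show ?case unfolding collapses_to_def by (rule converse_rtranclp_into_rtranclp)
qed

lemma starlike_collapsible:
  assumes "starlike (\<Union>C)"
  shows "collapsible sd"
proof -
  let ?X = "{k. flag k}"
  have "{} \<in> ?X" by (simp add: subset_chain_def)
  then obtain F where F: "pair_removal^** ?X {{}, {F}}"
    using vanishes_imp_to_vertex[OF starlike_chains_vanish[OF assms]] by blast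
  have "collapses_to (simplex_of ` ?X) (simplex_of ` {{}, {F}})"
    by (rule pair_removals_imp_collapses[OF F]) auto
  moreover have "simplex_of ` ?X = sd" unfolding sd_def by blast
  moreover have "simplex_of ` {{}, {F}} = {{}, {p F}}" unfolding simplex_of_def by simp
  ultimately show ?thesis unfolding collapsible_def by metis
qed

end

lemma derived_subdivisionE:
  assumes "simplicial_complex C" "derived_subdivision C D"
  obtains p where "derived_complex C p" "D = derived_complex.sd C p"
proof -
  obtain p where pF: "\<forall>F \<in> C - {{}}. p F \<in> rel_interior F" and D: "D = {convex hull (p ` K) | K. subset.chain (C - {{}}) K}"
    using assms(2) unfolding derived_subdivision_def by blast
  interpret derived_complex C p
    by unfold_locales (use assms(1) pF in auto)
  have "D = sd" unfolding D sd_def simplex_of_def ..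
  then show ?thesis using that derived_complex_axioms by blast
qed

section \<open>Collapses carried to a subdivision\<close>

lemma affine_coordinates_unique:
  fixes V :: "'a::real_vector set"
  assumes "\<not> affine_dependent V" "finite V" "sum a V = sum b V"
    "(\<Sum>v\<in>V. a v *\<^sub>R v) = (\<Sum>v\<in>V. b v *\<^sub>R v)" "v \<in> V"
  shows "a v = b v"
proof (rule ccontr)
  assume "a v \<noteq> b v"
  then have "affine_dependent V"
    unfolding affine_dependent_explicit_finite[OF assms(2)] using assms(3-5)
    by (intro exI[of _ "\<lambda>v. a v - b v"])
      (auto simp: sum_subtractf scaleR_diff_left intro!: bexI[of _ v])
  then show False using assms(1) by blast
qed

context geometric_complex
begin

lemma free_face_verts:
  assumes free: "free_face C \<sigma>" "\<tau> \<in> C" "\<sigma> \<subset> \<tau>"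
  obtains v where "v \<in> verts \<tau>" "verts \<sigma> = verts \<tau> - {v}"
proof -
  have \<sigma>: "\<sigma> \<in> C" using free unfolding free_face_def by blast
  have only: "\<tau>' = \<tau>" if "\<tau>' \<in> C" "\<sigma> \<subset> \<tau>'" for \<tau>'
    using free that unfolding free_face_def by metis
  have sub: "verts \<sigma> \<subset> verts \<tau>"
    using verts_subset_iff[OF \<sigma> free(2)] verts_subset_iff[OF free(2) \<sigma>] free(3) by blast
  then obtain v where v: "v \<in> verts \<tau>" "v \<notin> verts \<sigma>" by blast
  let ?\<rho> = "convex hull (verts \<tau> - {v})"
  have \<rho>: "?\<rho> \<in> C" "verts ?\<rho> = verts \<tau> - {v}"
    using verts_subset_face[OF free(2), of "verts \<tau> - {v}"] by auto
  have "\<sigma> \<subseteq> ?\<rho>" using verts_subset_iff[OF \<sigma> \<rho>(1)] \<rho>(2) sub v by auto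
  moreover have "?\<rho> \<noteq> \<tau>"
  proof
    assume "?\<rho> = \<tau>"
    then have "verts \<tau> = verts \<tau> - {v}" using \<rho>(2) by simp
    then show False using v(1) by (metis Diff_iff singletonI)
  qed
  ultimately have "?\<rho> = \<sigma>" using only[OF \<rho>(1)] by blast
  then show ?thesis using that[OF v(1)] \<rho>(2) by simp
qed

text \<open>The simplex is swept from a point \<open>z\<close> beyond \<open>v\<close>, whose coordinates at the other vertices are negative. A point of the simplex
that moves towards \<open>z\<close> leaves it at once exactly if one of these coordinates is already zero, that is, on the facets
through \<open>v\<close>.\<close>

lemma chains_vanish_off_faces_at_vertex:
  assumes V: "\<not> affine_dependent V" "v \<in> V" "V - {v} \<noteq> {}"
    and U: "\<Union>C = convex hull V"
  shows "vanishes (chains_off True (C - {{}}) {F \<in> C. \<exists>u\<in>V - {v}. F \<subseteq> convex hull (V - {u})})"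
proof -
  define B where "B = {F \<in> C. \<exists>u\<in>V - {v}. F \<subseteq> convex hull (V - {u})}"
  have fV: "finite V" using V(1) by (rule aff_independent_finite)
  define n where "n = real (card (V - {v}))"
  have n: "1 \<le> n" unfolding n_def using V(3) fV by (simp add: Suc_le_eq card_gt_0_iff)
  define \<zeta> where "\<zeta> u = (if u = v then 2 else - (1 / n))" for u
  define z where "z = (\<Sum>u\<in>V. \<zeta> u *\<^sub>R u)"
  have "sum \<zeta> (V - {v}) = -1"
  proof -
    have "sum \<zeta> (V - {v}) = (\<Sum>u\<in>V - {v}. - (1 / n))" by (rule sum.cong) (auto simp: \<zeta>_def)
    then show ?thesis using n by (simp add: n_def[symmetric])
  qed
  then have \<zeta>1: "sum \<zeta> V = 1" using sum.remove[OF fV V(2), of \<zeta>] by (simp add: \<zeta>_def)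
  have hullE: "\<exists>a. (\<forall>u\<in>V. 0 \<le> a u) \<and> sum a V = 1 \<and> (\<Sum>u\<in>V. a u *\<^sub>R u) = x"
    if "x \<in> convex hull V" for x
    using that unfolding convex_hull_finite[OF fV] by blast
  obtain u0 where u0: "u0 \<in> V - {v}" using V(3) by blast
  \<comment> \<open>The coordinates of the point moved towards \<open>z\<close>.\<close>
  have moved_coord: "(1 - s) * a u + s * \<zeta> u \<ge> 0"
    if m: "x + s *\<^sub>R (z - x) \<in> convex hull V" "sum a V = 1" "(\<Sum>u\<in>V. a u *\<^sub>R u) = x" "u \<in> V" for x s a u
  proof -
    obtain b where b: "\<forall>u\<in>V. 0 \<le> b u" "sum b V = 1" "(\<Sum>u\<in>V. b u *\<^sub>R u) = x + s *\<^sub>R (z - x)"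
      using hullE[OF m(1)] by blast
    have "b u = (1 - s) * a u + s * \<zeta> u"
    proof (rule affine_coordinates_unique[OF V(1) fV _ _ m(4)])
      show "sum b V = (\<Sum>u\<in>V. (1 - s) * a u + s * \<zeta> u)"
        using b(2) m(2) \<zeta>1 by (simp add: sum.distrib flip: sum_distrib_left)
      have "(\<Sum>u\<in>V. ((1 - s) * a u + s * \<zeta> u) *\<^sub>R u) = (1 - s) *\<^sub>R x + s *\<^sub>R z"
        unfolding m(3)[symmetric] z_def by (simp add: scaleR_add_left sum.distrib scaleR_sum_right)
      then show "(\<Sum>u\<in>V. b u *\<^sub>R u) = (\<Sum>u\<in>V. ((1 - s) * a u + s * \<zeta> u) *\<^sub>R u)"
        unfolding b(3) by (simp add: algebra_simps)
    qed
    moreover have "0 \<le> b u" using b(1) m(4) by blast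
    ultimately show ?thesis by simp
  qed
  have znot: "z \<notin> \<Union>C"
  proof
    assume "z \<in> \<Union>C"
    then have "z + 1 *\<^sub>R (z - z) \<in> convex hull V" unfolding U by simp
    from moved_coord[OF this \<zeta>1 z_def[symmetric], of u0] u0 n show False by (auto simp: \<zeta>_def)
  qed
  have Cne: "C \<noteq> {}" using U V(2) hull_inc[of v V convex] by auto
  have B0: "{} \<in> B" unfolding B_def using empty_mem[OF Cne] u0 by auto
  have in_B: "F \<in> B \<longleftrightarrow> (\<exists>u\<in>V - {v}. a u = 0)"
    if F: "F \<in> C" "x \<in> rel_interior F" and a: "\<forall>u\<in>V. 0 \<le> a u" "sum a V = 1" "(\<Sum>u\<in>V. a u *\<^sub>R u) = x" for F x a
  proof -
    have "F \<subseteq> convex hull (V - {u}) \<longleftrightarrow> a u = 0" if u: "u \<in> V" for u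
    proof
      assume "F \<subseteq> convex hull (V - {u})"
      then have "x \<in> convex hull (V - {u})" using F(2) rel_interior_subset by blast
      then obtain b where b: "\<forall>w\<in>V - {u}. 0 \<le> b w" "sum b (V - {u}) = 1" "(\<Sum>w\<in>V - {u}. b w *\<^sub>R w) = x"
        using convex_hull_finite[of "V - {u}"] fV by auto
      let ?b = "b(u := 0)"
      have "sum ?b (V - {u}) = sum b (V - {u})" by (rule sum.cong) auto
      then have b1: "sum ?b V = 1" using sum.remove[OF fV u, of ?b] b(2) by simp
      have "(\<Sum>w\<in>V - {u}. ?b w *\<^sub>R w) = (\<Sum>w\<in>V - {u}. b w *\<^sub>R w)" by (rule sum.cong) auto
      then have bx: "(\<Sum>w\<in>V. ?b w *\<^sub>R w) = x"
        using sum.remove[OF fV u, of "\<lambda>w. ?b w *\<^sub>R w"] b(3) by simp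
      have "a u = ?b u"
        by (rule affine_coordinates_unique[OF V(1) fV _ _ u]) (simp_all only: a b1 bx)
      then show "a u = 0" by simp
    next
      assume au: "a u = 0"
      have "sum a (V - {u}) = 1" "(\<Sum>w\<in>V - {u}. a w *\<^sub>R w) = x"
        using sum.remove[OF fV u, of a] sum.remove[OF fV u, of "\<lambda>w. a w *\<^sub>R w"] a(2,3) au by auto
      then have "x \<in> convex hull (V - {u})"
        using convex_hull_finite[of "V - {u}"] fV a(1) by auto
      moreover have "convex hull (V - {u}) face_of convex hull V"
        using face_of_convex_hull_affine_independent[OF V(1)] by blast
      moreover have "F \<subseteq> convex hull V" using F(1) U by blast
      ultimately show "F \<subseteq> convex hull (V - {u})" using subset_of_face_of F(2) by blast
    qed
    then show ?thesis unfolding B_def using F(1) by auto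
  qed
  have "vanishes (chains_off ({} \<in> B) (C - {{}}) B)"
  proof (rule chains_vanish_from_point[where z = z])
    show "{} \<notin> B \<longleftrightarrow> z \<in> \<Union>C" using B0 znot by blast
    show "F \<notin> B \<longleftrightarrow> (\<exists>G\<in>C. F \<subseteq> G \<and> (\<exists>s>0. x + s *\<^sub>R (z - x) \<in> G))"
      if F: "F \<in> C" "x \<in> rel_interior F" for F x
    proof -
      have "x \<in> convex hull V" using F rel_interior_subset U by blast
      then obtain a where a: "\<forall>u\<in>V. 0 \<le> a u" "sum a V = 1" "(\<Sum>u\<in>V. a u *\<^sub>R u) = x"
        using hullE by blast
      show ?thesis
      proof
        assume "F \<notin> B"
        then have pos: "0 < a u" if "u \<in> V - {v}" for u
          using in_B[OF F a] a(1) that by (metis DiffD1 less_eq_real_def)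
        \<comment> \<open>For steps up to \<open>e\<close> each coordinate keeps half of its value, and loses at most the other half.\<close>
        define e where "e = min (1/2) (Min (a ` (V - {v})) / 2)"
        have "0 < Min (a ` (V - {v}))" using pos fV V(3) by simp
        then have e: "0 < e" "e \<le> 1/2" unfolding e_def by auto
        have ea: "e \<le> a u / 2" if "u \<in> V - {v}" for u
        proof -
          have "Min (a ` (V - {v})) \<le> a u" using fV that by (intro Min_le) auto
          then show ?thesis unfolding e_def by linarith
        qed
        have "x + s *\<^sub>R (z - x) \<in> \<Union>C" if s: "0 < s" "s \<le> e" for s
        proof -
          have nonneg: "0 \<le> (1 - s) * a u + s * \<zeta> u" if u: "u \<in> V" for u
          proof (cases "u = v")
            case True
            then show ?thesis using a(1) u s e by (simp add: \<zeta>_def)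
          next
            case False
            have "(1/2) * a u \<le> (1 - s) * a u" using s e a(1) u by (intro mult_right_mono) auto
            moreover have "s * (1 / n) \<le> s * 1" using n s by (intro mult_left_mono) auto
            moreover have "s * \<zeta> u = - (s * (1 / n))" using False by (simp add: \<zeta>_def)
            moreover have "e \<le> a u / 2" using ea[of u] u False by blast
            ultimately show ?thesis using s by linarith
          qed
          have "x + s *\<^sub>R (z - x) = (\<Sum>u\<in>V. ((1 - s) * a u + s * \<zeta> u) *\<^sub>R u)"
          proof -
            have "(\<Sum>u\<in>V. ((1 - s) * a u + s * \<zeta> u) *\<^sub>R u) = (1 - s) *\<^sub>R x + s *\<^sub>R z"
              unfolding a(3)[symmetric] z_def by (simp add: scaleR_add_left sum.distrib scaleR_sum_right)
            then show ?thesis by (simp add: algebra_simps)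
          qed
          moreover have "(\<Sum>u\<in>V. (1 - s) * a u + s * \<zeta> u) = 1"
            using a(2) \<zeta>1 by (simp add: sum.distrib flip: sum_distrib_left)
          ultimately show ?thesis
            unfolding U convex_hull_finite[OF fV] using nonneg
            by (intro CollectI exI[of _ "\<lambda>u. (1 - s) * a u + s * \<zeta> u"]) auto
        qed
        from initial_segment_in_face[OF F e(1) this]
        show "\<exists>G\<in>C. F \<subseteq> G \<and> (\<exists>s>0. x + s *\<^sub>R (z - x) \<in> G)" .
      next
        assume "\<exists>G\<in>C. F \<subseteq> G \<and> (\<exists>s>0. x + s *\<^sub>R (z - x) \<in> G)"
        then obtain G s where "G \<in> C" "0 < s" "x + s *\<^sub>R (z - x) \<in> G" by blast
        then have s: "0 < s" "x + s *\<^sub>R (z - x) \<in> convex hull V" using U by blast+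
        have "a u \<noteq> 0" if u: "u \<in> V - {v}" for u
        proof
          assume "a u = 0"
          then have "0 \<le> s * \<zeta> u" using moved_coord[OF s(2) a(2,3), of u] u by simp
          then have "0 \<le> \<zeta> u" using s(1) by (simp add: zero_le_mult_iff)
          then show False using u n by (auto simp: \<zeta>_def)
        qed
        then show "F \<notin> B" using in_B[OF F a] by blast
      qed
    qed
    show "F \<in> B" if "F \<in> C" "G \<in> B" "F \<subseteq> G" for F G
      using that unfolding B_def by blast
    show "B \<subseteq> C" unfolding B_def by blast
  qed (use Cne in auto)
  then show ?thesis using B0 unfolding B_def by simp
qed

end

locale subdivided_complex = geometric_complex C + D: derived_complex D p
  for C D :: "'a::euclidean_space set set" and p +
  assumes same_space: "\<Union>D = \<Union>C"
    and refines: "F \<in> D \<Longrightarrow> \<exists>G\<in>C. F \<subseteq> G"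
begin

text \<open>\<open>F\<close> lies in some face of \<open>C\<close>, whose intersection with \<open>G\<close> is a face of it; a face that meets the relative
interior of \<open>F\<close> contains \<open>F\<close>.\<close>

lemma cell_subset:
  assumes "F \<in> D" "G \<in> C" "x \<in> rel_interior F" "x \<in> G"
  shows "F \<subseteq> G"
proof -
  obtain G' where G': "G' \<in> C" "F \<subseteq> G'" using refines assms(1) by blast
  have "x \<in> G'" using G'(2) assms(3) rel_interior_subset by blast
  then show ?thesis
    using subset_of_face_of[OF Int_face[OF G'(1) assms(2)] G'(2)] assms(3,4) by blast
qed

definition cells_in :: "'a set \<Rightarrow> 'a set set"
  where "cells_in A = {F \<in> D. F \<subseteq> A}"

definition chains_in :: "'a set \<Rightarrow> 'a set set set"
  where "chains_in A = {K. subset.chain (cells_in A - {{}}) K}"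

lemma cells_in_Union:
  assumes "F \<in> D" "F \<noteq> {}" "E \<subseteq> C" "F \<subseteq> \<Union>E"
  obtains G where "G \<in> E" "F \<subseteq> G"
proof -
  obtain x where x: "x \<in> rel_interior F" using D.rel_interior_nonempty assms(1,2) by blast
  then obtain G where "G \<in> E" "x \<in> G" using assms(4) rel_interior_subset by blast
  then show ?thesis using that cell_subset[OF assms(1) _ x] assms(3) by blast
qed

text \<open>The subdividing point of \<open>F\<close> lies in the underlying space of \<open>E\<close> only if all of \<open>F\<close> does.\<close>

lemma restriction_sd:
  assumes "E \<subseteq> C"
  shows "restriction D.sd (\<Union>E) = D.simplex_of ` chains_in (\<Union>E)"
proof -
  have iff: "D.simplex_of K \<subseteq> \<Union>E \<longleftrightarrow> K \<subseteq> cells_in (\<Union>E)" if K: "D.flag K" for K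
  proof
    assume sub: "D.simplex_of K \<subseteq> \<Union>E"
    show "K \<subseteq> cells_in (\<Union>E)"
    proof
      fix F assume F: "F \<in> K"
      then have FD: "F \<in> D" "F \<noteq> {}" using D.chainD(2,3)[OF K] by auto
      have "p F \<in> \<Union>E" using sub F unfolding D.simplex_of_def by (auto intro: hull_inc)
      then obtain G where "G \<in> E" "p F \<in> G" by blast
      then have "F \<subseteq> G" using cell_subset[OF FD(1) _ D.p[OF FD]] assms by blast
      then show "F \<in> cells_in (\<Union>E)" unfolding cells_in_def using \<open>G \<in> E\<close> FD by blast
    qed
  next
    assume "K \<subseteq> cells_in (\<Union>E)"
    then show "D.simplex_of K \<subseteq> \<Union>E" using D.simplex_of_subset_Union[OF K] unfolding cells_in_def by blast
  qed
  have "{F \<in> D.sd. F \<subseteq> \<Union>E} = D.simplex_of ` {K. D.flag K \<and> D.simplex_of K \<subseteq> \<Union>E}"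
    unfolding D.sd_def by blast
  also have "{K. D.flag K \<and> D.simplex_of K \<subseteq> \<Union>E} = chains_in (\<Union>E)"
    unfolding chains_in_def
  proof (rule Collect_cong)
    fix K
    have "subset.chain (cells_in (\<Union>E) - {{}}) K \<longleftrightarrow> D.flag K \<and> K \<subseteq> cells_in (\<Union>E)"
      unfolding subset_chain_def cells_in_def by auto
    then show "(D.flag K \<and> D.simplex_of K \<subseteq> \<Union>E) = subset.chain (cells_in (\<Union>E) - {{}}) K"
      using iff by metis
  qed
  finally show ?thesis unfolding restriction_eq[OF D.sd_simplicial_complex] .
qed

text \<open>The chains to be removed are those with a member in the relative interior of \<open>\<tau>\<close> or \<open>\<sigma>\<close>. Since \<open>\<sigma>\<close> is free, such chains
lie in \<open>\<tau>\<close> altogether, and what is to remain of \<open>\<tau>\<close> is the union of its facets through the vertex opposite to \<open>\<sigma>\<close>.\<close>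

lemma chains_in_deletion:
  assumes E: "simplicial_complex E" "E \<subseteq> C" and free: "free_face E \<sigma>"
  shows "pair_removal^** (chains_in (\<Union>E)) (chains_in (\<Union>(deletion E \<sigma>)))"
proof -
  interpret E: geometric_complex E by unfold_locales (rule E(1))
  define E' where "E' = deletion E \<sigma>"
  have E'C: "E' \<subseteq> E" "E' \<subseteq> C" unfolding E'_def deletion_def using E(2) by auto
  have \<sigma>: "\<sigma> \<in> E" "\<sigma> \<noteq> {}" using free unfolding free_face_def by auto
  obtain \<tau> where \<tau>: "\<tau> \<in> E" "\<sigma> \<subset> \<tau>" "\<And>\<tau>'. \<tau>' \<in> E \<Longrightarrow> \<sigma> \<subset> \<tau>' \<Longrightarrow> \<tau>' = \<tau>"
    using free unfolding free_face_def by (elim conjE ex1E) blast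
  obtain v where v: "v \<in> verts \<tau>" "verts \<sigma> = verts \<tau> - {v}"
    by (rule E.free_face_verts[OF free \<tau>(1,2)])
  define V where "V = verts \<tau>"
  have V: "\<not> affine_dependent V" "v \<in> V" "V - {v} \<noteq> {}" "convex hull V = \<tau>"
    using E.verts[OF \<tau>(1)] v E.verts_empty_iff[OF \<sigma>(1)] \<sigma>(2) unfolding V_def by auto
  define DT where "DT = cells_in \<tau>"
  have "subcomplex DT D" unfolding DT_def cells_in_def
    using face_of_imp_subset by (intro subcomplex_filter[OF D.complex]) blast
  then interpret DT: geometric_complex DT by unfold_locales (simp add: subcomplex_def)
  have \<tau>C: "\<tau> \<in> C" using \<tau>(1) E(2) by blast
  have "\<Union>DT = \<tau>"
  proof
    show "\<Union>DT \<subseteq> \<tau>" unfolding DT_def cells_in_def by blast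
    show "\<tau> \<subseteq> \<Union>DT"
    proof
      fix x assume x: "x \<in> \<tau>"
      then obtain F where "F \<in> D" "x \<in> F" using same_space \<tau>C by blast
      then obtain G where G: "G \<in> D" "x \<in> rel_interior G" by (rule D.carrier) blast
      then have "G \<subseteq> \<tau>" using cell_subset[OF G(1) \<tau>C G(2) x] by blast
      then show "x \<in> \<Union>DT" unfolding DT_def cells_in_def using G rel_interior_subset by blast
    qed
  qed
  then have U: "\<Union>DT = convex hull V" using V(4) by simp
  define B where "B = {F \<in> DT. \<exists>u\<in>V - {v}. F \<subseteq> convex hull (V - {u})}"
  have in_B: "F \<in> cells_in (\<Union>E') \<longleftrightarrow> F \<in> B" if F: "F \<in> DT" for F
  proof
    assume FE': "F \<in> cells_in (\<Union>E')"
    show "F \<in> B"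
    proof (cases "F = {}")
      case True
      then show ?thesis using F V(3) unfolding B_def by blast
    next
      case False
      have FD: "F \<in> D" "F \<subseteq> \<tau>" "F \<subseteq> \<Union>E'" using F FE' unfolding DT_def cells_in_def by auto
      obtain G where G: "G \<in> E'" "F \<subseteq> G" by (rule cells_in_Union[OF FD(1) False E'C(2) FD(3)])
      have GE: "G \<in> E" "\<not> \<sigma> \<subseteq> G" using G(1) unfolding E'_def deletion_def by auto
      have "\<tau> \<inter> G face_of convex hull V" using E.Int_face[OF \<tau>(1) GE(1)] V(4) by simp
      then obtain c where c: "c \<subseteq> V" "\<tau> \<inter> G = convex hull c"
        unfolding face_of_convex_hull_affine_independent[OF V(1)] by blast
      have "\<not> V - {v} \<subseteq> c"
      proof
        assume "V - {v} \<subseteq> c"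
        then have "convex hull (verts \<sigma>) \<subseteq> convex hull c" unfolding v(2) V_def by (rule hull_mono)
        then show False using E.verts(3)[OF \<sigma>(1)] c(2) GE(2) by auto
      qed
      then obtain u where u: "u \<in> V - {v}" "u \<notin> c" by blast
      then have "convex hull c \<subseteq> convex hull (V - {u})" using c(1) by (intro hull_mono) blast
      then have "F \<subseteq> convex hull (V - {u})" using G(2) FD(2) c(2) by blast
      then show ?thesis unfolding B_def using F u(1) by blast
    qed
  next
    assume "F \<in> B"
    then obtain u where u: "u \<in> V - {v}" "F \<subseteq> convex hull (V - {u})" unfolding B_def by blast
    let ?\<rho> = "convex hull (V - {u})"
    have \<rho>: "?\<rho> \<in> E" "verts ?\<rho> = V - {u}"
      using E.verts_subset_face[OF \<tau>(1), of "V - {u}"] unfolding V_def by auto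
    have "\<not> \<sigma> \<subseteq> ?\<rho>" using E.verts_subset_iff[OF \<sigma>(1) \<rho>(1)] \<rho>(2) v(2) u(1) unfolding V_def by auto
    then have "?\<rho> \<in> E'" unfolding E'_def deletion_def using \<rho>(1) by blast
    then show "F \<in> cells_in (\<Union>E')" unfolding cells_in_def using F u(2) unfolding DT_def cells_in_def by blast
  qed
  have in_\<tau>: "F \<in> DT" if F: "F \<in> cells_in (\<Union>E)" "F \<notin> cells_in (\<Union>E')" for F
  proof (cases "F = {}")
    case True
    then show ?thesis using F unfolding cells_in_def by auto
  next
    case False
    have FD: "F \<in> D" "F \<subseteq> \<Union>E" using F unfolding cells_in_def by auto
    obtain G where G: "G \<in> E" "F \<subseteq> G" by (rule cells_in_Union[OF FD(1) False E(2) FD(2)])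
    have "G \<notin> E'" using F(2) G(2) FD(1) unfolding cells_in_def by blast
    then have "\<sigma> \<subseteq> G" using G(1) unfolding E'_def deletion_def by blast
    then have "G \<subseteq> \<tau>" using \<tau>(2,3) G(1) by blast
    then show ?thesis using FD(1) G(2) unfolding DT_def cells_in_def by blast
  qed
  have sub: "DT \<subseteq> cells_in (\<Union>E)" "cells_in (\<Union>E') \<subseteq> cells_in (\<Union>E)"
    unfolding DT_def cells_in_def using Union_upper[OF \<tau>(1)] Union_mono[OF E'C(1)] by blast+
  have down: "F \<in> cells_in A" if "F \<in> D" "F \<subseteq> G" "G \<in> cells_in A" for F G A
    using that unfolding cells_in_def by blast
  have diff: "chains_in (\<Union>E) - chains_in (\<Union>E') = chains_off True (DT - {{}}) B"
  proof (intro subset_antisym subsetI)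
    fix K assume "K \<in> chains_in (\<Union>E) - chains_in (\<Union>E')"
    then have K: "K \<subseteq> cells_in (\<Union>E) - {{}}" "\<And>X Y. X \<in> K \<Longrightarrow> Y \<in> K \<Longrightarrow> X \<subseteq> Y \<or> Y \<subseteq> X"
        "\<not> K \<subseteq> cells_in (\<Union>E')"
      unfolding chains_in_def subset_chain_def by auto
    obtain F where F: "F \<in> K" "F \<notin> cells_in (\<Union>E')" using K(3) by blast
    have F\<tau>: "F \<in> DT" using in_\<tau> F K(1) by blast
    have "G \<in> DT" if G: "G \<in> K" for G
    proof -
      have GD: "G \<in> D" "G \<in> cells_in (\<Union>E)" using G K(1) unfolding cells_in_def by auto
      have FD: "F \<in> D" using F\<tau> unfolding DT_def cells_in_def by simp
      show ?thesis
        using K(2)[OF F(1) G]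
      proof
        assume "F \<subseteq> G"
        then have "G \<notin> cells_in (\<Union>E')" using down[OF FD] F(2) by blast
        then show ?thesis using in_\<tau> GD(2) by blast
      next
        assume "G \<subseteq> F"
        then show ?thesis using down[OF GD(1)] F\<tau> unfolding DT_def by blast
      qed
    qed
    then have "K \<subseteq> DT - {{}}" using K(1) by blast
    moreover have "\<not> K \<subseteq> B" using F in_B[OF F\<tau>] by blast
    ultimately show "K \<in> chains_off True (DT - {{}}) B"
      unfolding chains_off_def subset_chain_def using K(2) by blast
  next
    fix K assume "K \<in> chains_off True (DT - {{}}) B"
    then have K: "K \<subseteq> DT - {{}}" "\<And>X Y. X \<in> K \<Longrightarrow> Y \<in> K \<Longrightarrow> X \<subseteq> Y \<or> Y \<subseteq> X" "\<not> K \<subseteq> B"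
      unfolding chains_off_def subset_chain_def by auto
    obtain F where "F \<in> K" "F \<notin> B" using K(3) by blast
    then have "\<not> K \<subseteq> cells_in (\<Union>E')" using in_B[of F] K(1) by blast
    moreover have "K \<subseteq> cells_in (\<Union>E) - {{}}" using K(1) sub(1) by blast
    ultimately show "K \<in> chains_in (\<Union>E) - chains_in (\<Union>E')"
      unfolding chains_in_def subset_chain_def using K(2) by blast
  qed
  have sub': "chains_in (\<Union>E') \<subseteq> chains_in (\<Union>E)"
    unfolding chains_in_def subset_chain_def using sub(2) by blast
  have "vanishes (chains_in (\<Union>E) - chains_in (\<Union>E'))"
    unfolding diff B_def by (rule DT.chains_vanish_off_faces_at_vertex[OF V(1-3) U])
  then have "pair_removal^** ((chains_in (\<Union>E) - chains_in (\<Union>E')) \<union> chains_in (\<Union>E')) ({} \<union> chains_in (\<Union>E'))"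
    unfolding vanishes_def
  proof (rule pair_removals_frame)
    fix K L assume K: "K \<in> chains_in (\<Union>E')" and L: "L \<in> chains_in (\<Union>E) - chains_in (\<Union>E') - {}"
    show "\<not> L \<subseteq> K"
    proof
      assume "L \<subseteq> K"
      then have "L \<in> chains_in (\<Union>E')" using K chain_subsetI unfolding chains_in_def by blast
      then show False using L by blast
    qed
  qed
  moreover have "(chains_in (\<Union>E) - chains_in (\<Union>E')) \<union> chains_in (\<Union>E') = chains_in (\<Union>E)"
    using sub' by blast
  ultimately show ?thesis unfolding E'_def by simp
qed

theorem sd_collapses_to_restriction:
  assumes "collapses_to C C'"
  shows "collapses_to D.sd (restriction D.sd (\<Union>C'))"
  using assms unfolding collapses_to_def
proof (induction rule: rtranclp_induct)
  case base
  have "restriction D.sd (\<Union>C) = D.sd"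
    unfolding restriction_eq[OF D.sd_simplicial_complex] using D.Union_sd same_space by auto
  then show ?case by simp
next
  case (step E E')
  obtain \<sigma> where \<sigma>: "free_face E \<sigma>" "E' = deletion E \<sigma>"
    using step.hyps(2) unfolding elementary_collapse_def by blast
  have "subcomplex E C"
    using collapses_to_subcomplex[OF complex] step.hyps(1) unfolding collapses_to_def by blast
  then have E: "simplicial_complex E" "E \<subseteq> C" unfolding subcomplex_def by auto
  have E'C: "E' \<subseteq> C" using \<sigma>(2) E(2) unfolding deletion_def by blast
  have "collapses_to (D.simplex_of ` chains_in (\<Union>E)) (D.simplex_of ` chains_in (\<Union>E'))"
    unfolding \<sigma>(2)
  proof (rule D.pair_removals_imp_collapses[OF chains_in_deletion[OF E \<sigma>(1)]])
    show "{} \<in> chains_in (\<Union>(deletion E \<sigma>))" unfolding chains_in_def subset_chain_def by simp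
    show "D.flag K" if "K \<in> chains_in (\<Union>E)" for K
      using that unfolding chains_in_def cells_in_def subset_chain_def by auto
  qed
  then show ?case
    using step.IH unfolding restriction_sd[OF E(2)] restriction_sd[OF E'C] collapses_to_def by simp
qed

end

section \<open>Star-shaped complexes in the plane\<close>

lemma vanishes_alternating_sum:
  assumes "vanishes X" "finite X" "\<And>k. k \<in> X \<Longrightarrow> finite k"
  shows "(\<Sum>k\<in>X. (-1::int) ^ card k) = 0"
  using assms unfolding vanishes_def
proof (induction rule: converse_rtranclp_induct)
  case (step X X1)
  obtain s x where sx: "x \<notin> s" "s \<in> X" "insert x s \<in> X" "X1 = X - {s, insert x s}"
    using step.hyps(1) unfolding pair_removal_def by blast
  have "s \<noteq> insert x s" using sx(1) by blast
  then have "(\<Sum>k\<in>X. (-1::int) ^ card k) = (\<Sum>k\<in>X1. (-1) ^ card k) + (\<Sum>k\<in>{s, insert x s}. (-1) ^ card k)"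
    using sum.subset_diff[of "{s, insert x s}" X "\<lambda>k. (-1::int) ^ card k"] sx step.prems(1) by simp
  also have "(\<Sum>k\<in>{s, insert x s}. (-1::int) ^ card k) = 0"
    using \<open>s \<noteq> insert x s\<close> sx(1) step.prems(2)[OF sx(2)] by simp
  also have "(\<Sum>k\<in>X1. (-1::int) ^ card k) = 0"
    using step.IH step.prems sx(4) by simp
  finally show ?case by simp
qed simp

lemma alternating_sum_Pow:
  assumes "finite V" "V \<noteq> {}"
  shows "(\<Sum>S\<in>Pow V. (-1::int) ^ card S) = 0"
proof -
  obtain a where "a \<in> V" using assms(2) by blast
  have "vanishes (Pow V)"
    by (rule vanishes_cone[where a = a]) (use assms(1) \<open>a \<in> V\<close> finite_subset in auto)
  then show ?thesis by (rule vanishes_alternating_sum) (use assms(1) finite_subset in auto)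
qed

text \<open>The first removal that affected \<open>Z\<close> would have to remove a member of \<open>Z\<close> together with one of its facets, but that facet
lies in another member of \<open>Z\<close>.\<close>

lemma vanishes_no_closed_part:
  assumes "vanishes X" "Z \<subseteq> X"
    and maximal: "\<And>z u. z \<in> Z \<Longrightarrow> u \<in> X \<Longrightarrow> z \<subseteq> u \<Longrightarrow> u = z"
    and shared: "\<And>z x. z \<in> Z \<Longrightarrow> x \<in> z \<Longrightarrow> \<exists>z'\<in>Z. z' \<noteq> z \<and> z - {x} \<subseteq> z'"
  shows "Z = {}"
proof -
  have "Z \<subseteq> Y" if "pair_removal^** X Y" for Y
    using that
  proof (induction rule: rtranclp_induct)
    case (step Y Y1)
    obtain s x where sx: "x \<notin> s" "s \<in> Y" "insert x s \<in> Y"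
      "\<forall>u\<in>Y. s \<subseteq> u \<longrightarrow> u = s \<or> u = insert x s" "Y1 = Y - {s, insert x s}"
      using step.hyps(2) unfolding pair_removal_def by blast
    have YX: "Y \<subseteq> X" by (rule pair_removals_subset[OF step.hyps(1)])
    have "s \<notin> Z"
    proof
      assume "s \<in> Z"
      then have "insert x s = s" using maximal[of s "insert x s"] sx(3) YX by blast
      then show False using sx(1) by blast
    qed
    moreover have "insert x s \<notin> Z"
    proof
      assume "insert x s \<in> Z"
      then obtain z' where z': "z' \<in> Z" "z' \<noteq> insert x s" "insert x s - {x} \<subseteq> z'"
        using shared[of "insert x s" x] by blast
      then have "z' = s" using sx(1,4) step.IH by blast
      then show False using \<open>s \<notin> Z\<close> z'(1) by blast
    qed
    ultimately show ?case using step.IH sx(5) by blast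
  qed (rule assms(2))
  from this[of "{}"] assms(1) show ?thesis unfolding vanishes_def by blast
qed

abbreviation face_sum :: "'a::real_vector set set \<Rightarrow> int"
  where "face_sum C \<equiv> \<Sum>F\<in>C. (-1) ^ card (verts F)"

context geometric_complex
begin

lemma verts_image: "F \<in> C \<Longrightarrow> verts ` {G \<in> C. G \<subseteq> F} = Pow (verts F)"
proof (intro subset_antisym subsetI)
  fix S assume F: "F \<in> C" and "S \<in> verts ` {G \<in> C. G \<subseteq> F}"
  then show "S \<in> Pow (verts F)" using verts_subset_iff by auto
next
  fix S assume F: "F \<in> C" and "S \<in> Pow (verts F)"
  then have S: "convex hull S \<in> C" "verts (convex hull S) = S" using verts_subset_face[OF F] by auto
  then have "convex hull S \<subseteq> F" using verts_subset_iff[OF S(1) F] \<open>S \<in> Pow (verts F)\<close> by simp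
  then show "S \<in> verts ` {G \<in> C. G \<subseteq> F}" using S by (intro image_eqI[of _ _ "convex hull S"]) auto
qed

lemma inj_on_verts: "inj_on verts C"
  using verts_eq_iff by (intro inj_onI) blast

text \<open>Chains with largest face \<open>F\<close> arise by adding \<open>F\<close> to a chain with a smaller largest face, so the sum for \<open>F\<close> is minus
the total over the proper faces. The numbers \<open>(-1) ^ card (verts F)\<close> satisfy the same recursion.\<close>

lemma alternating_sum_chains:
  assumes "F \<in> C"
  shows "(\<Sum>K | flag K \<and> \<Union>K = F. (-1::int) ^ card K) = (-1) ^ card (verts F)"
  using assms
proof (induction "card (verts F)" arbitrary: F rule: less_induct)
  case less
  note F = less.prems
  have finch: "finite {K. flag K}"
    by (rule finite_subset[of _ "Pow C"]) (use finite_C in \<open>auto simp: subset_chain_def\<close>)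
  have fin: "finite K" if "flag K" for K using that finite_C finite_subset by (auto simp: subset_chain_def)
  show ?case
  proof (cases "F = {}")
    case True
    have "{K. flag K \<and> \<Union>K = F} = {{}}" unfolding True subset_chain_def by auto
    then show ?thesis using True verts_empty_iff[OF F] by simp
  next
    case False
    define L where "L = {G \<in> C. G \<subset> F}"
    define A where "A = {K. flag K \<and> \<Union>K \<in> L}"
    have "{K. flag K \<and> \<Union>K = F} = insert F ` A"
    proof (intro subset_antisym subsetI)
      fix K assume "K \<in> {K. flag K \<and> \<Union>K = F}"
      then have K: "flag K" "\<Union>K = F" by auto
      have FK: "F \<in> K" using Union_in_chain[OF fin[OF K(1)] _ K(1)] K(2) False by auto
      have K': "flag (K - {F})" by (rule chain_subsetI[OF K(1)]) blast
      have "\<Union>(K - {F}) \<in> L"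
      proof (cases "K - {F} = {}")
        case True
        then have "\<Union>(K - {F}) = {}" by (simp only: Union_empty)
        moreover have "{} \<in> L" unfolding L_def using empty_mem F False by blast
        ultimately show ?thesis by (simp only:)
      next
        case False
        then have "\<Union>(K - {F}) \<in> K - {F}" using Union_in_chain[OF fin[OF K'] _ K'] by blast
        then have "\<Union>(K - {F}) \<in> C" "\<Union>(K - {F}) \<noteq> F" using K(1) unfolding subset_chain_def by blast+
        moreover have "\<Union>(K - {F}) \<subseteq> F" using K(2) by blast
        ultimately show ?thesis unfolding L_def by blast
      qed
      then have "K - {F} \<in> A" unfolding A_def using K' by simp
      moreover have "K = insert F (K - {F})" using FK by blast
      ultimately show "K \<in> insert F ` A" by (rule rev_image_eqI)
    next
      fix K assume "K \<in> insert F ` A"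
      then obtain M where M: "flag M" "\<Union>M \<in> L" "K = insert F M" unfolding A_def by blast
      have MF: "\<Union>M \<subset> F" using M(2) unfolding L_def by simp
      then have "\<forall>X\<in>M. X \<subseteq> F" by blast
      then have "flag K" unfolding M(3) subset_chain_insert using M(1) F False by simp
      moreover have "\<Union>K = F" unfolding M(3) using MF by auto
      ultimately show "K \<in> {K. flag K \<and> \<Union>K = F}" by simp
    qed
    moreover have AF: "F \<notin> K \<and> finite K" if "K \<in> A" for K
      using that fin unfolding A_def L_def by auto
    moreover have "inj_on (insert F) A" using AF by (intro inj_onI) (metis insert_ident)
    ultimately have "(\<Sum>K | flag K \<and> \<Union>K = F. (-1::int) ^ card K) = (\<Sum>K\<in>A. (-1) ^ card (insert F K))"
      by (simp add: sum.reindex)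
    also have "\<dots> = - (\<Sum>K\<in>A. (-1) ^ card K)"
      unfolding sum_negf[symmetric] by (rule sum.cong) (use AF in auto)
    also have "(\<Sum>K\<in>A. (-1::int) ^ card K) = (\<Sum>G\<in>L. \<Sum>K | flag K \<and> \<Union>K = G. (-1) ^ card K)"
    proof -
      have "(\<Sum>K\<in>A. (-1::int) ^ card K) = (\<Sum>G\<in>L. \<Sum>K | K \<in> A \<and> \<Union>K = G. (-1) ^ card K)"
        by (rule sum.group[symmetric]) (use finch finite_C in \<open>auto simp: A_def L_def\<close>)
      also have "\<dots> = (\<Sum>G\<in>L. \<Sum>K | flag K \<and> \<Union>K = G. (-1) ^ card K)"
        by (rule sum.cong[OF refl], rule sum.cong) (auto simp: A_def)
      finally show ?thesis .
    qed
    also have "\<dots> = (\<Sum>G\<in>L. (-1) ^ card (verts G))"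
    proof (rule sum.cong[OF refl])
      fix G assume "G \<in> L"
      then have G: "G \<in> C" "G \<subset> F" unfolding L_def by auto
      then have "verts G \<subset> verts F" using verts_subset_iff[OF G(1) F] verts_eq_iff[OF G(1) F] by blast
      then have "card (verts G) < card (verts F)" using verts(2)[OF F] by (rule psubset_card_mono[rotated])
      then show "(\<Sum>K | flag K \<and> \<Union>K = G. (-1::int) ^ card K) = (-1) ^ card (verts G)"
        by (rule less.hyps[OF _ G(1)])
    qed
    also have "(\<Sum>G\<in>L. (-1::int) ^ card (verts G)) = - ((-1) ^ card (verts F))"
    proof -
      have "(\<Sum>G | G \<in> C \<and> G \<subseteq> F. (-1::int) ^ card (verts G)) = (\<Sum>S\<in>Pow (verts F). (-1) ^ card S)"
        unfolding verts_image[OF F, symmetric]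
        by (subst sum.reindex) (auto intro: inj_on_subset[OF inj_on_verts])
      also have "\<dots> = 0" using alternating_sum_Pow verts(2)[OF F] verts_empty_iff[OF F] False by blast
      also have "{G. G \<in> C \<and> G \<subseteq> F} = insert F L" unfolding L_def using F by auto
      finally show ?thesis using finite_C unfolding L_def by (simp add: eq_neg_iff_add_eq_0 add.commute)
    qed
    finally show ?thesis by simp
  qed
qed

text \<open>A complex and its derived subdivision have the same Euler characteristic. Both sums include the empty set, so they are the
reduced ones up to sign.\<close>

lemma alternating_sum_faces:
  assumes "vanishes {K. flag K}" "C \<noteq> {}"
  shows "face_sum C = 0"
proof -
  let ?X = "{K. flag K}"
  have finX: "finite ?X"
    by (rule finite_subset[of _ "Pow C"]) (use finite_C in \<open>auto simp: subset_chain_def\<close>)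
  have fin: "finite K" if "K \<in> ?X" for K
    using that finite_C finite_subset by (auto simp: subset_chain_def)
  have top: "\<Union>K \<in> C" if "K \<in> ?X" for K
  proof (cases "K = {}")
    case True
    then show ?thesis using empty_mem[OF assms(2)] by simp
  next
    case False
    then have "\<Union>K \<in> K" using Union_in_chain[OF fin[OF that]] that by blast
    then show ?thesis using that by (auto simp: subset_chain_def)
  qed
  have "face_sum C = (\<Sum>F\<in>C. \<Sum>K | K \<in> ?X \<and> \<Union>K = F. (-1) ^ card K)"
    by (rule sum.cong) (simp_all add: alternating_sum_chains)
  also have "\<dots> = (\<Sum>K\<in>?X. (-1) ^ card K)"
    by (rule sum.group[OF finX finite_C]) (use top in auto)
  also have "\<dots> = 0" by (rule vanishes_alternating_sum[OF assms(1) finX fin])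
  finally show ?thesis .
qed

text \<open>Connectedness expressed by unions of components instead of paths, which makes it easy to follow through a collapse.\<close>

definition vertex_connected :: bool
  where "vertex_connected \<longleftrightarrow> (\<forall>A. (\<forall>F\<in>C. verts F \<subseteq> A \<or> verts F \<inter> A = {}) \<longrightarrow>
    \<Union>(verts ` C) \<subseteq> A \<or> \<Union>(verts ` C) \<inter> A = {})"

text \<open>Otherwise the faces inside \<open>A\<close> and the faces disjoint from \<open>A\<close> would cover the space by two disjoint closed sets.\<close>

lemma connected_imp_vertex_connected:
  assumes "connected (\<Union>C)"
  shows vertex_connected
  unfolding vertex_connected_def
proof (intro allI impI)
  fix A assume A: "\<forall>F\<in>C. verts F \<subseteq> A \<or> verts F \<inter> A = {}"
  define P where "P = \<Union>{F \<in> C. verts F \<subseteq> A}"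
  define N where "N = \<Union>{F \<in> C. verts F \<inter> A = {}}"
  have closed: "closed P" "closed N"
    unfolding P_def N_def using finite_C closed_mem by (auto intro!: closed_Union)
  have "P \<inter> N = {}"
  proof (rule ccontr)
    assume "P \<inter> N \<noteq> {}"
    then obtain x F G where FG: "F \<in> C" "G \<in> C" "x \<in> F" "x \<in> G" "verts F \<subseteq> A" "verts G \<inter> A = {}"
      unfolding P_def N_def by blast
    obtain H where H: "H \<in> C" "H \<subseteq> F" "x \<in> rel_interior H" by (rule carrier[OF FG(1,3)])
    have "H \<subseteq> G" by (rule rel_interior_subset_mem[OF H(1) FG(2) H(3) FG(4)])
    then have "verts H \<subseteq> verts F" "verts H \<subseteq> verts G"
      using verts_subset_iff H(1,2) FG(1,2) by auto
    then have "verts H = {}" using FG(5,6) by blast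
    then have "H = {}" using verts_empty_iff[OF H(1)] by blast
    then show False using H(3) by simp
  qed
  moreover have U: "\<Union>C \<subseteq> P \<union> N" unfolding P_def N_def using A by blast
  ultimately have "P \<inter> \<Union>C = {} \<or> N \<inter> \<Union>C = {}"
    using connected_closedD[OF assms _ U closed] by blast
  moreover have "P \<subseteq> \<Union>C" "N \<subseteq> \<Union>C" unfolding P_def N_def by blast+
  ultimately have PN: "P = {} \<or> N = {}" by blast
  show "\<Union>(verts ` C) \<subseteq> A \<or> \<Union>(verts ` C) \<inter> A = {}"
  proof (rule ccontr)
    assume "\<not> ?thesis"
    then obtain F G where FG: "F \<in> C" "G \<in> C" "\<not> verts F \<subseteq> A" "verts G \<inter> A \<noteq> {}" by blast
    then have "F \<subseteq> N" "G \<subseteq> P" unfolding P_def N_def using A by blast+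
    moreover have "F \<noteq> {}" "G \<noteq> {}" using verts_empty_iff FG by blast+
    ultimately show False using PN by blast
  qed
qed

lemma free_face_deletion:
  assumes "free_face C \<sigma>"
  obtains \<tau> v where "\<tau> \<in> C" "\<sigma> \<in> C" "v \<in> verts \<tau>" "verts \<sigma> = verts \<tau> - {v}" "verts \<sigma> \<noteq> {}"
    "deletion C \<sigma> = C - {\<sigma>, \<tau>}" "\<forall>\<rho>\<in>C. verts \<sigma> \<subseteq> verts \<rho> \<longrightarrow> \<rho> = \<sigma> \<or> \<rho> = \<tau>"
proof -
  have \<sigma>: "\<sigma> \<in> C" "\<sigma> \<noteq> {}" using assms unfolding free_face_def by auto
  obtain \<tau> where \<tau>: "\<tau> \<in> C" "\<sigma> \<subset> \<tau>" "\<And>\<rho>. \<rho> \<in> C \<Longrightarrow> \<sigma> \<subset> \<rho> \<Longrightarrow> \<rho> = \<tau>"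
    using assms unfolding free_face_def by (elim conjE ex1E) blast
  obtain v where v: "v \<in> verts \<tau>" "verts \<sigma> = verts \<tau> - {v}" by (rule free_face_verts[OF assms \<tau>(1,2)])
  have up: "\<rho> = \<sigma> \<or> \<rho> = \<tau>" if "\<rho> \<in> C" "\<sigma> \<subseteq> \<rho>" for \<rho> using \<tau>(3) that by blast
  have "deletion C \<sigma> = C - {\<sigma>, \<tau>}"
    unfolding deletion_def using up \<tau>(2) by blast
  moreover have "\<rho> = \<sigma> \<or> \<rho> = \<tau>" if "\<rho> \<in> C" "verts \<sigma> \<subseteq> verts \<rho>" for \<rho>
    using up[OF that(1)] verts_subset_iff[OF \<sigma>(1) that(1)] that(2) by blast
  moreover have "verts \<sigma> \<noteq> {}" using verts_empty_iff \<sigma> by blast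
  ultimately show ?thesis using that[OF \<tau>(1) \<sigma>(1) v] by blast
qed

text \<open>If \<open>\<sigma>\<close> is a vertex \<open>w\<close>, then \<open>\<tau>\<close> is its only edge and \<open>w\<close> belongs to the component of the other end. If \<open>\<sigma>\<close> is an edge, then
the other two edges of the triangle \<open>\<tau>\<close> still connect its ends.\<close>

lemma collapse_preserves:
  assumes free: "free_face C \<sigma>" and small: "\<And>F. F \<in> C \<Longrightarrow> card (verts F) \<le> 3"
    and conn: vertex_connected and sum: "face_sum C = 0"
  shows "geometric_complex.vertex_connected (deletion C \<sigma>)"
    and "face_sum (deletion C \<sigma>) = 0"
proof -
  have "elementary_collapse C (deletion C \<sigma>)" unfolding elementary_collapse_def using free by blast
  then have "simplicial_complex (deletion C \<sigma>)"
    using elementary_collapse_subcomplex[OF complex] unfolding subcomplex_def by blast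
  then interpret E: geometric_complex "deletion C \<sigma>" by unfold_locales
  obtain \<tau> v where \<tau>: "\<tau> \<in> C" "\<sigma> \<in> C" "v \<in> verts \<tau>" "verts \<sigma> = verts \<tau> - {v}" "verts \<sigma> \<noteq> {}"
    "deletion C \<sigma> = C - {\<sigma>, \<tau>}" "\<forall>\<rho>\<in>C. verts \<sigma> \<subseteq> verts \<rho> \<longrightarrow> \<rho> = \<sigma> \<or> \<rho> = \<tau>"
    by (rule free_face_deletion[OF free])
  have up: "\<rho> = \<sigma> \<or> \<rho> = \<tau>" if "\<rho> \<in> C" "verts \<sigma> \<subseteq> verts \<rho>" for \<rho> using \<tau>(7) that by blast
  have ne: "\<sigma> \<noteq> \<tau>" using \<tau>(3,4) by blast
  have f: "finite (verts \<tau>)" by (rule verts(2)[OF \<tau>(1)])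
  have card: "card (verts \<tau>) = Suc (card (verts \<sigma>))"
    unfolding \<tau>(4) using card.remove[OF f \<tau>(3)] by simp
  have "face_sum C =
      face_sum (C - {\<sigma>, \<tau>}) + face_sum {\<sigma>, \<tau>}"
    using sum.subset_diff[of "{\<sigma>, \<tau>}" C "\<lambda>F. (-1::int) ^ card (verts F)"] \<tau>(1,2) finite_C by simp
  also have "face_sum {\<sigma>, \<tau>} = 0" using ne card by simp
  finally show "face_sum (deletion C \<sigma>) = 0" using sum \<tau>(6) by simp
  show E.vertex_connected
    unfolding E.vertex_connected_def
  proof (intro allI impI)
    fix A assume A: "\<forall>F\<in>deletion C \<sigma>. verts F \<subseteq> A \<or> verts F \<inter> A = {}"
    show "\<Union>(verts ` deletion C \<sigma>) \<subseteq> A \<or> \<Union>(verts ` deletion C \<sigma>) \<inter> A = {}"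
    proof (cases "card (verts \<sigma>) = 1")
      case True
      then obtain w where w: "verts \<sigma> = {w}" by (auto simp: card_1_singleton_iff)
      then have \<tau>w: "verts \<tau> = {v, w}" "v \<noteq> w" using \<tau>(3,4) by auto
      define A' where "A' = (if v \<in> A then insert w A else A - {w})"
      have "verts F \<subseteq> A' \<or> verts F \<inter> A' = {}" if F: "F \<in> C" for F
      proof (cases "F = \<sigma> \<or> F = \<tau>")
        case True
        then show ?thesis using w \<tau>w unfolding A'_def by auto
      next
        case False
        then have "w \<notin> verts F" using up[OF F] w by auto
        moreover have "verts F \<subseteq> A \<or> verts F \<inter> A = {}" using A F False \<tau>(6) by auto
        ultimately show ?thesis unfolding A'_def by auto
      qed
      then have all: "\<Union>(verts ` C) \<subseteq> A' \<or> \<Union>(verts ` C) \<inter> A' = {}" using conn unfolding vertex_connected_def by blast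
      have "w \<notin> verts F" if "F \<in> deletion C \<sigma>" for F using \<tau>(6) up[of F] w that by auto
      then have nw: "w \<notin> \<Union>(verts ` deletion C \<sigma>)" by blast
      have sub: "\<Union>(verts ` deletion C \<sigma>) \<subseteq> \<Union>(verts ` C)" unfolding \<tau>(6) by blast
      have A': "A' - {w} = A - {w}" unfolding A'_def by auto
      have transfer: "U' \<subseteq> A \<or> U' \<inter> A = {}"
        if U: "w \<notin> U'" "U' \<subseteq> U" "A' - {w} = A - {w}" "U \<subseteq> A' \<or> U \<inter> A' = {}" for U U'
        using U(4)
      proof
        assume "U \<subseteq> A'"
        then have "U' \<subseteq> A - {w}" unfolding U(3)[symmetric] using U(1,2) by blast
        then show ?thesis by blast
      next
        assume "U \<inter> A' = {}"
        then have "U' \<inter> (A - {w}) = {}" unfolding U(3)[symmetric] using U(2) by blast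
        then show ?thesis using U(1) by blast
      qed
      show ?thesis by (rule transfer[OF nw sub A' all])
    next
      case False
      have "card (verts \<sigma>) \<noteq> 0" using \<tau>(5) verts(2)[OF \<tau>(2)] by simp
      then have "card (verts \<sigma>) = 2" using False card small[OF \<tau>(1)] by simp
      then obtain a b where ab: "verts \<sigma> = {a, b}" "a \<noteq> b" by (auto simp: card_2_iff)
      then have \<tau>v: "verts \<tau> = {v, a, b}" "v \<noteq> a" "v \<noteq> b" using \<tau>(3,4) by auto
      have edge: "v \<in> A \<longleftrightarrow> u \<in> A" if u: "u \<in> {a, b}" for u
      proof -
        have e: "convex hull {v, u} \<in> C" "verts (convex hull {v, u}) = {v, u}"
          using verts_subset_face[OF \<tau>(1), of "{v, u}"] \<tau>v(1) u by auto
        then have "convex hull {v, u} \<noteq> \<sigma>" "convex hull {v, u} \<noteq> \<tau>"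
          using ab \<tau>v u by auto
        then have "convex hull {v, u} \<in> deletion C \<sigma>" using e(1) \<tau>(6) by blast
        then show ?thesis using A e(2) by force
      qed
      have "verts F \<subseteq> A \<or> verts F \<inter> A = {}" if F: "F \<in> C" for F
      proof (cases "F = \<sigma> \<or> F = \<tau>")
        case True
        then show ?thesis using ab(1) \<tau>v(1) edge[of a] edge[of b] by auto
      next
        case False
        then show ?thesis using A F \<tau>(6) by auto
      qed
      then have "\<Union>(verts ` C) \<subseteq> A \<or> \<Union>(verts ` C) \<inter> A = {}" using conn unfolding vertex_connected_def by blast
      moreover have "\<Union>(verts ` deletion C \<sigma>) \<subseteq> \<Union>(verts ` C)" unfolding \<tau>(6) by blast
      ultimately show ?thesis by blast
    qed
  qed
qed

text \<open>The flags of vertex, edge and triangle inside the triangles of \<open>E\<close> cannot disappear from the order complex of \<open>C\<close>: dropping the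
vertex or the edge leaves two choices to fill it in, and so does dropping the triangle, because no edge is free.\<close>

lemma no_triangle:
  assumes van: "vanishes {K. flag K}"
    and small: "\<And>F. F \<in> C \<Longrightarrow> card (verts F) \<le> 3"
    and E: "simplicial_complex E" "E \<subseteq> C"
    and full: "\<And>F G. F \<in> E \<Longrightarrow> F \<noteq> {} \<Longrightarrow> G \<in> E \<Longrightarrow> F \<subset> G \<Longrightarrow> \<exists>G'\<in>E. F \<subset> G' \<and> G' \<noteq> G"
    and T: "T \<in> E"
  shows "card (verts T) \<noteq> 3"
proof
  assume T3: "card (verts T) = 3"
  interpret E: geometric_complex E by unfold_locales (rule E(1))
  define n where "n F = card (verts F)" for F :: "'a set"
  have n_mono: "n F < n G" if "F \<in> C" "G \<in> C" "F \<subset> G" for F G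
  proof -
    have "verts F \<subset> verts G" using verts_subset_iff[OF that(1,2)] verts_eq_iff[OF that(1,2)] that(3) by blast
    then show ?thesis unfolding n_def by (rule psubset_card_mono[OF verts(2)[OF that(2)]])
  qed
  define Z where "Z = {{F1, F2, F3} | F1 F2 F3. F1 \<in> E \<and> F2 \<in> E \<and> F3 \<in> E \<and> F1 \<subset> F2 \<and> F2 \<subset> F3 \<and>
    n F1 = 1 \<and> n F2 = 2 \<and> n F3 = 3}"
  have ZI: "{F1, F2, F3} \<in> Z"
    if "F1 \<in> E" "F2 \<in> E" "F3 \<in> E" "F1 \<subset> F2" "F2 \<subset> F3" "n F1 = 1" "n F2 = 2" "n F3 = 3" for F1 F2 F3
    unfolding Z_def by (rule CollectI, rule exI[of _ F1], rule exI[of _ F2], rule exI[of _ F3]) (simp add: that)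
  have edge: "\<exists>e\<in>E. verts e = S \<and> e \<subseteq> F" if "F \<in> E" "S \<subseteq> verts F" for F S
    using E.verts_subset_face[OF that] E.verts_subset_iff[of "convex hull S" F] that by metis
  have psub: "F \<subset> G" if "F \<in> E" "G \<in> E" "verts F \<subset> verts G" for F G
    using E.verts_subset_iff[OF that(1,2)] that(3) by blast
  have "Z = {}"
  proof (rule vanishes_no_closed_part[OF van])
    show "Z \<subseteq> {K. flag K}"
    proof
      fix z assume "z \<in> Z"
      then obtain F1 F2 F3 where z: "z = {F1, F2, F3}" "F1 \<in> E" "F2 \<in> E" "F3 \<in> E" "F1 \<subset> F2" "F2 \<subset> F3" "n F1 = 1"
        unfolding Z_def by blast
      have "F1 \<noteq> {}" using z(7) E.verts_empty_iff[OF z(2)] unfolding n_def by auto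
      then show "z \<in> {K. flag K}"
        unfolding subset_chain_def z(1) using z(2-6) E(2) by auto
    qed
    show "u = z" if zu: "z \<in> Z" "u \<in> {K. flag K}" "z \<subseteq> u" for z u
    proof -
      obtain F1 F2 F3 where z: "z = {F1, F2, F3}" "n F1 = 1" "n F2 = 2" "n F3 = 3"
        using zu(1) unfolding Z_def by blast
      have "G \<in> z" if G: "G \<in> u" for G
      proof -
        have GC: "G \<in> C" "G \<noteq> {}" using zu(2) G unfolding subset_chain_def by auto
        have "n G \<noteq> 0" using verts_empty_iff[OF GC(1)] verts(2)[OF GC(1)] GC(2) unfolding n_def by simp
        moreover have "n G \<le> 3" using small[OF GC(1)] unfolding n_def .
        ultimately have "n G = 1 \<or> n G = 2 \<or> n G = 3" by linarith
        then have "n F1 = n G \<or> n F2 = n G \<or> n F3 = n G" unfolding z(2-4) by metis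
        moreover have "F1 \<in> z" "F2 \<in> z" "F3 \<in> z" unfolding z(1) by simp_all
        ultimately obtain F where F: "F \<in> z" "n F = n G" by blast
        then have "F \<in> u" using zu(3) by blast
        then have "F \<in> C" "F \<subseteq> G \<or> G \<subseteq> F" using zu(2) G unfolding subset_chain_def by auto
        then have "F = G" using n_mono[of F G] n_mono[of G F] GC(1) F(2) by auto
        then show ?thesis using F(1) by simp
      qed
      then show ?thesis using zu(3) by blast
    qed
    show "\<exists>z'\<in>Z. z' \<noteq> z \<and> z - {x} \<subseteq> z'" if zx: "z \<in> Z" "x \<in> z" for z x
    proof -
      obtain F1 F2 F3 where z: "z = {F1, F2, F3}" and F: "F1 \<in> E" "F2 \<in> E" "F3 \<in> E" "F1 \<subset> F2" "F2 \<subset> F3"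
        and n: "n F1 = 1" "n F2 = 2" "n F3 = 3"
        using zx(1) unfolding Z_def by blast
      have sub: "verts F1 \<subseteq> verts F2" "verts F2 \<subseteq> verts F3"
        using E.verts_subset_iff F by blast+
      obtain a where a: "verts F1 = {a}" using n(1) unfolding n_def by (auto simp: card_1_singleton_iff)
      have "card (verts F2 - {a}) = 1" using n(2) sub(1) a unfolding n_def by simp
      then obtain b where "verts F2 - {a} = {b}" by (auto simp: card_1_singleton_iff)
      then have b: "verts F2 = {a, b}" "a \<noteq> b" using sub(1) a by auto
      have "card (verts F3 - {a, b}) = 1"
        using n(3) sub(2) b verts(2)[of F3] F(3) E(2) unfolding n_def by (simp add: card_Diff_subset)
      then obtain c where "verts F3 - {a, b} = {c}" by (auto simp: card_1_singleton_iff)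
      then have c: "verts F3 = {a, b, c}" "c \<noteq> a" "c \<noteq> b" using sub(2) b(1) by auto
      consider "x = F1" | "x = F2" | "x = F3" using zx(2) z by blast
      then show ?thesis
      proof cases
        case 1
        obtain G where G: "G \<in> E" "verts G = {b}" using edge[OF F(2), of "{b}"] b by auto
        have "G \<subset> F2" by (rule psub[OF G(1) F(2)]) (use G(2) b in auto)
        moreover have "n G = 1" using G(2) unfolding n_def by simp
        ultimately have "{G, F2, F3} \<in> Z" by (intro ZI G(1) F n)
        moreover have "G \<noteq> F1" "G \<noteq> F2" "G \<noteq> F3" using G(2) a b c by auto
        moreover have "F1 \<noteq> F2" "F1 \<noteq> F3" using n by auto
        ultimately show ?thesis unfolding z 1 by (intro bexI[of _ "{G, F2, F3}"]) blast+
      next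
        case 2
        obtain G where G: "G \<in> E" "verts G = {a, c}" using edge[OF F(3), of "{a, c}"] c by auto
        have "F1 \<subset> G" by (rule psub[OF F(1) G(1)]) (use G(2) a c in auto)
        moreover have "G \<subset> F3" by (rule psub[OF G(1) F(3)]) (use G(2) b c in auto)
        moreover have "n G = 2" using G(2) c unfolding n_def by simp
        ultimately have "{F1, G, F3} \<in> Z" by (intro ZI G(1) F n)
        moreover have "G \<noteq> F2" "G \<noteq> F1" "G \<noteq> F3" using G(2) a b c by auto
        moreover have "F1 \<noteq> F2" "F2 \<noteq> F3" using n by auto
        ultimately show ?thesis unfolding z 2 by (intro bexI[of _ "{F1, G, F3}"]) blast+
      next
        case 3
        have "F2 \<noteq> {}" using b(1) E.verts_empty_iff[OF F(2)] by auto
        then obtain G where G: "G \<in> E" "F2 \<subset> G" "G \<noteq> F3" using full[OF F(2) _ F(3,5)] by blast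
        have "n F2 < n G" "n G \<le> 3" using n_mono[of F2 G] small[of G] G(1,2) F(2) E(2) unfolding n_def by blast+
        then have "n G = 3" using n(2) by simp
        then have "{F1, F2, G} \<in> Z" by (intro ZI G(1,2) F n)
        moreover have "F1 \<noteq> F3" "F2 \<noteq> F3" using n by auto
        ultimately show ?thesis unfolding z 3 using G(3) by (intro bexI[of _ "{F1, F2, G}"]) blast+
      qed
    qed
  qed
  moreover have "Z \<noteq> {}"
  proof -
    obtain a b c where abc: "verts T = {a, b, c}" "a \<noteq> b" "b \<noteq> c" "a \<noteq> c"
      using T3 by (auto simp: card_3_iff)
    obtain F2 where F2: "F2 \<in> E" "verts F2 = {a, b}" using edge[OF T, of "{a, b}"] abc by auto
    obtain F1 where F1: "F1 \<in> E" "verts F1 = {a}" using edge[OF F2(1), of "{a}"] F2 by auto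
    have "F1 \<subset> F2" by (rule psub[OF F1(1) F2(1)]) (use F1 F2 abc in auto)
    moreover have "F2 \<subset> T" by (rule psub[OF F2(1) T]) (use F2 abc in auto)
    moreover have "n F1 = 1" "n F2 = 2" "n T = 3" using F1 F2 abc unfolding n_def by auto
    ultimately have "{F1, F2, T} \<in> Z" by (intro ZI F1(1) F2(1) T)
    then show ?thesis by blast
  qed
  ultimately show False by blast
qed

text \<open>There is one vertex more than there are edges, so the degrees, which sum to twice the number of edges, cannot all be at least two.
As degree one would make the vertex free, some vertex is isolated, and by connectedness it is the only one.\<close>

lemma terminal_graph_is_point:
  assumes small: "\<And>F. F \<in> C \<Longrightarrow> card (verts F) \<le> 2"
    and full: "\<And>F G. F \<in> C \<Longrightarrow> F \<noteq> {} \<Longrightarrow> G \<in> C \<Longrightarrow> F \<subset> G \<Longrightarrow> \<exists>G'\<in>C. F \<subset> G' \<and> G' \<noteq> G"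
    and conn: vertex_connected and sum: "face_sum C = 0"
    and ne: "C \<noteq> {}"
  obtains v where "C = {{}, {v}}"
proof -
  define V where "V = {F \<in> C. card (verts F) = 1}"
  define E where "E = {F \<in> C. card (verts F) = 2}"
  have fin: "finite V" "finite E" unfolding V_def E_def using finite_C by auto
  have "card (verts F) = 0 \<longleftrightarrow> F = {}" if "F \<in> C" for F
    using verts_empty_iff[OF that] verts(2)[OF that] by simp
  then have C: "C = insert {} (V \<union> E)"
    unfolding V_def E_def using small empty_mem[OF ne] by (auto simp: le_Suc_eq numeral_2_eq_2)
  have disj: "{} \<notin> V \<union> E" "V \<inter> E = {}"
    using verts_empty_iff[OF empty_mem[OF ne]] unfolding V_def E_def by auto
  have "face_sum C = 1 + (face_sum V + face_sum E)"
    unfolding C using fin disj verts_empty_iff[OF empty_mem[OF ne]] by (simp add: sum.union_disjoint)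
  also have "face_sum V = - int (card V)" unfolding V_def by simp
  also have "face_sum E = int (card E)" unfolding E_def by simp
  finally have VE: "card V = card E + 1" using sum by linarith
  define deg where "deg v = card {e \<in> E. v \<subset> e}" for v
  have deg: "deg v \<noteq> 1" if v: "v \<in> V" for v
  proof
    assume "deg v = 1"
    then obtain e where e: "{e \<in> E. v \<subset> e} = {e}" unfolding deg_def by (auto simp: card_1_singleton_iff)
    have vC: "v \<in> C" "v \<noteq> {}" using v disj unfolding V_def by auto
    have eC: "e \<in> C" "v \<subset> e" using e unfolding E_def by auto
    obtain e' where e': "e' \<in> C" "v \<subset> e'" "e' \<noteq> e" using full[OF vC eC] by blast
    have "verts v \<subset> verts e'" using verts_subset_iff[OF vC(1) e'(1)] verts_eq_iff[OF vC(1) e'(1)] e'(2) by blast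
    then have "card (verts v) < card (verts e')" by (rule psubset_card_mono[OF verts(2)[OF e'(1)]])
    then have "e' \<in> E" unfolding E_def using e'(1) small[OF e'(1)] v unfolding V_def by simp
    then show False using e e'(2,3) by blast
  qed
  have two: "card {v \<in> V. v \<subset> e} = 2" if e: "e \<in> E" for e
  proof -
    have eC: "e \<in> C" "card (verts e) = 2" using e unfolding E_def by auto
    obtain a b where ab: "verts e = {a, b}" "a \<noteq> b" using eC(2) by (auto simp: card_2_iff)
    have pt: "convex hull {u} \<in> C" "verts (convex hull {u}) = {u}" if "u \<in> {a, b}" for u
      using verts_subset_face[OF eC(1), of "{u}"] ab(1) that by auto
    have "{v \<in> V. v \<subset> e} = {{a}, {b}}"
    proof (intro subset_antisym subsetI)
      fix v assume "v \<in> {v \<in> V. v \<subset> e}"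
      then have v: "v \<in> C" "card (verts v) = 1" "v \<subseteq> e" unfolding V_def by auto
      obtain u where u: "verts v = {u}" using v(2) by (auto simp: card_1_singleton_iff)
      then have "u \<in> {a, b}" using verts_subset_iff[OF v(1) eC(1)] v(3) ab(1) by auto
      moreover have "v = {u}" using verts(3)[OF v(1)] u by simp
      ultimately show "v \<in> {{a}, {b}}" by auto
    next
      fix v assume "v \<in> {{a}, {b}}"
      then obtain u where u: "v = {u}" "u \<in> {a, b}" by blast
      have v: "v \<in> C" "verts v = {u}" using pt[OF u(2)] u(1) by auto
      then have "v \<subseteq> e" using verts_subset_iff[OF v(1) eC(1)] ab(1) u(2) by auto
      moreover have "v \<noteq> e" using v(2) ab by auto
      ultimately show "v \<in> {v \<in> V. v \<subset> e}" unfolding V_def using v by auto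
    qed
    then show ?thesis using ab(2) by simp
  qed
  have "sum deg V = (\<Sum>v\<in>V. \<Sum>e\<in>E. if v \<subset> e then 1 else 0)"
    unfolding deg_def using fin(2) by (simp add: sum.If_cases Int_def)
  also have "\<dots> = (\<Sum>e\<in>E. \<Sum>v\<in>V. if v \<subset> e then 1 else 0)" by (rule sum.swap)
  also have "\<dots> = (\<Sum>e\<in>E. 2)"
  proof (rule sum.cong[OF refl])
    fix e assume "e \<in> E"
    then show "(\<Sum>v\<in>V. if v \<subset> e then 1 else 0) = (2::nat)"
      using two[of e] fin(1) by (simp add: sum.If_cases Int_def)
  qed
  finally have degsum: "sum deg V = 2 * card E" by simp
  obtain v where v: "v \<in> V" "deg v = 0"
  proof (rule ccontr)
    assume "\<not> thesis"
    then have "deg v \<noteq> 0" if "v \<in> V" for v using that \<open>\<And>v. v \<in> V \<Longrightarrow> deg v = 0 \<Longrightarrow> thesis\<close> by blast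
    then have "2 \<le> deg v" if "v \<in> V" for v using that deg[OF that] by (metis less_2_cases not_le One_nat_def)
    then have "(\<Sum>v\<in>V. 2) \<le> sum deg V" by (rule sum_mono)
    then show False using degsum VE by simp
  qed
  have vC: "v \<in> C" using v(1) unfolding V_def by simp
  obtain a where a: "verts v = {a}" using v(1) unfolding V_def by (auto simp: card_1_singleton_iff)
  have va: "v = {a}" using verts(3)[OF vC] a by simp
  have noE: "a \<notin> verts e" if e: "e \<in> E" for e
  proof
    assume "a \<in> verts e"
    have eC: "e \<in> C" using e unfolding E_def by simp
    have "v \<subseteq> e" using verts_subset_iff[OF vC eC] a \<open>a \<in> verts e\<close> by simp
    moreover have "v \<noteq> e" using v(1) e disj(2) by blast
    ultimately have "e \<in> {e \<in> E. v \<subset> e}" using e by blast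
    then show False using v(2) fin(2) unfolding deg_def by auto
  qed
  have "verts F \<subseteq> {a} \<or> verts F \<inter> {a} = {}" if F: "F \<in> C" for F
  proof -
    consider "F = {}" | "F \<in> V" | "F \<in> E" using F C by blast
    then show ?thesis
    proof cases
      case 1
      then show ?thesis using verts_empty_iff[OF F] by simp
    next
      case 2
      then obtain b where "verts F = {b}" unfolding V_def by (auto simp: card_1_singleton_iff)
      then show ?thesis by auto
    next
      case 3
      then show ?thesis using noE by blast
    qed
  qed
  then have "\<Union>(verts ` C) \<subseteq> {a} \<or> \<Union>(verts ` C) \<inter> {a} = {}" using conn unfolding vertex_connected_def by blast
  then have all: "verts F \<subseteq> {a}" if "F \<in> C" for F using that vC a by blast
  have "F = v" if F: "F \<in> V" for F
  proof -
    have FC: "F \<in> C" "card (verts F) = 1" using F unfolding V_def by auto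
    then have "verts F = {a}" using all[OF FC(1)] by (metis card.empty subset_singletonD zero_neq_one)
    then show ?thesis using verts_eq_iff[OF FC(1) vC] a by simp
  qed
  then have V: "V = {v}" using v(1) by blast
  then have "E = {}" using VE fin(2) by simp
  then show ?thesis using that[of a] C V va by simp
qed

text \<open>Take a complex of least size to which \<open>C\<close> collapses; it has no free face.\<close>

theorem starlike_plane_complex_collapsible:
  assumes dim: "DIM('a) = 2" and star: "starlike (\<Union>C)"
  shows "collapsible C"
proof -
  note van = starlike_chains_vanish[OF star]
  have ne: "C \<noteq> {}" using star unfolding starlike_def by auto
  have small: "card (verts F) \<le> 3" if "F \<in> C" for F
  proof -
    have "aff_dim (verts F) = int (card (verts F)) - 1"
      using verts(1)[OF that] by (simp add: affine_independent_iff_card)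
    then show ?thesis using aff_dim_le_DIM[of "verts F"] dim by simp
  qed
  have invariant: "geometric_complex E \<and> E \<subseteq> C \<and> E \<noteq> {} \<and> geometric_complex.vertex_connected E \<and>
      face_sum E = 0" if "collapses_to C E" for E
    using that unfolding collapses_to_def
  proof (induction rule: rtranclp_induct)
    case base
    show ?case
      using geometric_complex_axioms ne alternating_sum_faces[OF van ne]
        connected_imp_vertex_connected[OF starlike_imp_connected[OF star]] by blast
  next
    case (step E E')
    interpret E: geometric_complex E using step.IH by blast
    obtain \<sigma> where \<sigma>: "free_face E \<sigma>" "E' = deletion E \<sigma>"
      using step.hyps(2) unfolding elementary_collapse_def by blast
    have "geometric_complex E'"
      using elementary_collapse_subcomplex[OF E.complex step.hyps(2)] unfolding subcomplex_def
      by (simp add: geometric_complex_def)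
    moreover have "E' \<subseteq> C" using step.IH unfolding \<sigma>(2) deletion_def by blast
    moreover have "E' \<noteq> {}"
    proof -
      have "{} \<in> E'" unfolding \<sigma>(2) deletion_def
        using E.empty_mem step.IH \<sigma>(1) unfolding free_face_def by blast
      then show ?thesis by blast
    qed
    moreover have "geometric_complex.vertex_connected E'" "face_sum E' = 0"
      unfolding \<sigma>(2) using E.collapse_preserves[OF \<sigma>(1)] small step.IH by blast+
    ultimately show ?case by blast
  qed
  have "collapses_to C C" unfolding collapses_to_def by simp
  then obtain E where E: "collapses_to C E" "\<And>E'. collapses_to C E' \<Longrightarrow> card E \<le> card E'"
    using ex_has_least_nat[of "collapses_to C" C card] by blast
  interpret E: geometric_complex E using invariant[OF E(1)] by blast
  have inv: "E \<subseteq> C" "E \<noteq> {}" E.vertex_connected "face_sum E = 0"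
    using invariant[OF E(1)] by auto
  have no_free: "\<not> free_face E \<sigma>" for \<sigma>
  proof
    assume free: "free_face E \<sigma>"
    then have "collapses_to C (deletion E \<sigma>)"
      using E(1) rtranclp.rtrancl_into_rtrancl[of elementary_collapse C E "deletion E \<sigma>"]
      unfolding collapses_to_def by (auto simp: elementary_collapse_def)
    then have "card E \<le> card (deletion E \<sigma>)" by (rule E(2))
    moreover have "deletion E \<sigma> \<subset> E" using free unfolding deletion_def free_face_def by blast
    ultimately show False using psubset_card_mono[OF E.finite_C] by (meson not_le)
  qed
  have full: "\<exists>G'\<in>E. F \<subset> G' \<and> G' \<noteq> G" if "F \<in> E" "F \<noteq> {}" "G \<in> E" "F \<subset> G" for F G
    using no_free[of F] that unfolding free_face_def by metis
  have "card (verts F) \<le> 2" if "F \<in> E" for F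
    using no_triangle[OF van small E.complex inv(1) full that] small[of F] inv(1) that by force
  then obtain v where "E = {{}, {v}}"
    using E.terminal_graph_is_point[OF _ full inv(3,4,2)] by blast
  then show ?thesis using E(1) unfolding collapsible_def by blast
qed

end

section \<open>Convex, star-shaped and collapsible complexes\<close>

lemma iterated_derived_subdivision_complex:
  assumes "simplicial_complex C" "iterated_derived_subdivision m C D"
  shows "simplicial_complex D \<and> \<Union>D = \<Union>C"
  using assms(2)
proof (induction m arbitrary: D)
  case 0
  then show ?case using assms(1) by (simp add: iterated_derived_subdivision_def)
next
  case (Suc m)
  then obtain E where E: "iterated_derived_subdivision m C E" "derived_subdivision E D"
    unfolding iterated_derived_subdivision_def by (auto elim: relpowp_Suc_E)
  then have IH: "simplicial_complex E" "\<Union>E = \<Union>C" using Suc.IH by blast+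
  obtain p where pD: "derived_complex E p" "D = derived_complex.sd E p"
    by (rule derived_subdivisionE[OF IH(1) E(2)])
  interpret derived_complex E p by (rule pD(1))
  show ?case using sd_simplicial_complex Union_sd IH(2) pD(2) by simp
qed

lemma starlike_derived_subdivision_collapsible:
  assumes "simplicial_complex C" "starlike (\<Union>C)" "derived_subdivision C D"
  shows "collapsible D"
proof -
  obtain p where pD: "derived_complex C p" "D = derived_complex.sd C p"
    by (rule derived_subdivisionE[OF assms(1,3)])
  interpret derived_complex C p by (rule pD(1))
  show ?thesis using starlike_collapsible[OF assms(2)] pD(2) by simp
qed

text \<open>In dimension at least three the last of the \<open>d - 2\<close> subdivisions is applied to a star-shaped complex; in dimension two there is
none.\<close>

theorem theorem1:
  fixes C :: "'a::euclidean_space set set"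
  assumes "simplicial_complex C" and "\<Union>C \<noteq> {}"
  shows "(convex (\<Union>C) \<longrightarrow> (\<forall>D. derived_subdivision C D \<longrightarrow> collapsible D)) \<and>
    (DIM('a) \<ge> 2 \<and> starlike (\<Union>C) \<longrightarrow>
       (\<forall>D. iterated_derived_subdivision (DIM('a) - 2) C D \<longrightarrow> collapsible D)) \<and>
    (\<forall>C' D D'. subcomplex C' C \<and> collapses_to C C' \<and>
       simplicial_subdivision C D \<and> derived_subdivision D D' \<longrightarrow>
       collapses_to D' (restriction D' (\<Union>C')))"
proof (intro conjI impI allI)
  fix D assume "convex (\<Union>C)" "derived_subdivision C D"
  then show "collapsible D"
    using starlike_derived_subdivision_collapsible assms convex_imp_starlike by blast
next
  fix D assume star: "2 \<le> DIM('a) \<and> starlike (\<Union>C)" and D: "iterated_derived_subdivision (DIM('a) - 2) C D"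
  show "collapsible D"
  proof (cases "DIM('a) = 2")
    case True
    interpret geometric_complex C by unfold_locales (rule assms(1))
    have "D = C" using D True by (simp add: iterated_derived_subdivision_def)
    then show ?thesis using starlike_plane_complex_collapsible[OF True] star by simp
  next
    case False
    then obtain k where "DIM('a) - 2 = Suc k" using star by (metis Suc_diff_Suc le_neq_implies_less)
    then obtain E where E: "iterated_derived_subdivision k C E" "derived_subdivision E D"
      using D unfolding iterated_derived_subdivision_def by (auto elim: relpowp_Suc_E)
    then show ?thesis
      using iterated_derived_subdivision_complex[OF assms(1) E(1)] star
        starlike_derived_subdivision_collapsible[OF _ _ E(2)] by simp
  qed
next
  fix C' D D'
  assume *: "subcomplex C' C \<and> collapses_to C C' \<and> simplicial_subdivision C D \<and> derived_subdivision D D'"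
  then have D: "simplicial_complex D" "\<Union>D = \<Union>C" "\<forall>F\<in>D. \<exists>G\<in>C. F \<subseteq> G"
    unfolding simplicial_subdivision_def by auto
  obtain p where pD: "derived_complex D p" "D' = derived_complex.sd D p"
    using derived_subdivisionE[OF D(1)] * by blast
  interpret D: derived_complex D p by (rule pD(1))
  interpret subdivided_complex C D p by unfold_locales (use assms(1) D in auto)
  show "collapses_to D' (restriction D' (\<Union>C'))"
    using sd_collapses_to_restriction * pD(2) by blast
qed

end
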